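(* Let $\mathbf A=\begin{pmatrix}1&1\\1&1\end{pmatrix}$ and let $\mathcal{C}=L_2(\Sigma_{\mathbf A}^+;\mathbb{R})$ be the set of real-valued 2-locally constant functions on $\Sigma_{\mathbf A}^+$. Then $$\{f\in\mathcal{C}:[f]_3=[f]_1\}=E,$$ where $$E=\{f\in\mathcal{C}: P(f)\ne P_1(\alpha)\text{ and }P(f)\ne P_2(\alpha)\text{ for any }\alpha\in(0,1)\text{ with }\alpha\ne 1/2\},$$ $$P_1(\alpha)=\begin{pmatrix}1-\alpha&\alpha\\1-\alpha&\alpha\end{pmatrix},\qquad P_2(\alpha)=\begin{pmatrix}1-\alpha&\alpha\\\alpha&1-\alpha\end{pmatrix}.$$
   Context: Let $N\ge 2$ and $\mathbf A$ an $N\times N$ aperiodic zero-one matrix (some power has all entries positive); here $N=2$. $\Sigma_{\mathbf A}^+=\{\omega=(\omega_n)_{n\ge 0}\in\{1,\dots,N\}^{\mathbb{N}\cup\{0\}}:\mathbf A_{\omega_n\omega_{n+1}}=1 \text{ for all } n\ge 0\}$, with metric $d(\omega,\omega')=\sum_{n\ge0}|\omega_n-\omega'_n|/2^n$; $\sigma_{\mathbf A}$ is the shift $(\sigma_{\mathbf A}\omega)_n=\omega_{n+1}$. A function $\phi$ on $\Sigma_{\mathbf A}^+$ is $n$-locally constant if $\phi(\omega)=\phi(\omega')$ whenever $\omega_k=\omega'_k$ for $0\le k\le n-1$. Cylinders: $C_n(\omega)=\{\omega'\in\Sigma_{\mathbf A}^+:\omega'_k=\omega_k,\ 0\le k\le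 n-1\}$, $C_0(\omega)=\Sigma_{\mathbf A}^+$. Gibbs measures: a $\sigma_{\mathbf A}$-invariant Borel probability measure $\mu$ is a Gibbs measure for continuous $f:\Sigma_{\mathbf A}^+\to\mathbb{R}$ if there are $C>0$, $P\in\mathbb{R}$ with $C^{-1}\le \mu(C_n(\omega))/\exp(-nP+\sum_{k=0}^{n-1}f(\sigma_{\mathbf A}^k\omega))\le C$ for all $\omega$ and $n\ge1$. Each Hölder continuous real $f$ (in particular each locally constant one) has a unique Gibbs measure $\mu_f$. Matrix $P(f)$: for $f\in L_2(\Sigma_{\mathbf A}^+;\mathbb{R})$ let $A(f)$ be the $N\times N$ matrix with $A(f)_{ij}=\exp(f(\omega))$ for any $\omega$ with $\omega_0=i,\omega_1=j$ if $\mathbf A_{ij}=1$, and $A(f)_{ij}=0$ otherwise. Let $\lambda_f$ be the Perron root (the positive eigenvalue strictly larger in modulus than all other eigenvalues) of $A(f)$, and $v$ a right eigenvector with positive entries, $A(f)v^{\mathrm T}=\lambda_f v^{\mathrm T}$. Then $P(f)_{ij}=\lambda_f^{-1}v_i^{-1}v_jA(f)_{ij}$ (a stochastic matrix, independent of the choice of $v$). Entropy spectrum: $E_\alpha^{(\mu)}=\{\omega:\lim_{n\to\infty}-\frac1n\log\mu(C_n(\omega))=\alpha\}$ and $\mathcal{E}^{(\mu)}(\alpha)=h(\sigma_{\mathbf A}|E_\alpha^{(\mu)})$ for $\alpha\in\mathbb{R}$. Here $h(\sigma_{\mathbf A}|Z)$ is Bowen's topological entropy of a subset $Z$: the infimum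 of all $s\ge0$ such that $\lim_{n\to\infty}\inf\sum_i e^{-s n_i}=0$, the infimum over countable covers of $Z$ by cylinders $C_{n_i}(\omega^{(i)})$ with all $n_i\ge n$; $h(\sigma_{\mathbf A}|\emptyset)=0$. Isomorphic: $(\Sigma_{\mathbf A}^+,\sigma_{\mathbf A},\mu_f)$ and $(\Sigma_{\mathbf A}^+,\sigma_{\mathbf A},\mu_g)$ are isomorphic if there exist Borel sets $X,Y\subset\Sigma_{\mathbf A}^+$ and a bijection $\Phi:X\to Y$ with $\sigma_{\mathbf A}(X)\subset X$, $\sigma_{\mathbf A}(Y)\subset Y$, $\mu_f(X)=\mu_g(Y)=1$; $\Phi,\Phi^{-1}$ Borel measurable; $\Phi\circ\sigma_{\mathbf A}=\sigma_{\mathbf A}\circ\Phi$ on $X$; $\mu_f=\mu_g\circ\Phi$ (i.e. $\mu_f(B)=\mu_g(\Phi(B))$ for Borel $B\subset X$). Classes: for $f\in\mathcal{C}$, $[f]_1=\{g\in\mathcal{C}:\mathcal{E}^{(\mu_f)}=\mathcal{E}^{(\mu_g)}\}$ and $[f]_3=\{g\in\mathcal{C}:(\Sigma_{\mathbf A}^+,\sigma_{\mathbf A},\mu_f)\text{ and }(\Sigma_{\mathbf A}^+,\sigma_{\mathbf A},\mu_g)\text{ are isomorphic}\}$. *)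

theory Defs
  imports "HOL-Probability.Probability" "Jordan_Normal_Form.Char_Poly"
begin

section \<open>Topological Markov shifts\<close>

text \<open>
  The alphabet is \<open>{1, \<dots>, N}\<close>, where \<open>N\<close> is the dimension of the zero-one transition matrix \<open>A\<close>.
  Symbols and matrix indices start at 1, whereas the entries of a \<^typ>\<open>'a mat\<close> are indexed from 0;
  \<open>entry\<close> and \<open>mat1\<close> translate.
\<close>

definition entry :: "'a mat \<Rightarrow> nat \<Rightarrow> nat \<Rightarrow> 'a" where
  "entry M i j = M $$ (i - 1, j - 1)"

definition mat1 :: "nat \<Rightarrow> (nat \<Rightarrow> nat \<Rightarrow> 'a) \<Rightarrow> 'a mat" where
  "mat1 N F = mat N N (\<lambda>(i, j). F (i + 1) (j + 1))"

definition shift_space :: "nat mat \<Rightarrow> (nat \<Rightarrow> nat) set" where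
  "shift_space A = {\<omega>. (\<forall>n. \<omega> n \<in> {1..dim_row A}) \<and> (\<forall>n. entry A (\<omega> n) (\<omega> (n + 1)) = 1)}"

definition shift :: "(nat \<Rightarrow> nat) \<Rightarrow> (nat \<Rightarrow> nat)" where
  "shift \<omega> = (\<lambda>n. \<omega> (n + 1))"

definition cylinder :: "nat mat \<Rightarrow> nat \<Rightarrow> (nat \<Rightarrow> nat) \<Rightarrow> (nat \<Rightarrow> nat) set" where
  "cylinder A n \<omega> = {\<omega>' \<in> shift_space A. \<forall>k<n. \<omega>' k = \<omega> k}"

text \<open>
  The locale \<^locale>\<open>Metric_space\<close> requires non-negativity of the distance on the whole type, also
  outside the carrier; the unordered sum, which is 0 when it diverges, has this property.
\<close>

definition shift_dist :: "(nat \<Rightarrow> nat) \<Rightarrow> (nat \<Rightarrow> nat) \<Rightarrow> real" where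
  "shift_dist \<omega> \<omega>' = (\<Sum>\<^sub>\<infinity>n. \<bar>real (\<omega> n) - real (\<omega>' n)\<bar> / 2 ^ n)"

lemma summable_on_shift_dist:
  assumes "\<omega> \<in> shift_space A" "\<omega>' \<in> shift_space A"
  shows "(\<lambda>n. \<bar>real (\<omega> n) - real (\<omega>' n)\<bar> / 2 ^ n) summable_on UNIV"
proof (rule norm_summable_imp_summable_on, rule summable_comparison_test)
  have "\<bar>real (\<omega> n) - real (\<omega>' n)\<bar> \<le> real (dim_row A)" for n
  proof -
    have "1 \<le> \<omega> n" "\<omega> n \<le> dim_row A" "1 \<le> \<omega>' n" "\<omega>' n \<le> dim_row A"
      using assms by (auto simp: shift_space_def)
    then show ?thesis by linarith
  qed
  then show "\<exists>N. \<forall>n\<ge>N. norm (norm (\<bar>real (\<omega> n) - real (\<omega>' n)\<bar> / 2 ^ n))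
      \<le> real (dim_row A) * (1 / 2) ^ n"
    by (auto simp: power_divide divide_right_mono)
  show "summable (\<lambda>n. real (dim_row A) * (1 / 2) ^ n)"
    by (intro summable_mult summable_geometric) simp
qed

lemma Metric_space_shift_dist: "Metric_space (shift_space A) shift_dist"
proof
  show "0 \<le> shift_dist x y" for x y
    unfolding shift_dist_def by (rule infsum_nonneg) simp
  show "shift_dist x y = shift_dist y x" for x y
    by (simp add: shift_dist_def abs_minus_commute)
  show "shift_dist x y = 0 \<longleftrightarrow> x = y" if "x \<in> shift_space A" "y \<in> shift_space A" for x y
  proof
    assume "shift_dist x y = 0"
    then have "\<bar>real (x n) - real (y n)\<bar> / 2 ^ n = 0" for n
      using nonneg_infsum_le_0D[OF _ summable_on_shift_dist[OF that], of n]
      by (simp add: shift_dist_def)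
    then show "x = y" by auto
  qed (simp add: shift_dist_def)
  show "shift_dist x z \<le> shift_dist x y + shift_dist y z"
    if "x \<in> shift_space A" "y \<in> shift_space A" "z \<in> shift_space A" for x y z
    unfolding shift_dist_def
    by (subst infsum_add[symmetric], (rule summable_on_shift_dist that)+,
        rule infsum_mono, (rule summable_on_shift_dist summable_on_add that)+)
       (simp add: add_divide_distrib[symmetric] divide_right_mono)
qed

definition shift_borel :: "nat mat \<Rightarrow> (nat \<Rightarrow> nat) measure" where
  "shift_borel A =
     sigma (shift_space A) {U. openin (Metric_space.mtopology (shift_space A) shift_dist) U}"

text \<open>
  \<open>n\<close>-locally constant real functions on \<open>shift_space A\<close>. A function on this set is represented by
  its unique extension to the whole type that is \<^const>\<open>undefined\<close> off the set, so that equality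
  is equality of functions on \<open>shift_space A\<close>.
\<close>

definition locally_constant :: "nat \<Rightarrow> nat mat \<Rightarrow> ((nat \<Rightarrow> nat) \<Rightarrow> real) set" where
  "locally_constant n A = {\<phi> \<in> extensional (shift_space A).
     \<forall>\<omega>\<in>shift_space A. \<forall>\<omega>'\<in>shift_space A. (\<forall>k<n. \<omega> k = \<omega>' k) \<longrightarrow> \<phi> \<omega> = \<phi> \<omega>'}"

section \<open>Gibbs measures\<close>

definition is_gibbs_measure ::
    "nat mat \<Rightarrow> ((nat \<Rightarrow> nat) \<Rightarrow> real) \<Rightarrow> (nat \<Rightarrow> nat) measure \<Rightarrow> bool" where
  "is_gibbs_measure A f \<mu> \<longleftrightarrow>
     prob_space \<mu> \<and> sets \<mu> = sets (shift_borel A) \<and>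
     (\<forall>B\<in>sets \<mu>. emeasure \<mu> (shift -` B \<inter> shift_space A) = emeasure \<mu> B) \<and>
     (\<exists>C>0. \<exists>P. \<forall>\<omega>\<in>shift_space A. \<forall>n\<ge>1.
        measure \<mu> (cylinder A n \<omega>) / exp (- real n * P + (\<Sum>k<n. f ((shift ^^ k) \<omega>))) \<in> {1 / C..C})"

text \<open>Gibbs measures exist and are unique for Hoelder continuous functions and aperiodic \<open>A\<close>.\<close>

definition gibbs_measure :: "nat mat \<Rightarrow> ((nat \<Rightarrow> nat) \<Rightarrow> real) \<Rightarrow> (nat \<Rightarrow> nat) measure" where
  "gibbs_measure A f = (THE \<mu>. is_gibbs_measure A f \<mu>)"

section \<open>The stochastic matrix of a 2-locally constant function\<close>

definition weight_matrix :: "nat mat \<Rightarrow> ((nat \<Rightarrow> nat) \<Rightarrow> real) \<Rightarrow> real mat" where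
  "weight_matrix A f = mat1 (dim_row A) (\<lambda>i j.
     if entry A i j = 1 then exp (f (SOME \<omega>. \<omega> \<in> shift_space A \<and> \<omega> 0 = i \<and> \<omega> 1 = j)) else 0)"

definition perron_root :: "real mat \<Rightarrow> real" where
  "perron_root M = (THE r. r > 0 \<and> eigenvalue (map_mat complex_of_real M) (complex_of_real r) \<and>
     (\<forall>z. eigenvalue (map_mat complex_of_real M) z \<and> z \<noteq> complex_of_real r \<longrightarrow> cmod z < r))"

definition perron_vector :: "real mat \<Rightarrow> real vec" where
  "perron_vector M = (SOME v. eigenvector M v (perron_root M) \<and> (\<forall>i<dim_vec v. v $ i > 0))"

definition stochastic_matrix :: "nat mat \<Rightarrow> ((nat \<Rightarrow> nat) \<Rightarrow> real) \<Rightarrow> real mat" where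
  "stochastic_matrix A f =
     (let M = weight_matrix A f; v = perron_vector M
      in mat (dim_row A) (dim_row A)
           (\<lambda>(i, j). inverse (perron_root M) * inverse (v $ i) * v $ j * M $$ (i, j)))"

section \<open>Bowen's topological entropy of a subset and the entropy spectrum\<close>

text \<open>
  A countable cover by cylinders is given by the set \<open>S\<close> of pairs of lengths and base points; \<open>S\<close>
  may be finite or empty. In particular the entropy of the empty set is 0.
\<close>

definition bowen_sum :: "nat mat \<Rightarrow> real \<Rightarrow> (nat \<Rightarrow> nat) set \<Rightarrow> nat \<Rightarrow> ennreal" where
  "bowen_sum A s Z n =
     (INF S \<in> {S. countable S \<and> S \<subseteq> {n..} \<times> shift_space A \<and> Z \<subseteq> (\<Union>(m, \<omega>)\<in>S. cylinder A m \<omega>)}.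
        \<Sum>\<^sub>\<infinity>(m, \<omega>)\<in>S. ennreal (exp (- s * real m)))"

definition bowen_entropy :: "nat mat \<Rightarrow> (nat \<Rightarrow> nat) set \<Rightarrow> real" where
  "bowen_entropy A Z = Inf {s. s \<ge> 0 \<and> bowen_sum A s Z \<longlonglongrightarrow> 0}"

lemma bowen_entropy_empty: "bowen_entropy A {} = 0"
proof -
  have "bowen_sum A s {} n = 0" for s n
  proof -
    have "bowen_sum A s {} n \<le> (\<Sum>\<^sub>\<infinity>(m, \<omega>::nat \<Rightarrow> nat)\<in>{}. ennreal (exp (- s * real m)))"
      unfolding bowen_sum_def by (rule INF_lower) auto
    then show ?thesis by simp
  qed
  then have "bowen_sum A s {} = (\<lambda>_. 0)" for s by auto
  then have "bowen_entropy A {} = Inf {0..}"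
    by (simp add: bowen_entropy_def atLeast_def)
  then show ?thesis by simp
qed

definition entropy_level_set ::
    "nat mat \<Rightarrow> (nat \<Rightarrow> nat) measure \<Rightarrow> real \<Rightarrow> (nat \<Rightarrow> nat) set" where
  "entropy_level_set A \<mu> \<alpha> =
     {\<omega> \<in> shift_space A. (\<lambda>n. - (1 / real n) * ln (measure \<mu> (cylinder A n \<omega>))) \<longlonglongrightarrow> \<alpha>}"

definition entropy_spectrum :: "nat mat \<Rightarrow> (nat \<Rightarrow> nat) measure \<Rightarrow> real \<Rightarrow> real" where
  "entropy_spectrum A \<mu> = (\<lambda>\<alpha>. bowen_entropy A (entropy_level_set A \<mu> \<alpha>))"

section \<open>Isomorphism and the equivalence classes\<close>

definition shift_isomorphic :: "nat mat \<Rightarrow> (nat \<Rightarrow> nat) measure \<Rightarrow> (nat \<Rightarrow> nat) measure \<Rightarrow> bool" where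
  "shift_isomorphic A \<mu> \<nu> \<longleftrightarrow>
     (\<exists>X\<in>sets (shift_borel A). \<exists>Y\<in>sets (shift_borel A). \<exists>\<Phi>.
        bij_betw \<Phi> X Y \<and> shift ` X \<subseteq> X \<and> shift ` Y \<subseteq> Y \<and> measure \<mu> X = 1 \<and> measure \<nu> Y = 1 \<and>
        \<Phi> \<in> measurable (restrict_space (shift_borel A) X) (restrict_space (shift_borel A) Y) \<and>
        inv_into X \<Phi> \<in> measurable (restrict_space (shift_borel A) Y) (restrict_space (shift_borel A) X) \<and>
        (\<forall>\<omega>\<in>X. \<Phi> (shift \<omega>) = shift (\<Phi> \<omega>)) \<and>
        (\<forall>B\<in>sets (shift_borel A). B \<subseteq> X \<longrightarrow> emeasure \<mu> B = emeasure \<nu> (\<Phi> ` B)))"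

text \<open>The set \<open>\<C>\<close> is the ambient class of functions in which the equivalence classes are formed.\<close>

definition spectrum_class ::
    "nat mat \<Rightarrow> ((nat \<Rightarrow> nat) \<Rightarrow> real) set \<Rightarrow> ((nat \<Rightarrow> nat) \<Rightarrow> real) \<Rightarrow> ((nat \<Rightarrow> nat) \<Rightarrow> real) set" where
  "spectrum_class A \<C> f =
     {g \<in> \<C>. entropy_spectrum A (gibbs_measure A f) = entropy_spectrum A (gibbs_measure A g)}"

definition isomorphism_class ::
    "nat mat \<Rightarrow> ((nat \<Rightarrow> nat) \<Rightarrow> real) set \<Rightarrow> ((nat \<Rightarrow> nat) \<Rightarrow> real) \<Rightarrow> ((nat \<Rightarrow> nat) \<Rightarrow> real) set" where
  "isomorphism_class A \<C> f =
     {g \<in> \<C>. shift_isomorphic A (gibbs_measure A f) (gibbs_measure A g)}"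

end

theory Submission
  imports Defs
begin

text \<open>
  A 2-locally constant function \<open>f\<close> is cohomologous to \<open>ln P(f)\<close> up to a constant, so its Gibbs measure
  is the stationary Markov measure with transition matrix \<open>P(f)\<close>, which is given by its diagonal
  entries \<open>x\<close>, \<open>y\<close>. The endpoints of the support of the entropy spectrum are determined by the largest
  and the smallest of the mean cycle weights \<open>x\<close>, \<open>y\<close>, \<open>sqrt ((1 - x) * (1 - y))\<close>, and the place where
  it attains its maximum \<open>ln 2\<close> is determined by the product \<open>x * y * (1 - x) * (1 - y)\<close>. These three
  numbers determine \<open>{x, y}\<close> unless \<open>x + y = 1\<close> or \<open>x = y\<close>. An isomorphism preserves the Jacobian of
  the shift, and under the same condition the distribution of the Jacobian determines \<open>{x, y}\<close>. Since
  exchanging the symbols is an isomorphism that exchanges \<open>x\<close> and \<open>y\<close>, both classes of \<open>f\<close> coincide in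
  the generic case. In the exceptional case, recording whether consecutive symbols agree maps the
  symmetric chain two-to-one onto a Bernoulli shift, so that both have the same spectrum. They are
  not isomorphic, because the Jacobians along an orbit determine the point for the Bernoulli
  measure, whereas for the symmetric chain they do not change when the symbols are exchanged.
\<close>

section \<open>The full shift on two symbols\<close>

text \<open>No variational formula for the spectrum is proved. Only three facts are used: level sets
  outside the range of the mean cycle weights are empty, the entropy is positive arbitrarily close
  to each mean cycle weight, and a value of at least \<open>ln 2\<close> occurs at a single point.
  Nearness matters, since the entropy at an endpoint itself may vanish; free concatenation of two
  blocks of equal weight supplies the positivity. The maximum is located by the uniform measure:
  almost every sequence has the mean transition weight as its average, while any other average
  restricts words to an exponentially small fraction. That mean is
  \<open>- ln (x * y * ((1 - x) * (1 - y))) / 4\<close>, which is where the product comes from. On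
  the measure side, a stationary two-state chain is reversible, so the Jacobian is an entry of the
  transition matrix. Since \<open>gibbs_measure\<close> is a definite description, uniqueness has to
  be established before anything can be said about it; this is done by a quadratic energy
  argument.\<close>

definition full_mat :: "nat mat" where
  "full_mat = mat_of_rows_list 2 [[1, 1], [1, 1]]"

definition \<Omega> :: "(nat \<Rightarrow> nat) set" where
  "\<Omega> = {w. \<forall>n. w n \<in> {1, 2}}"

abbreviation cyl :: "nat \<Rightarrow> (nat \<Rightarrow> nat) \<Rightarrow> (nat \<Rightarrow> nat) set" where
  "cyl \<equiv> cylinder full_mat"

abbreviation \<B> :: "(nat \<Rightarrow> nat) measure" where
  "\<B> \<equiv> shift_borel full_mat"

lemma dim_full_mat [simp]: "dim_row full_mat = 2" "dim_col full_mat = 2"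
  by (simp_all add: full_mat_def mat_of_rows_list_def)

lemma entry_full_mat: "i \<in> {1, 2} \<Longrightarrow> j \<in> {1, 2} \<Longrightarrow> entry full_mat i j = 1"
  by (auto simp: entry_def full_mat_def mat_of_rows_list_def)

lemma shift_space_full_mat [simp]: "shift_space full_mat = \<Omega>"
proof -
  have "w n \<in> {1..2} \<longleftrightarrow> w n \<in> {1, 2}" for w :: "nat \<Rightarrow> nat" and n
    by auto
  then show ?thesis
    unfolding shift_space_def \<Omega>_def using entry_full_mat by auto
qed

lemma \<Omega>_cases: "w \<in> \<Omega> \<Longrightarrow> w n = 1 \<or> w n = 2"
  by (auto simp: \<Omega>_def)

lemma cyl_def: "cyl n w = {w' \<in> \<Omega>. \<forall>k<n. w' k = w k}"
  by (simp add: cylinder_def)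

lemma cyl_0 [simp]: "cyl 0 w = \<Omega>"
  by (simp add: cyl_def)

lemma cyl_subset: "cyl n w \<subseteq> \<Omega>"
  by (auto simp: cyl_def)

lemma cyl_cong: "(\<And>k. k < n \<Longrightarrow> w k = w' k) \<Longrightarrow> cyl n w = cyl n w'"
  by (auto simp: cyl_def)

lemma self_in_cyl: "w \<in> \<Omega> \<Longrightarrow> w \<in> cyl n w"
  by (simp add: cyl_def)

lemma shift_in_\<Omega>: "w \<in> \<Omega> \<Longrightarrow> shift w \<in> \<Omega>"
  by (auto simp: \<Omega>_def shift_def)

lemma shift_funpow: "(shift ^^ k) w = (\<lambda>n. w (n + k))"
  by (induction k arbitrary: w) (auto simp: shift_def funpow_swap1)

lemma shift_case_nat [simp]: "shift (case_nat i w) = w"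
  by (simp add: shift_def)

lemma case_nat_shift: "case_nat (w 0) (shift w) = w"
  by (auto simp: shift_def fun_eq_iff split: nat.splits)

lemma case_nat_in_\<Omega>: "i \<in> {1, 2} \<Longrightarrow> w \<in> \<Omega> \<Longrightarrow> case_nat i w \<in> \<Omega>"
  by (auto simp: \<Omega>_def split: nat.splits)

lemma upd_in_\<Omega>: "i \<in> {1, 2} \<Longrightarrow> w \<in> \<Omega> \<Longrightarrow> w(n := i) \<in> \<Omega>"
  by (auto simp: \<Omega>_def)

text \<open>A common point can serve as base point of both cylinders, and then the longer one lies
  inside the shorter. This makes the cylinders a generator stable under intersection.\<close>

lemma cyl_Int: "cyl n w \<inter> cyl m w' \<in> {{}, cyl n w, cyl m w'}"
proof (cases "cyl n w \<inter> cyl m w' = {}")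
  case False
  then obtain \<eta> where \<eta>: "\<eta> \<in> cyl n w" "\<eta> \<in> cyl m w'"
    by auto
  then have eq: "cyl n w = cyl n \<eta>" "cyl m w' = cyl m \<eta>"
    by (auto simp: cyl_def)
  show ?thesis
  proof (cases "n \<le> m")
    case True
    then have "cyl n \<eta> \<inter> cyl m \<eta> = cyl m \<eta>"
      by (auto simp: cyl_def)
    then show ?thesis by (simp add: eq)
  next
    case False
    then have "cyl n \<eta> \<inter> cyl m \<eta> = cyl n \<eta>"
      by (auto simp: cyl_def)
    then show ?thesis by (simp add: eq)
  qed
qed simp

lemma cyl_split: "cyl n w = cyl (Suc n) (w(n := 1)) \<union> cyl (Suc n) (w(n := 2))"
  by (auto simp: cyl_def less_Suc_eq \<Omega>_def)

lemma cyl_split_disjoint: "cyl (Suc n) (w(n := 1)) \<inter> cyl (Suc n) (w(n := 2)) = {}"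
  by (auto simp: cyl_def)

lemma vimage_shift_cyl:
  "shift -` cyl n w \<inter> \<Omega> = cyl (Suc n) (case_nat 1 w) \<union> cyl (Suc n) (case_nat 2 w)"
proof -
  have "(shift \<eta> \<in> \<Omega> \<and> (\<forall>k<n. shift \<eta> k = w k)) \<longleftrightarrow>
      (\<forall>k<Suc n. \<eta> k = case_nat 1 w k) \<or> (\<forall>k<Suc n. \<eta> k = case_nat 2 w k)" if "\<eta> \<in> \<Omega>" for \<eta>
    using shift_in_\<Omega>[OF that] \<Omega>_cases[OF that, of 0]
    by (auto simp: All_less_Suc2 shift_def)
  then have "\<eta> \<in> shift -` cyl n w \<inter> \<Omega> \<longleftrightarrow>
      \<eta> \<in> cyl (Suc n) (case_nat 1 w) \<union> cyl (Suc n) (case_nat 2 w)" for \<eta>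
    unfolding cyl_def vimage_def by blast
  then show ?thesis
    by blast
qed

lemma vimage_shift_cyl_disjoint: "cyl n (case_nat 1 w) \<inter> cyl n (case_nat 2 w) = {}" if "n > 0"
  using that by (auto simp: cyl_def)

subsection \<open>Words\<close>

text \<open>A word of length \<open>n\<close> is represented by its continuation with the symbol 1.\<close>

definition words :: "nat \<Rightarrow> (nat \<Rightarrow> nat) set" where
  "words n = {w \<in> \<Omega>. \<forall>k\<ge>n. w k = 1}"

lemma words_subset: "words n \<subseteq> \<Omega>"
  by (auto simp: words_def)

lemma words_0: "words 0 = {\<lambda>_. 1}"
  by (auto simp: words_def \<Omega>_def)

lemma sum_words_Suc: "(\<Sum>w\<in>words (Suc n). F w) = (\<Sum>w\<in>words n. F (w(n := 1)) + F (w(n := 2)))"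
  and finite_words_Suc: "finite (words n) \<Longrightarrow> finite (words (Suc n))"
proof -
  let ?u = "\<lambda>i w. w(n := i) :: nat \<Rightarrow> nat"
  have sub: "?u i w \<in> words (Suc n)" if "i \<in> {1, 2}" "w \<in> words n" for i w
    using that by (auto simp: words_def upd_in_\<Omega>)
  have *: "words (Suc n) = ?u 1 ` words n \<union> ?u 2 ` words n"
  proof (intro equalityI subsetI)
    fix w assume w: "w \<in> words (Suc n)"
    then have "w(n := 1) \<in> words n" "w = (w(n := 1))(n := w n)"
      by (auto simp: words_def upd_in_\<Omega> not_less_eq_eq[symmetric] le_Suc_eq)
    moreover have "w n = 1 \<or> w n = 2"
      using w \<Omega>_cases[of w n] by (auto simp add: words_def)
    ultimately show "w \<in> ?u 1 ` words n \<union> ?u 2 ` words n"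
      by (metis UnCI image_eqI)
  qed (use sub in auto)
  then show "finite (words n) \<Longrightarrow> finite (words (Suc n))"
    by simp
  have inj: "inj_on (?u i) (words n)" for i
  proof (rule inj_onI)
    fix w w' assume "w \<in> words n" "w' \<in> words n" and eq: "?u i w = ?u i w'"
    then have "w n = 1" "w' n = 1"
      by (auto simp: words_def)
    then show "w = w'"
      using eq by (metis fun_upd_triv fun_upd_upd)
  qed
  have disj: "?u 1 ` words n \<inter> ?u 2 ` words n = {}"
    by (auto dest: fun_upd_eqD)
  show "(\<Sum>w\<in>words (Suc n). F w) = (\<Sum>w\<in>words n. F (w(n := 1)) + F (w(n := 2)))"
  \<comment> \<open>Finiteness of \<open>words n\<close> is derived only afterwards, by induction
    from the companion statement. In the infinite case both sums are 0 by convention.\<close>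
  proof (cases "finite (words n)")
    case True
    then show ?thesis
      unfolding * by (subst sum.union_disjoint) (use disj inj in \<open>auto simp: sum.reindex sum.distrib\<close>)
  next
    case False
    then have "infinite (words (Suc n))"
      using * inj[of 1] by (metis finite_Un finite_imageD)
    with False show ?thesis by simp
  qed
qed

lemma finite_words [simp]: "finite (words n)"
  by (induction n) (simp_all add: words_0 finite_words_Suc)

text \<open>Words grow at the front here, not at the end: invariance relates a word to its two
  extensions on the left, the Markov property to those on the right.\<close>

lemma sum_words_Suc':
  "(\<Sum>w\<in>words (Suc n). F w) = (\<Sum>w\<in>words n. F (case_nat 1 w) + F (case_nat 2 w))"
proof -
  have sub: "case_nat i w \<in> words (Suc n)" if "i \<in> {1, 2}" "w \<in> words n" for i w
    using that by (auto simp: words_def case_nat_in_\<Omega> split: nat.split)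
  have *: "words (Suc n) = case_nat 1 ` words n \<union> case_nat 2 ` words n"
  proof (intro equalityI subsetI)
    fix w assume w: "w \<in> words (Suc n)"
    then have "shift w \<in> words n" "w 0 = 1 \<or> w 0 = 2"
      using \<Omega>_cases[of w 0] by (auto simp: words_def shift_in_\<Omega>) (simp_all add: shift_def)
    then show "w \<in> case_nat 1 ` words n \<union> case_nat 2 ` words n"
      using case_nat_shift[of w] by (metis UnCI image_eqI)
  qed (use sub in auto)
  have inj: "inj_on (case_nat i) (words n)" for i :: nat
    by (metis inj_onI shift_case_nat)
  have disj: "case_nat 1 ` words n \<inter> case_nat 2 ` words n = {}"
    by (auto dest: fun_cong[of _ _ 0])
  show ?thesis
    unfolding * by (subst sum.union_disjoint) (use disj inj in \<open>auto simp: sum.reindex sum.distrib\<close>)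
qed

lemma card_words: "card (words n) = 2 ^ n"
proof -
  have "(\<Sum>w\<in>words n. 1) = (2 ^ n :: nat)"
    by (induction n) (simp add: words_0, simp only: sum_words_Suc, simp)
  then show ?thesis by simp
qed

definition word_of :: "nat \<Rightarrow> (nat \<Rightarrow> nat) \<Rightarrow> (nat \<Rightarrow> nat)" where
  "word_of n w = (\<lambda>k. if k < n then w k else 1)"

lemma word_of_in_words: "w \<in> \<Omega> \<Longrightarrow> word_of n w \<in> words n"
  by (auto simp: word_of_def words_def \<Omega>_def)

lemma cyl_word_of: "cyl n (word_of n w) = cyl n w"
  by (rule cyl_cong) (simp add: word_of_def)

lemma \<Omega>_eq_UN_words: "\<Omega> = (\<Union>w\<in>words n. cyl n w)"
proof (intro equalityI subsetI)
  fix w assume "w \<in> \<Omega>"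
  then show "w \<in> (\<Union>w\<in>words n. cyl n w)"
    by (intro UN_I[of "word_of n w"]) (auto simp: cyl_word_of self_in_cyl word_of_in_words)
qed (auto simp: cyl_def)

lemma disjoint_cyl_words: "disjoint_family_on (cyl n) (words n)"
  unfolding disjoint_family_on_def
proof (intro ballI impI)
  fix w w' assume w: "w \<in> words n" "w' \<in> words n" and ne: "w \<noteq> w'"
  have "\<exists>k<n. w k \<noteq> w' k"
  proof (rule ccontr)
    assume "\<not> (\<exists>k<n. w k \<noteq> w' k)"
    then have "w k = w' k" for k
      using w by (cases "k < n") (auto simp: words_def)
    then show False using ne by auto
  qed
  then show "cyl n w \<inter> cyl n w' = {}"
    by (auto simp: cyl_def)
qed

subsection \<open>The Borel sets are generated by the cylinders\<close>

interpretation \<Omega>: Metric_space \<Omega> shift_dist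
  using Metric_space_shift_dist[of full_mat] by simp

lemma summable_shift_dist:
  "w \<in> \<Omega> \<Longrightarrow> w' \<in> \<Omega> \<Longrightarrow> (\<lambda>n. \<bar>real (w n) - real (w' n)\<bar> / 2 ^ n) summable_on UNIV"
  using summable_on_shift_dist[of w full_mat w'] by simp

lemma shift_dist_ge:
  assumes "w \<in> \<Omega>" "w' \<in> \<Omega>"
  shows "\<bar>real (w n) - real (w' n)\<bar> / 2 ^ n \<le> shift_dist w w'"
proof -
  have "(\<Sum>\<^sub>\<infinity>n\<in>{n}. \<bar>real (w n) - real (w' n)\<bar> / 2 ^ n) \<le> shift_dist w w'"
    unfolding shift_dist_def
    by (rule infsum_mono2) (use summable_shift_dist[OF assms] in auto)
  then show ?thesis by simp
qed

text \<open>Since \<open>1 / 2 \<le> (3 / 4)^2\<close>, half of each exponent yields the factor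
  \<open>(3 / 4) ^ n\<close> and the other half a geometric series with sum 4. This avoids
  reindexing the tail.\<close>

lemma shift_dist_le:
  assumes "w \<in> \<Omega>" "w' \<in> \<Omega>" "\<forall>k<n. w k = w' k"
  shows "shift_dist w w' \<le> 4 * (3 / 4) ^ n"
proof -
  have geo: "(\<lambda>k. (3 / 4) ^ n * (3 / 4 :: real) ^ k) sums ((3 / 4) ^ n * (1 / (1 - 3 / 4)))"
    by (intro sums_mult geometric_sums) simp
  then have hs: "((\<lambda>k. (3 / 4) ^ n * (3 / 4 :: real) ^ k) has_sum (4 * (3 / 4) ^ n)) UNIV"
    by (intro sums_nonneg_imp_has_sum) (auto simp: mult.commute)
  have "\<bar>real (w k) - real (w' k)\<bar> / 2 ^ k \<le> (3 / 4) ^ n * (3 / 4) ^ k" for k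
  proof (cases "k < n")
    case False
    have "\<bar>real (w k) - real (w' k)\<bar> \<le> 1"
      using \<Omega>_cases[OF assms(1), of k] \<Omega>_cases[OF assms(2), of k] by auto
    then have "\<bar>real (w k) - real (w' k)\<bar> / 2 ^ k \<le> (1 / 2) ^ k"
      by (simp add: power_divide divide_right_mono)
    also have "\<dots> \<le> (9 / 16) ^ k"
      by (rule power_mono) auto
    also have "\<dots> = (3 / 4) ^ k * (3 / 4) ^ k"
      by (simp flip: power_mult_distrib)
    also have "\<dots> \<le> (3 / 4) ^ n * (3 / 4) ^ k"
      using False by (intro mult_right_mono power_decreasing) auto
    finally show ?thesis .
  qed (use assms in auto)
  then have "shift_dist w w' \<le> (\<Sum>\<^sub>\<infinity>k. (3 / 4) ^ n * (3 / 4) ^ k)"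
    unfolding shift_dist_def
    by (intro infsum_mono summable_shift_dist assms) (use hs in \<open>auto dest: has_sum_imp_summable\<close>)
  then show ?thesis
    using hs by (simp add: infsumI)
qed

lemma openin_cyl: "openin \<Omega>.mtopology (cyl n w)"
  unfolding \<Omega>.openin_mtopology
proof (intro conjI allI impI)
  show "cyl n w \<subseteq> \<Omega>" by (rule cyl_subset)
  fix \<eta> assume \<eta>: "\<eta> \<in> cyl n w"
  have "\<Omega>.mball \<eta> (1 / 2 ^ n) \<subseteq> cyl n w"
  proof
    fix \<xi> assume "\<xi> \<in> \<Omega>.mball \<eta> (1 / 2 ^ n)"
    then have \<xi>: "\<eta> \<in> \<Omega>" "\<xi> \<in> \<Omega>" "shift_dist \<eta> \<xi> < 1 / 2 ^ n"
      by auto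
    have "\<eta> k = \<xi> k" if "k < n" for k
    proof (rule ccontr)
      assume "\<eta> k \<noteq> \<xi> k"
      then have "\<bar>real (\<eta> k) - real (\<xi> k)\<bar> = 1"
        using \<Omega>_cases[OF \<xi>(1), of k] \<Omega>_cases[OF \<xi>(2), of k] by auto
      then have "1 / 2 ^ k < (1 / 2 ^ n :: real)"
        using shift_dist_ge[OF \<xi>(1,2), of k] \<xi>(3) by simp
      moreover have "1 / 2 ^ n \<le> (1 / 2 ^ k :: real)"
        using that by (intro divide_left_mono power_increasing) auto
      ultimately show False by simp
    qed
    with \<eta> \<xi> show "\<xi> \<in> cyl n w"
      by (auto simp: cyl_def)
  qed
  then show "\<exists>r>0. \<Omega>.mball \<eta> r \<subseteq> cyl n w"
    by (intro exI[of _ "1 / 2 ^ n"]) auto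
qed

text \<open>Indexing by words instead of points of \<open>U\<close> makes the union countable, as
  needed to place open sets in the sigma-algebra generated by cylinders.\<close>

lemma openin_eq_UN_cyl:
  assumes "openin \<Omega>.mtopology U"
  shows "U = (\<Union>(n, w)\<in>{(n, w). w \<in> words n \<and> cyl n w \<subseteq> U}. cyl n w)"
proof (intro equalityI subsetI)
  fix \<eta> assume \<eta>: "\<eta> \<in> U"
  with assms obtain r where r: "r > 0" "\<Omega>.mball \<eta> r \<subseteq> U" and \<eta>\<Omega>: "\<eta> \<in> \<Omega>"
    unfolding \<Omega>.openin_mtopology by blast
  obtain n where n: "(3 / 4 :: real) ^ n < r / 4"
    using real_arch_pow_inv[of "r / 4" "3 / 4"] r by auto
  have "cyl n \<eta> \<subseteq> \<Omega>.mball \<eta> r"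
  proof
    fix \<xi> assume "\<xi> \<in> cyl n \<eta>"
    then have "\<xi> \<in> \<Omega>" "shift_dist \<eta> \<xi> \<le> 4 * (3 / 4) ^ n"
      using \<eta>\<Omega> by (auto simp: cyl_def intro!: shift_dist_le)
    with n \<eta>\<Omega> show "\<xi> \<in> \<Omega>.mball \<eta> r"
      by auto
  qed
  with r have "cyl n (word_of n \<eta>) \<subseteq> U"
    by (auto simp: cyl_word_of)
  moreover have "\<eta> \<in> cyl n (word_of n \<eta>)"
    by (simp add: cyl_word_of self_in_cyl \<eta>\<Omega>)
  ultimately show "\<eta> \<in> (\<Union>(n, w)\<in>{(n, w). w \<in> words n \<and> cyl n w \<subseteq> U}. cyl n w)"
    using word_of_in_words[OF \<eta>\<Omega>, of n] by blast
qed auto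

lemma countable_words: "countable {(n, w). w \<in> words n \<and> P n w}"
proof -
  have "countable (SIGMA n:UNIV. words n)"
    by (intro countable_SIGMA) (auto intro: countable_finite)
  then show ?thesis
    by (rule countable_subset[rotated]) auto
qed

lemma space_\<B> [simp]: "space \<B> = \<Omega>"
  unfolding shift_borel_def by (simp add: space_measure_of_conv)

lemma \<Omega>_in_\<B> [simp]: "\<Omega> \<in> sets \<B>"
  using sets.top[of \<B>] by simp

lemma sets_\<B>: "sets \<B> = sigma_sets \<Omega> (insert {} {cyl n w | n w. w \<in> \<Omega>})"
proof -
  let ?C = "insert {} {cyl n w | n w. w \<in> \<Omega>}"
  have "sets \<B> = sigma_sets \<Omega> {U. openin \<Omega>.mtopology U}"
    unfolding shift_borel_def
    by (subst sets_measure_of) (auto simp: \<Omega>.openin_mtopology)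
  also have "\<dots> = sigma_sets \<Omega> ?C"
  proof (rule sigma_sets_eqI)
    fix U assume "U \<in> {U. openin \<Omega>.mtopology U}"
    then have U: "U = (\<Union>(n, w)\<in>{(n, w). w \<in> words n \<and> cyl n w \<subseteq> U}. cyl n w)"
      using openin_eq_UN_cyl by blast
    interpret sigma_algebra \<Omega> "sigma_sets \<Omega> ?C"
      by (rule sigma_algebra_sigma_sets) (auto simp: cyl_def)
    show "U \<in> sigma_sets \<Omega> ?C"
    proof (subst U, intro countable_UN' countable_words image_subsetI, clarsimp, rule sigma_sets.Basic)
      fix n w assume "w \<in> words n"
      then show "cyl n w \<in> ?C"
        using words_subset by blast
    qed
  next
    fix c assume "c \<in> ?C"
    then show "c \<in> sigma_sets \<Omega> {U. openin \<Omega>.mtopology U}"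
      by (auto intro!: sigma_sets.Basic sigma_sets.Empty openin_cyl)
  qed
  finally show ?thesis .
qed

lemma cyl_in_\<B> [measurable, simp]: "cyl n w \<in> sets \<B>"
proof (cases "cyl n w = {}")
  case False
  then obtain \<eta> where "\<eta> \<in> cyl n w" by auto
  then have "\<eta> \<in> \<Omega>" "cyl n w = cyl n \<eta>"
    by (auto simp: cyl_def)
  then show ?thesis
    unfolding sets_\<B> by (auto intro!: sigma_sets.Basic)
qed simp

lemma Int_stable_cyl: "Int_stable (insert {} {cyl n w | n w. w \<in> \<Omega>})"
proof (rule Int_stableI)
  fix a b assume ab: "a \<in> insert {} {cyl n w | n w. w \<in> \<Omega>}" "b \<in> insert {} {cyl n w | n w. w \<in> \<Omega>}"
  show "a \<inter> b \<in> insert {} {cyl n w | n w. w \<in> \<Omega>}"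
  proof (cases "a = {} \<or> b = {}")
    case False
    then obtain n w m w' where "a = cyl n w" "w \<in> \<Omega>" "b = cyl m w'" "w' \<in> \<Omega>"
      using ab by auto
    then show ?thesis using cyl_Int[of n w m w'] by auto
  qed auto
qed

lemma const_1_in_\<Omega>: "(\<lambda>_. 1) \<in> \<Omega>"
  by (auto simp: \<Omega>_def)

text \<open>Uniqueness on a generator stable under intersection. Length 0 is left out of the
  hypothesis because the Markov product formula needs a first symbol; it is recovered by splitting a
  cylinder.\<close>

lemma measure_eqI_cyl:
  assumes M: "sets M = sets \<B>" "emeasure M \<Omega> \<noteq> \<infinity>" and N: "sets N = sets \<B>"
    and eq: "\<And>n w. w \<in> \<Omega> \<Longrightarrow> emeasure M (cyl (Suc n) w) = emeasure N (cyl (Suc n) w)"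
  shows "M = N"
proof -
  have eq': "emeasure M (cyl n w) = emeasure N (cyl n w)" if "w \<in> \<Omega>" for n w
  proof -
    have "emeasure K (cyl n w) = emeasure K (cyl (Suc n) (w(n := 1))) + emeasure K (cyl (Suc n) (w(n := 2)))"
      if "sets K = sets \<B>" for K
      by (subst cyl_split, rule plus_emeasure[symmetric]) (use that cyl_split_disjoint in auto)
    then show ?thesis
      using M N that by (simp add: eq upd_in_\<Omega>)
  qed
  show ?thesis
  proof (rule measure_eqI_generator_eq[OF Int_stable_cyl, where \<Omega> = \<Omega> and A = "\<lambda>_. \<Omega>"])
    show "insert {} {cyl n w | n w. w \<in> \<Omega>} \<subseteq> Pow \<Omega>"
      by (auto simp: cyl_def)
    show "range (\<lambda>_. \<Omega>) \<subseteq> insert {} {cyl n w | n w. w \<in> \<Omega>}"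
      using const_1_in_\<Omega> cyl_0 by blast
  qed (use M N eq' in \<open>auto simp: sets_\<B>\<close>)
qed

lemma measurable_\<B>I:
  assumes "\<And>x. x \<in> space M \<Longrightarrow> f x \<in> \<Omega>"
    and "\<And>n w. w \<in> \<Omega> \<Longrightarrow> f -` cyl n w \<inter> space M \<in> sets M"
  shows "f \<in> measurable M \<B>"
  by (rule measurable_sigma_sets[OF sets_\<B>]) (use assms in \<open>auto simp: cyl_def\<close>)

lemma measurable_shift [measurable]: "shift \<in> measurable \<B> \<B>"
  by (rule measurable_\<B>I) (simp_all add: shift_in_\<Omega> vimage_shift_cyl)

lemma coord_eq_Un_cyl:
  "{w \<in> \<Omega>. w n = i} = (\<Union>\<eta>\<in>{\<eta> \<in> words (Suc n). \<eta> n = i}. cyl (Suc n) \<eta>)"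
proof (intro equalityI subsetI)
  fix w assume "w \<in> {w \<in> \<Omega>. w n = i}"
  then show "w \<in> (\<Union>\<eta>\<in>{\<eta> \<in> words (Suc n). \<eta> n = i}. cyl (Suc n) \<eta>)"
    by (intro UN_I[of "word_of (Suc n) w"])
      (auto simp: cyl_word_of self_in_cyl word_of_in_words, simp add: word_of_def)
qed (auto simp: cyl_def)

lemma measurable_coord [measurable]: "(\<lambda>w. w n) \<in> measurable \<B> (count_space UNIV)"
proof -
  have "{w \<in> \<Omega>. w n = i} \<in> sets \<B>" for i
    unfolding coord_eq_Un_cyl by (intro sets.finite_UN) auto
  moreover have "(\<lambda>w. w n) -` {i} \<inter> \<Omega> = {w \<in> \<Omega>. w n = i}" for i
    by auto
  ultimately show ?thesis
    by (simp add: measurable_count_space_eq2_countable)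
qed

section \<open>Stationary Markov measures on two symbols\<close>

locale markov_params =
  fixes x y :: real
  assumes x_pos: "0 < x" and x_less_1: "x < 1" and y_pos: "0 < y" and y_less_1: "y < 1"

text \<open>Every symbol other than 1 is treated as 2, so positivity and row sums hold without
  membership assumptions. The diagonal is \<open>x\<close>, \<open>y\<close>.\<close>

definition tprob :: "real \<Rightarrow> real \<Rightarrow> nat \<Rightarrow> nat \<Rightarrow> real" where
  "tprob x y i j = (if i = 1 then (if j = 1 then x else 1 - x) else (if j = 1 then 1 - y else y))"

text \<open>The weights \<open>1 - y\<close> and \<open>1 - x\<close> equalise the flows between the
  two symbols.\<close>

definition stat :: "real \<Rightarrow> real \<Rightarrow> nat \<Rightarrow> real" where
  "stat x y i = (if i = 1 then 1 - y else 1 - x) / (2 - x - y)"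

text \<open>
  The chain is driven by independent pairs of bits: the first bit is the next symbol if the
  present symbol is 1, the second one if it is 2. With this choice every cylinder becomes a box.
\<close>

definition driver :: "real \<Rightarrow> real \<Rightarrow> nat \<Rightarrow> (bool \<times> bool) pmf" where
  "driver x y k = (if k = 0 then pair_pmf (bernoulli_pmf (stat x y 1)) (bernoulli_pmf (stat x y 1))
     else pair_pmf (bernoulli_pmf x) (bernoulli_pmf (1 - y)))"

definition letter :: "bool \<Rightarrow> nat" where
  "letter b = (if b then 1 else 2)"

primrec path :: "(nat \<Rightarrow> bool \<times> bool) \<Rightarrow> nat \<Rightarrow> nat" where
  "path U 0 = letter (fst (U 0))"
| "path U (Suc n) = letter (if path U n = 1 then fst (U (Suc n)) else snd (U (Suc n)))"

definition markov :: "real \<Rightarrow> real \<Rightarrow> (nat \<Rightarrow> nat) measure" where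
  "markov x y = distr (PiM UNIV (\<lambda>k. measure_pmf (driver x y k))) \<B> path"

definition driver_box :: "(nat \<Rightarrow> nat) \<Rightarrow> nat \<Rightarrow> (bool \<times> bool) set" where
  "driver_box w k = {c. letter (if k > 0 \<and> w (k - 1) \<noteq> 1 then snd c else fst c) = w k}"

lemma path_in_\<Omega>: "path U \<in> \<Omega>"
proof -
  have "path U n \<in> {1, 2}" for n
    by (cases n) (auto simp: letter_def)
  then show ?thesis by (auto simp: \<Omega>_def)
qed

text \<open>As long as the path agrees with \<open>w\<close>, the bit consulted next is selected by
  the prescribed symbol of \<open>w\<close>, not by the random one. The conditions on distinct
  coordinates are therefore independent.\<close>

lemma path_in_cyl_iff: "path U \<in> cyl (Suc n) w \<longleftrightarrow> (\<forall>k\<in>{..n}. U k \<in> driver_box w k)"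
proof -
  have "(\<forall>k<Suc n. path U k = w k) \<longleftrightarrow> (\<forall>k\<in>{..n}. U k \<in> driver_box w k)"
  proof (induction n)
    case 0
    then show ?case by (simp add: driver_box_def)
  next
    case (Suc n)
    have "(\<forall>k<Suc (Suc n). path U k = w k) \<longleftrightarrow>
        (\<forall>k<Suc n. path U k = w k) \<and> path U (Suc n) = w (Suc n)"
      by (auto simp: less_Suc_eq)
    also have "\<dots> \<longleftrightarrow> (\<forall>k<Suc n. path U k = w k) \<and> U (Suc n) \<in> driver_box w (Suc n)"
      by (auto simp: driver_box_def)
    also have "\<dots> \<longleftrightarrow> (\<forall>k\<in>{..Suc n}. U k \<in> driver_box w k)"
      unfolding Suc.IH by (auto simp: le_Suc_eq)
    finally show ?case .
  qed
  then show ?thesis by (simp add: cyl_def path_in_\<Omega>)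
qed

context markov_params
begin

lemma tprob_pos: "0 < tprob x y i j"
  using x_pos x_less_1 y_pos y_less_1 by (simp add: tprob_def)

lemma stat_pos: "0 < stat x y i"
  using x_less_1 y_less_1 by (simp add: stat_def)

lemma stat_sum: "stat x y 1 + stat x y 2 = 1"
  using x_less_1 y_less_1 by (simp add: stat_def flip: add_divide_distrib)

lemma tprob_sum: "tprob x y i 1 + tprob x y i 2 = 1"
  by (simp add: tprob_def)

text \<open>With two states, stationarity forces equal flow in both directions, so the chain is
  reversible. This yields stationarity below and later identifies the Jacobian.\<close>

lemma detailed_balance: "i \<in> {1, 2} \<Longrightarrow> j \<in> {1, 2} \<Longrightarrow> stat x y i * tprob x y i j = stat x y j * tprob x y j i"
  by (auto simp: stat_def tprob_def)

lemma stat_tprob: "j \<in> {1, 2} \<Longrightarrow> stat x y 1 * tprob x y 1 j + stat x y 2 * tprob x y 2 j = stat x y j"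
  using detailed_balance[of 1 j] detailed_balance[of 2 j] tprob_sum[of j]
  by (simp flip: distrib_left)

lemma measure_pair_bernoulli:
  assumes "0 \<le> p" "p \<le> 1" "0 \<le> q" "q \<le> 1" "i \<in> {1, 2}"
  shows "measure_pmf.prob (pair_pmf (bernoulli_pmf p) (bernoulli_pmf q)) {c. letter (fst c) = i} =
      (if i = 1 then p else 1 - p)" (is ?a)
    and "measure_pmf.prob (pair_pmf (bernoulli_pmf p) (bernoulli_pmf q)) {c. letter (snd c) = i} =
      (if i = 1 then q else 1 - q)" (is ?b)
proof -
  have "letter b = i \<longleftrightarrow> b = (i = 1)" for b
    using assms(5) by (cases b) (auto simp: letter_def)
  then have letter: "{b. letter b = i} = {i = 1}"
    by simp
  have bernoulli: "measure_pmf.prob (bernoulli_pmf r) {b. letter b = i} = (if i = 1 then r else 1 - r)"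
    if "0 \<le> r" "r \<le> 1" for r
    unfolding letter measure_pmf_single using that by (cases "i = 1") simp_all
  let ?P = "pair_pmf (bernoulli_pmf p) (bernoulli_pmf q)"
  show ?a
    using bernoulli[OF assms(1,2)] measure_map_pmf[of fst ?P "{b. letter b = i}"]
    by (simp add: map_fst_pair_pmf vimage_def)
  show ?b
    using bernoulli[OF assms(3,4)] measure_map_pmf[of snd ?P "{b. letter b = i}"]
    by (simp add: map_snd_pair_pmf vimage_def)
qed

lemma prob_driver_box_0:
  assumes "w \<in> \<Omega>"
  shows "measure_pmf.prob (driver x y 0) (driver_box w 0) = stat x y (w 0)"
proof -
  have "w 0 \<in> {1, 2}" using assms by (auto simp: \<Omega>_def)
  moreover have "1 - stat x y 1 = stat x y 2" using stat_sum by simp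
  ultimately show ?thesis
    using measure_pair_bernoulli(1)[of "stat x y 1" "stat x y 1" "w 0"] stat_pos[of 1] stat_pos[of 2]
    by (auto simp: driver_def driver_box_def)
qed

lemma prob_driver_box_Suc:
  assumes "w \<in> \<Omega>"
  shows "measure_pmf.prob (driver x y (Suc k)) (driver_box w (Suc k)) = tprob x y (w k) (w (Suc k))"
proof -
  have "w k = 1 \<or> w k = 2" and wS: "w (Suc k) \<in> {1, 2}"
    using assms by (auto simp: \<Omega>_def)
  then consider "w k = 1" | "w k = 2" by blast
  then show ?thesis
  proof cases
    case 1
    then have "driver_box w (Suc k) = {c. letter (fst c) = w (Suc k)}"
      by (simp add: driver_box_def)
    then show ?thesis
      using measure_pair_bernoulli(1)[of x "1 - y", OF _ _ _ _ wS] x_pos x_less_1 y_pos y_less_1 1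
      by (simp add: driver_def tprob_def)
  next
    case 2
    then have "driver_box w (Suc k) = {c. letter (snd c) = w (Suc k)}"
      by (simp add: driver_box_def)
    then show ?thesis
      using measure_pair_bernoulli(2)[of x "1 - y", OF _ _ _ _ wS] x_pos x_less_1 y_pos y_less_1 2
      by (simp add: driver_def tprob_def)
  qed
qed

sublocale drv: product_prob_space "\<lambda>k. measure_pmf (driver x y k)" UNIV ..

lemma vimage_path_cyl:
  "path -` cyl (Suc n) w \<inter> space (PiM UNIV (\<lambda>k. measure_pmf (driver x y k))) =
    prod_emb UNIV (\<lambda>k. measure_pmf (driver x y k)) {..n} (PiE {..n} (driver_box w))"
  by (auto simp: path_in_cyl_iff prod_emb_def space_PiM PiE_iff)

lemma measurable_path [measurable]: "path \<in> measurable (PiM UNIV (\<lambda>k. measure_pmf (driver x y k))) \<B>"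
proof (rule measurable_\<B>I)
  fix n and w :: "nat \<Rightarrow> nat"
  show "path -` cyl n w \<inter> space (PiM UNIV (\<lambda>k. measure_pmf (driver x y k)))
      \<in> sets (PiM UNIV (\<lambda>k. measure_pmf (driver x y k)))"
  proof (cases n)
    case 0
    have "path -` \<Omega> \<inter> S = S" for S
      using path_in_\<Omega> by auto
    then show ?thesis by (simp add: 0)
  next
    case (Suc m)
    show ?thesis
      unfolding Suc vimage_path_cyl by (rule sets_PiM_I) auto
  qed
qed (rule path_in_\<Omega>)

lemma sets_markov [simp, measurable_cong]: "sets (markov x y) = sets \<B>"
  by (simp add: markov_def)

lemma space_markov [simp]: "space (markov x y) = \<Omega>"
  by (simp add: markov_def)

sublocale prob_space "markov x y"
  unfolding markov_def by (rule drv.prob_space_distr) measurable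

lemma measure_markov_cyl:
  assumes "w \<in> \<Omega>"
  shows "measure (markov x y) (cyl (Suc n) w) = stat x y (w 0) * (\<Prod>k<n. tprob x y (w k) (w (Suc k)))"
proof -
  have "measure (markov x y) (cyl (Suc n) w) =
      measure (PiM UNIV (\<lambda>k. measure_pmf (driver x y k)))
        (prod_emb UNIV (\<lambda>k. measure_pmf (driver x y k)) {..n} (PiE {..n} (driver_box w)))"
    unfolding markov_def by (simp add: measure_distr vimage_path_cyl)
  also have "\<dots> = (\<Prod>k\<in>{..n}. measure_pmf.prob (driver x y k) (driver_box w k))"
    by (rule drv.measure_PiM_emb) auto
  also have "\<dots> = measure_pmf.prob (driver x y 0) (driver_box w 0) *
      (\<Prod>k<n. measure_pmf.prob (driver x y (Suc k)) (driver_box w (Suc k)))"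
    unfolding lessThan_Suc_atMost[symmetric] by (rule prod.lessThan_Suc_shift)
  finally show ?thesis
    by (simp add: prob_driver_box_0 prob_driver_box_Suc assms)
qed

lemma measure_markov_cyl_pos: "w \<in> \<Omega> \<Longrightarrow> measure (markov x y) (cyl n w) > 0"
proof (cases n)
  case 0
  then show ?thesis using prob_space by simp
qed (simp add: measure_markov_cyl stat_pos tprob_pos prod_pos)

lemma markov_shift: "distr (markov x y) \<B> shift = markov x y"
proof (rule measure_eqI_cyl)
  fix n and w :: "nat \<Rightarrow> nat" assume w: "w \<in> \<Omega>"
  have w0: "w 0 \<in> {1, 2}" using w by (auto simp: \<Omega>_def)
  have "emeasure (distr (markov x y) \<B> shift) (cyl (Suc n) w) =
      emeasure (markov x y) (cyl (Suc (Suc n)) (case_nat 1 w) \<union> cyl (Suc (Suc n)) (case_nat 2 w))"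
    by (simp add: emeasure_distr vimage_shift_cyl)
  also have "\<dots> = ennreal (measure (markov x y) (cyl (Suc (Suc n)) (case_nat 1 w)) +
      measure (markov x y) (cyl (Suc (Suc n)) (case_nat 2 w)))"
    by (subst emeasure_eq_measure, subst finite_measure_Union) (use vimage_shift_cyl_disjoint[of "Suc (Suc n)" w] in auto)
  also have "measure (markov x y) (cyl (Suc (Suc n)) (case_nat 1 w)) +
      measure (markov x y) (cyl (Suc (Suc n)) (case_nat 2 w)) =
      (stat x y 1 * tprob x y 1 (w 0) + stat x y 2 * tprob x y 2 (w 0)) * (\<Prod>k<n. tprob x y (w k) (w (Suc k)))"
    by (simp add: measure_markov_cyl case_nat_in_\<Omega> w prod.lessThan_Suc_shift algebra_simps del: prod.lessThan_Suc)
  also have "\<dots> = measure (markov x y) (cyl (Suc n) w)"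
    by (simp only: stat_tprob[OF w0] measure_markov_cyl[OF w])
  finally show "emeasure (distr (markov x y) \<B> shift) (cyl (Suc n) w) = emeasure (markov x y) (cyl (Suc n) w)"
    by (simp add: emeasure_eq_measure)
next
  have "shift -` \<Omega> \<inter> \<Omega> = \<Omega>" by (auto simp: shift_in_\<Omega>)
  then show "emeasure (distr (markov x y) \<B> shift) \<Omega> \<noteq> \<infinity>"
    using sets.top[of \<B>] by (simp add: emeasure_distr emeasure_eq_measure)
qed auto

end

section \<open>Uniqueness of the Gibbs measure\<close>

lemma finite_positive_bounds:
  fixes S :: "real set"
  assumes "finite S" "\<And>s. s \<in> S \<Longrightarrow> 0 < s"
  shows "\<exists>C>0. \<forall>s\<in>S. s \<in> {1 / C..C}"
proof -
  \<comment> \<open>The sum dominates each \<open>s\<close> and each \<open>1 / s\<close>; the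
    summand 1 keeps \<open>C\<close> positive for empty \<open>S\<close>.\<close>
  define C where "C = 1 + (\<Sum>s\<in>S. s + 1 / s)"
  have "0 \<le> (\<Sum>s\<in>S. s + 1 / s)"
    using assms by (intro sum_nonneg add_nonneg_nonneg) (auto simp: less_imp_le)
  then have C: "C > 0" by (simp add: C_def)
  have "s \<in> {1 / C..C}" if s: "s \<in> S" for s
  proof -
    have "s + 1 / s \<le> (\<Sum>s\<in>S. s + 1 / s)"
      by (rule member_le_sum) (use assms s in \<open>auto intro!: add_nonneg_nonneg simp: less_imp_le\<close>)
    then have "s + 1 / s \<le> C" by (simp add: C_def)
    moreover have "s > 0" "1 / s > 0" using assms s by auto
    ultimately have "s \<le> C" "1 / s \<le> C" by linarith+
    then show ?thesis using \<open>s > 0\<close> C by (auto simp: field_simps)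
  qed
  then show ?thesis using C by auto
qed

definition birkhoff :: "((nat \<Rightarrow> nat) \<Rightarrow> real) \<Rightarrow> nat \<Rightarrow> (nat \<Rightarrow> nat) \<Rightarrow> real" where
  "birkhoff f n w = (\<Sum>k<n. f ((shift ^^ k) w))"

lemma is_gibbs_measureD:
  assumes "is_gibbs_measure full_mat f \<mu>"
  shows "prob_space \<mu>" and "sets \<mu> = sets \<B>" and "space \<mu> = \<Omega>"
    and "\<And>B. B \<in> sets \<B> \<Longrightarrow> measure \<mu> (shift -` B \<inter> \<Omega>) = measure \<mu> B"
proof -
  show 1: "prob_space \<mu>" "sets \<mu> = sets \<B>"
    using assms by (auto simp: is_gibbs_measure_def)
  show "space \<mu> = \<Omega>"
    using sets_eq_imp_space_eq[OF 1(2)] by simp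
  show "measure \<mu> (shift -` B \<inter> \<Omega>) = measure \<mu> B" if "B \<in> sets \<B>" for B
    using assms that 1 by (auto simp: is_gibbs_measure_def measure_def)
qed

text \<open>Both Gibbs estimates contain the same Birkhoff sum, which cancels. What remains is the
  difference \<open>d\<close> of the two pressures, not yet known to vanish.\<close>

lemma gibbs_measure_compare:
  assumes "is_gibbs_measure full_mat f \<mu>" "is_gibbs_measure full_mat f \<nu>"
  obtains K d where "K > 0"
    and "\<And>n w. n \<ge> 1 \<Longrightarrow> w \<in> \<Omega> \<Longrightarrow> measure \<mu> (cyl n w) \<le> K * exp (real n * d) * measure \<nu> (cyl n w)"
    and "\<And>n w. n \<ge> 1 \<Longrightarrow> w \<in> \<Omega> \<Longrightarrow> measure \<nu> (cyl n w) \<le> K * exp (- real n * d) * measure \<mu> (cyl n w)"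
proof -
  obtain C P where C: "C > 0" and \<mu>: "\<And>n w. w \<in> \<Omega> \<Longrightarrow> n \<ge> 1 \<Longrightarrow>
      measure \<mu> (cyl n w) / exp (- real n * P + birkhoff f n w) \<in> {1 / C..C}"
    using assms(1) unfolding is_gibbs_measure_def birkhoff_def[symmetric] shift_space_full_mat by blast
  obtain C' P' where C': "C' > 0" and \<nu>: "\<And>n w. w \<in> \<Omega> \<Longrightarrow> n \<ge> 1 \<Longrightarrow>
      measure \<nu> (cyl n w) / exp (- real n * P' + birkhoff f n w) \<in> {1 / C'..C'}"
    using assms(2) unfolding is_gibbs_measure_def birkhoff_def[symmetric] shift_space_full_mat by blast
  have bounds: "a \<le> D * exp (- real n * P + s)" "exp (- real n * P + s) \<le> D * a"
    if "a / exp (- real n * P + s) \<in> {1 / D..D}" "D > 0" for a D P s :: real and n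
    using that by (simp_all add: field_simps)
  have *: "a \<le> D * D' * exp (real n * (P' - P)) * b"
    if "a / exp (- real n * P + s) \<in> {1 / D..D}" "b / exp (- real n * P' + s) \<in> {1 / D'..D'}"
      "D > 0" "D' > 0" for a b D D' P P' s :: real and n
  proof -
    have "a \<le> D * exp (- real n * P + s)"
      using bounds that by blast
    also have "\<dots> = D * exp (real n * (P' - P)) * exp (- real n * P' + s)"
      by (simp add: mult.assoc algebra_simps flip: exp_add)
    also have "\<dots> \<le> D * exp (real n * (P' - P)) * (D' * b)"
      using that by (intro mult_left_mono bounds) auto
    finally show ?thesis by (simp add: mult_ac)
  qed
  show ?thesis
  proof (rule that)
    show "C * C' > 0" using C C' by simp
    fix n :: nat and w :: "nat \<Rightarrow> nat" assume n: "n \<ge> 1" and w: "w \<in> \<Omega>"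
    show "measure \<mu> (cyl n w) \<le> C * C' * exp (real n * (P' - P)) * measure \<nu> (cyl n w)"
      by (rule *[OF \<mu> \<nu>]) (use n w C C' in auto)
    have "measure \<nu> (cyl n w) \<le> C' * C * exp (real n * (P - P')) * measure \<mu> (cyl n w)"
      by (rule *[OF \<nu> \<mu>]) (use n w C C' in auto)
    moreover have "real n * (P - P') = - real n * (P' - P)"
      by (simp add: algebra_simps)
    ultimately show "measure \<nu> (cyl n w) \<le> C * C' * exp (- real n * (P' - P)) * measure \<mu> (cyl n w)"
      by (simp only: mult_ac)
  qed
qed

lemma sum_measure_words:
  assumes "prob_space \<mu>" "sets \<mu> = sets \<B>"
  shows "(\<Sum>w\<in>words n. measure \<mu> (cyl n w)) = 1"
proof -
  interpret prob_space \<mu> by fact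
  have "measure \<mu> (\<Union>w\<in>words n. cyl n w) = (\<Sum>w\<in>words n. measure \<mu> (cyl n w))"
    by (rule finite_measure_finite_Union) (use disjoint_cyl_words assms(2) in auto)
  then show ?thesis
    using prob_space sets_eq_imp_space_eq[OF assms(2)] by (simp flip: \<Omega>_eq_UN_words)
qed

lemma exp_growth_rate_nonneg:
  fixes d :: real
  assumes "\<And>n. n \<ge> 1 \<Longrightarrow> 1 \<le> K * exp (real n * d)"
  shows "0 \<le> d"
proof (rule ccontr)
  assume "\<not> 0 \<le> d"
  then have "(\<lambda>n. K * exp d ^ n) \<longlonglongrightarrow> K * 0"
    by (intro tendsto_mult_left LIMSEQ_realpow_zero) auto
  then have "(\<lambda>n. K * exp (real n * d)) \<longlonglongrightarrow> 0"
    by (simp add: exp_of_nat_mult)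
  then show False
    using assms by (meson LIMSEQ_le_const not_one_le_zero)
qed

lemma gibbs_measure_le:
  assumes "is_gibbs_measure full_mat f \<mu>" "is_gibbs_measure full_mat f \<nu>"
  obtains K where "K > 0"
    and "\<And>n w. n \<ge> 1 \<Longrightarrow> w \<in> \<Omega> \<Longrightarrow> measure \<mu> (cyl n w) \<le> K * measure \<nu> (cyl n w)"
proof -
  obtain K d where K: "K > 0"
    and 1: "\<And>n w. n \<ge> 1 \<Longrightarrow> w \<in> \<Omega> \<Longrightarrow> measure \<mu> (cyl n w) \<le> K * exp (real n * d) * measure \<nu> (cyl n w)"
    and 2: "\<And>n w. n \<ge> 1 \<Longrightarrow> w \<in> \<Omega> \<Longrightarrow> measure \<nu> (cyl n w) \<le> K * exp (- real n * d) * measure \<mu> (cyl n w)"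
    using gibbs_measure_compare[OF assms] by blast
  have sums: "(\<Sum>w\<in>words n. measure \<mu> (cyl n w)) = 1" "(\<Sum>w\<in>words n. measure \<nu> (cyl n w)) = 1" for n
    using is_gibbs_measureD[OF assms(1)] is_gibbs_measureD[OF assms(2)] sum_measure_words by auto
  have "1 \<le> K * exp (real n * - d)" if "n \<ge> 1" for n
  proof -
    have "(\<Sum>w\<in>words n. measure \<nu> (cyl n w)) \<le>
        (\<Sum>w\<in>words n. K * exp (- real n * d) * measure \<mu> (cyl n w))"
      using 2[OF that] words_subset by (intro sum_mono) auto
    also have "\<dots> = K * exp (- real n * d) * (\<Sum>w\<in>words n. measure \<mu> (cyl n w))"
      by (rule sum_distrib_left[symmetric])
    finally show ?thesis using sums[of n] by simp
  qed
  then have "d \<le> 0"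
    using exp_growth_rate_nonneg[of K "- d"] by simp
  have "measure \<mu> (cyl n w) \<le> K * measure \<nu> (cyl n w)" if "n \<ge> 1" "w \<in> \<Omega>" for n w
  proof -
    have "exp (real n * d) \<le> 1"
      using \<open>d \<le> 0\<close> by (simp add: mult_nonneg_nonpos)
    then have "K * exp (real n * d) * measure \<nu> (cyl n w) \<le> K * 1 * measure \<nu> (cyl n w)"
      using K by (intro mult_right_mono mult_left_mono) auto
    then show ?thesis using 1[OF that] by simp
  qed
  then show ?thesis using that K by blast
qed

context markov_params
begin

text \<open>
  The squared deviations of \<open>\<mu>\<close> from the Markov property are bounded by the increments of the sums
  \<open>\<Sum>\<mu>(w)\<^sup>2 / m(w)\<close> over the words \<open>w\<close> of length \<open>n\<close>, where \<open>m\<close> is the Markov measure. Domination by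
  \<open>m\<close> bounds these sums, so the deviations tend to 0; invariance makes them increase with \<open>n\<close>.
\<close>

lemma dominated_invariant_is_markov:
  assumes \<mu>: "prob_space \<mu>" and sets: "sets \<mu> = sets \<B>"
    and inv: "\<And>B. B \<in> sets \<B> \<Longrightarrow> measure \<mu> (shift -` B \<inter> \<Omega>) = measure \<mu> B"
    and dom: "\<And>n w. n \<ge> 1 \<Longrightarrow> w \<in> \<Omega> \<Longrightarrow> measure \<mu> (cyl n w) \<le> K * measure (markov x y) (cyl n w)"
  shows "\<mu> = markov x y"
proof -
  interpret \<mu>: prob_space \<mu> by fact
  have space: "space \<mu> = \<Omega>"
    using sets_eq_imp_space_eq[OF sets] by simp
  define r where "r n w = measure \<mu> (cyl n w)" for n w
  define m where "m n w = measure (markov x y) (cyl n w)" for n w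
  \<comment> \<open>Only the symbol 1 is recorded: the measure and the row of \<open>tprob\<close>
    both split additively, so the deviation for the symbol 2 is the negative.\<close>
  define e where "e n w = r (Suc (Suc n)) (w(Suc n := 1)) - r (Suc n) w * tprob x y (w n) 1" for n w
  define d where "d n = (\<Sum>w\<in>words (Suc n). \<bar>e n w\<bar>)" for n
  define T where "T n = (\<Sum>w\<in>words (Suc n). (r (Suc n) w)\<^sup>2 / m (Suc n) w)" for n

  have r_split: "r n w = r (Suc n) (w(n := 1)) + r (Suc n) (w(n := 2))" for n w
    unfolding r_def by (subst cyl_split, subst \<mu>.finite_measure_Union)
      (use cyl_split_disjoint sets in auto)
  have r_shift: "r n w = r (Suc n) (case_nat 1 w) + r (Suc n) (case_nat 2 w)" for n w
  proof -
    have "r n w = measure \<mu> (shift -` cyl n w \<inter> \<Omega>)"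
      unfolding r_def by (rule inv[symmetric]) simp
    also have "\<dots> = r (Suc n) (case_nat 1 w) + r (Suc n) (case_nat 2 w)"
      unfolding vimage_shift_cyl r_def
      by (subst \<mu>.finite_measure_Union) (use vimage_shift_cyl_disjoint[of "Suc n"] sets in auto)
    finally show ?thesis .
  qed
  have r_nonneg: "0 \<le> r n w" for n w by (simp add: r_def)
  have m_pos: "w \<in> \<Omega> \<Longrightarrow> 0 < m n w" for n w
    by (simp add: m_def measure_markov_cyl_pos)
  have m_upd: "m (Suc (Suc n)) (w(Suc n := j)) = m (Suc n) w * tprob x y (w n) j"
    if "w \<in> \<Omega>" "j \<in> {1, 2}" for n w j
    using that by (simp add: m_def measure_markov_cyl upd_in_\<Omega>)
  have sum_r: "(\<Sum>w\<in>words n. r n w) = 1" for n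
    unfolding r_def by (rule sum_measure_words[OF \<mu> sets])
  have sum_m: "(\<Sum>w\<in>words n. m n w) = 1" for n
    unfolding m_def by (rule sum_measure_words) (auto intro: prob_space_axioms)

  have T_le: "T n \<le> K" for n
  proof -
    have "T n \<le> (\<Sum>w\<in>words (Suc n). K * r (Suc n) w)"
      unfolding T_def
    proof (rule sum_mono)
      fix w assume "w \<in> words (Suc n)"
      then have w: "w \<in> \<Omega>" using words_subset by auto
      have "(r (Suc n) w)\<^sup>2 \<le> (K * m (Suc n) w) * r (Suc n) w"
        unfolding power2_eq_square using dom[OF _ w, of "Suc n"] r_nonneg
        by (intro mult_right_mono) (auto simp: r_def m_def)
      then show "(r (Suc n) w)\<^sup>2 / m (Suc n) w \<le> K * r (Suc n) w"
        using m_pos[OF w] by (simp add: pos_divide_le_eq mult_ac)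
    qed
    also have "\<dots> = K"
      by (simp add: sum_r flip: sum_distrib_left)
    finally show ?thesis .
  qed

  have T_Suc: "(d n)\<^sup>2 \<le> T (Suc n) - T n" for n
  proof -
    \<comment> \<open>The cross terms cancel, so refining a word adds
      \<open>E^2 / (M * p * (1 - p))\<close>. Bounding this from below by the expression linear in
      \<open>\<bar>E\<bar>\<close> replaces the Cauchy-Schwarz inequality: the deviations sum to
      \<open>d n\<close> and the weights \<open>m\<close> to 1, which leaves
      \<open>(d n)^2\<close>.\<close>
    have step: "(r (Suc n) w)\<^sup>2 / m (Suc n) w + (2 * d n * \<bar>e n w\<bar> - (d n)\<^sup>2 * m (Suc n) w) \<le>
        (r (Suc (Suc n)) (w(Suc n := 1)))\<^sup>2 / m (Suc (Suc n)) (w(Suc n := 1)) +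
        (r (Suc (Suc n)) (w(Suc n := 2)))\<^sup>2 / m (Suc (Suc n)) (w(Suc n := 2))"
      if w: "w \<in> \<Omega>" for w
    proof -
      define p where "p = tprob x y (w n) 1"
      define R where "R = r (Suc n) w"
      define M where "M = m (Suc n) w"
      define E where "E = e n w"
      have p: "0 < p" "p < 1" "tprob x y (w n) 2 = 1 - p"
        using tprob_pos[of "w n" 1] tprob_pos[of "w n" 2] tprob_sum[of "w n"] by (auto simp: p_def)
      have M: "M > 0" using m_pos[OF w] by (simp add: M_def)
      have r1: "r (Suc (Suc n)) (w(Suc n := 1)) = R * p + E"
        by (simp add: E_def e_def R_def p_def)
      have r2: "r (Suc (Suc n)) (w(Suc n := 2)) = R * (1 - p) - E"
        using r_split[of "Suc n" w] r1 by (simp add: R_def algebra_simps)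
      have m12: "m (Suc (Suc n)) (w(Suc n := 1)) = M * p" "m (Suc (Suc n)) (w(Suc n := 2)) = M * (1 - p)"
        using m_upd[OF w] p by (simp_all add: M_def p_def)
      have "(R * p + E)\<^sup>2 / (M * p) + (R * (1 - p) - E)\<^sup>2 / (M * (1 - p)) = R\<^sup>2 / M + E\<^sup>2 / (M * (p * (1 - p)))"
        using p(1,2) M by (simp add: divide_simps) (simp add: power2_eq_square algebra_simps)
      moreover have "2 * d n * \<bar>E\<bar> - (d n)\<^sup>2 * M \<le> E\<^sup>2 / M"
      proof -
        have "0 \<le> (\<bar>E\<bar> - d n * M)\<^sup>2" by simp
        then have "(2 * d n * \<bar>E\<bar> - (d n)\<^sup>2 * M) * M \<le> E\<^sup>2"
          by (simp add: power2_eq_square algebra_simps)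
        then show ?thesis using M by (simp add: pos_le_divide_eq)
      qed
      moreover have "E\<^sup>2 / M \<le> E\<^sup>2 / (M * (p * (1 - p)))"
      proof (rule divide_left_mono)
        have "p * (1 - p) \<le> 1 * 1" using p by (intro mult_mono) auto
        then show "M * (p * (1 - p)) \<le> M" using M by simp
      qed (use p M in auto)
      ultimately show ?thesis
        unfolding r1 r2 m12 by (simp add: R_def M_def E_def)
    qed
    have "T n + (2 * d n * d n - (d n)\<^sup>2 * 1) =
        (\<Sum>w\<in>words (Suc n). (r (Suc n) w)\<^sup>2 / m (Suc n) w + (2 * d n * \<bar>e n w\<bar> - (d n)\<^sup>2 * m (Suc n) w))"
      by (simp add: T_def sum.distrib sum_subtractf sum_m d_def flip: sum_distrib_left)
    also have "\<dots> \<le> T (Suc n)"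
      unfolding T_def sum_words_Suc[of _ "Suc n"]
      by (intro sum_mono step) (use words_subset in auto)
    finally show ?thesis by (simp add: power2_eq_square)
  qed

  \<comment> \<open>Prepending a symbol leaves the last transition unchanged, so by invariance
    deviations add up over the prepended symbol. The triangle inequality then makes \<open>d\<close>
    increasing.\<close>
  have e_shift: "e n w = e (Suc n) (case_nat 1 w) + e (Suc n) (case_nat 2 w)" for n w
  proof -
    have upd: "(case_nat i w)(Suc (Suc n) := j) = case_nat i (w(Suc n := j))" for i j
      by (auto simp: fun_eq_iff split: nat.splits)
    show ?thesis
      unfolding e_def upd using r_shift[of "Suc n" w] r_shift[of "Suc (Suc n)" "w(Suc n := 1)"]
      by (simp add: algebra_simps)
  qed
  have "incseq d"
  proof (rule incseq_SucI)
    show "d n \<le> d (Suc n)" for n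
      unfolding d_def sum_words_Suc'[of _ "Suc n"]
      by (intro sum_mono) (simp add: e_shift[of n])
  qed
  have "d n = 0" for n
  proof (rule ccontr)
    assume "d n \<noteq> 0"
    moreover have "0 \<le> d n"
      unfolding d_def by (rule sum_nonneg) simp
    ultimately have dn: "0 < d n" by simp
    have growth: "T n + real k * (d n)\<^sup>2 \<le> T (n + k)" for k
    proof (induction k)
      case (Suc k)
      have "(d n)\<^sup>2 \<le> (d (n + k))\<^sup>2"
        using dn \<open>incseq d\<close> by (intro power_mono) (auto simp: incseq_def)
      then show ?case
        using Suc T_Suc[of "n + k"] by (simp add: algebra_simps)
    qed simp
    have bound: "real k * (d n)\<^sup>2 \<le> K - T n" for k
      using growth[of k] T_le[of "n + k"] by linarith
    obtain k where "K - T n < real k * (d n)\<^sup>2"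
      using reals_Archimedean3[of "(d n)\<^sup>2"] dn by auto
    with bound[of k] show False by simp
  qed
  then have e0: "e n w = 0" if "w \<in> words (Suc n)" for n w
    using that by (auto simp: d_def sum_nonneg_eq_0_iff)

  have r_cong: "r n w = r n w'" if "\<And>k. k < n \<Longrightarrow> w k = w' k" for n w w'
    unfolding r_def using cyl_cong[OF that] by simp
  have r_Suc: "r (Suc (Suc n)) w = r (Suc n) w * tprob x y (w n) (w (Suc n))" if w: "w \<in> \<Omega>" for n w
  proof -
    \<comment> \<open>The deviations are known to vanish on words only; truncating \<open>w\<close>
      does not change the cylinders involved.\<close>
    define v where "v = word_of (Suc n) w"
    have v: "v \<in> words (Suc n)" "v n = w n"
      using word_of_in_words[OF w] by (auto simp: v_def word_of_def)
    have rv: "r (Suc n) v = r (Suc n) w"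
      by (rule r_cong) (simp add: v_def word_of_def)
    have r1: "r (Suc (Suc n)) (v(Suc n := 1)) = r (Suc n) v * tprob x y (v n) 1"
      using e0[OF v(1)] by (simp add: e_def)
    then have r2: "r (Suc (Suc n)) (v(Suc n := 2)) = r (Suc n) v * tprob x y (v n) 2"
      using r_split[of "Suc n" v] tprob_sum[of "v n"] by (metis add_diff_cancel_left' distrib_left mult.right_neutral)
    have "r (Suc (Suc n)) w = r (Suc (Suc n)) (v(Suc n := w (Suc n)))"
      by (rule r_cong) (auto simp: v_def word_of_def less_Suc_eq)
    also have "\<dots> = r (Suc n) v * tprob x y (v n) (w (Suc n))"
      using \<Omega>_cases[OF w, of "Suc n"] r1 r2 by auto
    finally show ?thesis by (simp add: rv v)
  qed

  have r1: "r 1 w = stat x y (w 0)" if w: "w \<in> \<Omega>" for w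
  proof -
    define a where "a i = r 1 (\<lambda>_. i)" for i
    have ra: "r 1 w = a (w 0)" for w
      unfolding a_def by (rule r_cong) simp
    have "a 1 + a 2 = 1"
      using sum_r[of 1] sum_words_Suc[of "r 1" 0] by (simp add: words_0 ra[unfolded One_nat_def])
    \<comment> \<open>Invariance says that the symbol 1 has the same probability at times 0 and 1,
      so the initial distribution solves the stationary equation.\<close>
    moreover have "a 1 = a 1 * x + a 2 * (1 - y)"
    proof -
      have "r (Suc 1) (case_nat i (\<lambda>_. 1)) = a i * tprob x y i 1" if "i \<in> {1, 2}" for i
        using r_Suc[of "case_nat i (\<lambda>_. 1)" 0] that ra[of "case_nat i (\<lambda>_. 1)"]
        using case_nat_in_\<Omega>[OF that const_1_in_\<Omega>] by simp
      then show ?thesis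
        using r_shift[of 1 "\<lambda>_. 1"] by (simp add: a_def tprob_def)
    qed
    moreover from calculation have a2: "a 2 = 1 - a 1" by simp
    ultimately have eq: "a 1 * (2 - x - y) = 1 - y" by (simp add: algebra_simps)
    then have "a 1 = stat x y 1"
      using x_less_1 y_less_1 by (simp add: stat_def eq_divide_eq)
    moreover from this have "a 2 = stat x y 2"
      using a2 stat_sum by simp
    ultimately have "a 1 = stat x y 1" "a 2 = stat x y 2" by auto
    then show ?thesis
      using \<Omega>_cases[OF w, of 0] ra[of w] by auto
  qed
  have "r (Suc n) w = m (Suc n) w" if w: "w \<in> \<Omega>" for n w
    using w by (induction n) (simp_all add: r1[simplified] r_Suc m_def measure_markov_cyl)
  then show ?thesis
    by (intro measure_eqI_cyl)
      (auto simp: sets r_def m_def \<mu>.emeasure_eq_measure emeasure_eq_measure)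
qed

lemma birkhoff_markov_potential:
  assumes f: "\<And>w. w \<in> \<Omega> \<Longrightarrow> f w = ln (tprob x y (w 0) (w 1)) + c + u (w 0) - u (w 1)" and w: "w \<in> \<Omega>"
  shows "birkhoff f n w = ln (\<Prod>k<n. tprob x y (w k) (w (Suc k))) + real n * c + u (w 0) - u (w n)"
proof (induction n)
  case (Suc n)
  have "(\<lambda>k. w (k + n)) \<in> \<Omega>" using w by (auto simp: \<Omega>_def)
  then have "f ((shift ^^ n) w) = ln (tprob x y (w n) (w (Suc n))) + c + u (w n) - u (w (Suc n))"
    by (simp add: shift_funpow f)
  moreover have "ln (\<Prod>k<Suc n. tprob x y (w k) (w (Suc k))) =
      ln (\<Prod>k<n. tprob x y (w k) (w (Suc k))) + ln (tprob x y (w n) (w (Suc n)))"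
    unfolding prod.lessThan_Suc by (intro ln_mult_pos prod_pos) (auto simp: tprob_pos)
  ultimately show ?case
    using Suc by (simp add: birkhoff_def algebra_simps del: prod.lessThan_Suc)
qed (simp add: birkhoff_def)

lemma is_gibbs_measure_markov:
  assumes f: "\<And>w. w \<in> \<Omega> \<Longrightarrow> f w = ln (tprob x y (w 0) (w 1)) + c + u (w 0) - u (w 1)"
  shows "is_gibbs_measure full_mat f (markov x y)"
proof -
  \<comment> \<open>The Birkhoff sum over \<open>n\<close> steps contains one transition more than a
    cylinder of length \<open>n\<close>, and \<open>u\<close> telescopes. With \<open>c\<close> as
    pressure the Gibbs quotient depends only on the first, the last and the following symbol, so it
    takes finitely many values.\<close>
  define q where "q = (\<lambda>(i, j, k). stat x y i / (tprob x y j k * exp (u i - u k)))"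
  have q_pos: "q t > 0" for t
    by (cases t) (simp add: q_def stat_pos tprob_pos)
  have "\<exists>C>0. \<forall>s\<in>q ` ({1, 2} \<times> {1, 2} \<times> {1, 2}). s \<in> {1 / C..C}"
    by (rule finite_positive_bounds) (use q_pos in blast)+
  then obtain C where C: "C > 0" "\<And>t. t \<in> {1, 2} \<times> {1, 2} \<times> {1, 2} \<Longrightarrow> q t \<in> {1 / C..C}"
    by blast
  have "measure (markov x y) (cyl n w) / exp (- real n * c + birkhoff f n w) \<in> {1 / C..C}"
    if w: "w \<in> \<Omega>" and n: "n \<ge> 1" for w n
  proof -
    obtain l where l: "n = Suc l" using n by (cases n) auto
    define Q where "Q = (\<Prod>k<l. tprob x y (w k) (w (Suc k)))"
    have Q: "Q > 0" by (auto simp: Q_def intro!: prod_pos tprob_pos)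
    have "- real n * c + birkhoff f n w = ln Q + ln (tprob x y (w l) (w n)) + (u (w 0) - u (w n))"
      using Q tprob_pos[of "w l" "w n"]
      by (simp add: birkhoff_markov_potential[OF f w] l ln_mult_pos algebra_simps flip: Q_def)
    then have "exp (- real n * c + birkhoff f n w) = Q * tprob x y (w l) (w n) * exp (u (w 0) - u (w n))"
      using Q tprob_pos[of "w l" "w n"]
      by (simp add: exp_add)
    then have "measure (markov x y) (cyl n w) / exp (- real n * c + birkhoff f n w) = q (w 0, w l, w n)"
      using Q by (simp add: l measure_markov_cyl[OF w] q_def flip: Q_def)
    then show ?thesis
      using C(2)[of "(w 0, w l, w n)"] w by (auto simp: \<Omega>_def)
  qed
  moreover have "emeasure (markov x y) (shift -` B \<inter> \<Omega>) = emeasure (markov x y) B" if "B \<in> sets \<B>" for B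
    using arg_cong[OF markov_shift, of "\<lambda>M. emeasure M B"] that by (simp add: emeasure_distr)
  ultimately show ?thesis
    unfolding is_gibbs_measure_def birkhoff_def[symmetric]
    using C(1) prob_space_axioms by auto
qed

theorem gibbs_measure_eq_markov:
  assumes f: "\<And>w. w \<in> \<Omega> \<Longrightarrow> f w = ln (tprob x y (w 0) (w 1)) + c + u (w 0) - u (w 1)"
  shows "gibbs_measure full_mat f = markov x y"
  unfolding gibbs_measure_def
proof (rule the_equality)
  show gibbs: "is_gibbs_measure full_mat f (markov x y)"
    by (rule is_gibbs_measure_markov[OF f])
  fix \<mu> assume \<mu>: "is_gibbs_measure full_mat f \<mu>"
  obtain K where "\<And>n w. n \<ge> 1 \<Longrightarrow> w \<in> \<Omega> \<Longrightarrow> measure \<mu> (cyl n w) \<le> K * measure (markov x y) (cyl n w)"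
    using gibbs_measure_le[OF \<mu> gibbs] by blast
  then show "\<mu> = markov x y"
    by (intro dominated_invariant_is_markov is_gibbs_measureD[OF \<mu>])
qed

end

section \<open>The stochastic matrix of a function of two coordinates\<close>

unbundle no vec_syntax

lemma eigenvector_2_iff:
  fixes M :: "'a :: comm_ring_1 mat"
  assumes "M \<in> carrier_mat 2 2"
  shows "eigenvector M v k \<longleftrightarrow> v \<in> carrier_vec 2 \<and> (v $ 0 \<noteq> 0 \<or> v $ 1 \<noteq> 0) \<and>
    M $$ (0, 0) * v $ 0 + M $$ (0, 1) * v $ 1 = k * v $ 0 \<and>
    M $$ (1, 0) * v $ 0 + M $$ (1, 1) * v $ 1 = k * v $ 1"
proof -
  have vec_eq: "u = w \<longleftrightarrow> u $ 0 = w $ 0 \<and> u $ 1 = w $ 1"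
    if "u \<in> carrier_vec 2" "w \<in> carrier_vec 2" for u w :: "'a vec"
    using that by (auto simp: vec_eq_iff less_2_cases_iff)
  have dims: "dim_row M = 2" "dim_col M = 2" using assms by auto
  have "(M *\<^sub>v v) $ i = M $$ (i, 0) * v $ 0 + M $$ (i, 1) * v $ 1" if "v \<in> carrier_vec 2" "i < 2" for i
    using that dims by (simp add: scalar_prod_def numeral_2_eq_2)
  moreover have "M *\<^sub>v v \<in> carrier_vec 2" by (rule carrier_vecI) (simp add: dims)
  ultimately show ?thesis
    unfolding eigenvector_def dims
    by (cases "v \<in> carrier_vec 2") (simp_all add: vec_eq carrier_vecD del: One_nat_def)
qed

locale positive_mat_2 =
  fixes M :: "real mat"
  assumes carrier: "M \<in> carrier_mat 2 2" and pos: "\<And>i j. i < 2 \<Longrightarrow> j < 2 \<Longrightarrow> M $$ (i, j) > 0"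
begin

abbreviation "a \<equiv> M $$ (0, 0)"
abbreviation "b \<equiv> M $$ (0, 1)"
abbreviation "c \<equiv> M $$ (1, 0)"
abbreviation "d \<equiv> M $$ (1, 1)"

text \<open>The larger root of the characteristic polynomial. The discriminant in this form is
  visibly greater than \<open>(a - d)^2\<close>, which puts \<open>rho\<close> above both diagonal
  entries.\<close>

definition "rho = (a + d + sqrt ((a - d)\<^sup>2 + 4 * b * c)) / 2"

lemma entries_pos: "0 < a" "0 < b" "0 < c" "0 < d"
  by (simp_all add: pos)

lemma rho_greater: "a < rho" "d < rho"
  and rho_eq: "(rho - a) * (rho - d) = b * c"
proof -
  define s where "s = sqrt ((a - d)\<^sup>2 + 4 * b * c)"
  have bc: "0 < b * c" using entries_pos by simp
  have "s > sqrt ((a - d)\<^sup>2)"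
    unfolding s_def using bc by (intro real_sqrt_less_mono) simp
  then have "s > \<bar>a - d\<bar>" by simp
  then show "a < rho" "d < rho"
    unfolding rho_def s_def[symmetric] by (auto simp: abs_if split: if_splits)
  have "s\<^sup>2 = (a - d)\<^sup>2 + 4 * b * c"
    unfolding s_def using bc by (intro real_sqrt_pow2) (auto intro!: add_nonneg_nonneg simp: mult.assoc)
  then show "(rho - a) * (rho - d) = b * c"
    unfolding rho_def s_def[symmetric] by (simp add: power2_eq_square field_simps)
qed

text \<open>Eliminating the eigenvector leaves \<open>(z - a) * (z - d) = b * c\<close>; the second
  root is the trace minus \<open>rho\<close>.\<close>

lemma complex_eigenvalue_cases:
  assumes "eigenvalue (map_mat complex_of_real M) z"
  shows "z = complex_of_real rho \<or> z = complex_of_real (a + d - rho)"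
proof -
  have dims: "dim_row M = 2" "dim_col M = 2" using carrier by auto
  obtain v where "eigenvector (map_mat complex_of_real M) v z"
    using assms by (auto simp: eigenvalue_def)
  then have v: "v $ 0 \<noteq> 0 \<or> v $ 1 \<noteq> 0"
      and 1: "complex_of_real a * v $ 0 + complex_of_real b * v $ 1 = z * v $ 0"
      and 2: "complex_of_real c * v $ 0 + complex_of_real d * v $ 1 = z * v $ 1"
    using carrier dims by (auto simp: eigenvector_2_iff)
  have "v $ 0 \<noteq> 0"
    using v 1 entries_pos by auto
  have "(z - complex_of_real a) * v $ 0 = complex_of_real b * v $ 1"
    using 1 by (simp add: algebra_simps)
  then have "(z - complex_of_real a) * (z - complex_of_real d) * v $ 0 =
      complex_of_real b * ((z - complex_of_real d) * v $ 1)"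
    by (metis mult.assoc mult.commute)
  also have "(z - complex_of_real d) * v $ 1 = complex_of_real c * v $ 0"
    using 2 by (simp add: algebra_simps)
  finally have "(z - complex_of_real a) * (z - complex_of_real d) = complex_of_real (b * c)"
    using \<open>v $ 0 \<noteq> 0\<close> by simp
  then have "(z - complex_of_real rho) * (z - complex_of_real (a + d - rho)) = 0"
    unfolding rho_eq[symmetric] by (simp add: algebra_simps)
  then show ?thesis by simp
qed

lemma rho_eigenvector: "eigenvector M (vec 2 (\<lambda>i. if i = 0 then b else rho - a)) rho"
  unfolding eigenvector_2_iff[OF carrier] using entries_pos rho_eq by (simp add: algebra_simps)

lemma perron_root_eq: "perron_root M = rho"
proof -
  have "eigenvector (map_mat complex_of_real M)
      (map_vec complex_of_real (vec 2 (\<lambda>i. if i = 0 then b else rho - a))) (complex_of_real rho)"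
    by (rule of_real_hom.eigenvector_hom[OF carrier rho_eigenvector])
  then have ev: "eigenvalue (map_mat complex_of_real M) (complex_of_real rho)"
    by (auto simp: eigenvalue_def)
  have dom: "cmod z < rho" if "eigenvalue (map_mat complex_of_real M) z" "z \<noteq> complex_of_real rho" for z
  proof -
    have "z = complex_of_real (a + d - rho)"
      using complex_eigenvalue_cases that by blast
    then have "cmod z = \<bar>a + d - rho\<bar>" by (simp only: norm_of_real)
    then show ?thesis using rho_greater entries_pos by linarith
  qed
  show ?thesis
    unfolding perron_root_def
  proof (rule the_equality)
    show "0 < rho \<and> eigenvalue (map_mat complex_of_real M) (complex_of_real rho) \<and>
        (\<forall>z. eigenvalue (map_mat complex_of_real M) z \<and> z \<noteq> complex_of_real rho \<longrightarrow> cmod z < rho)"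
      using rho_greater(1) entries_pos(1) ev dom by auto
    fix r assume r: "r > 0 \<and> eigenvalue (map_mat complex_of_real M) (complex_of_real r) \<and>
        (\<forall>z. eigenvalue (map_mat complex_of_real M) z \<and> z \<noteq> complex_of_real r \<longrightarrow> cmod z < r)"
    show "r = rho"
    \<comment> \<open>Of two distinct dominant eigenvalues each would be strictly smaller than the
      other.\<close>
    proof (rule ccontr)
      assume "r \<noteq> rho"
      then have "cmod (complex_of_real r) < rho"
        using dom[of "complex_of_real r"] r by simp
      moreover have "cmod (complex_of_real rho) < r"
        using r ev \<open>r \<noteq> rho\<close> by (simp del: norm_of_real)
      ultimately show False using r rho_greater(1) entries_pos(1) by auto
    qed
  qed
qed

lemma perron_vector:
  shows "perron_vector M $ 0 > 0" "perron_vector M $ 1 > 0"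
    and "a * perron_vector M $ 0 + b * perron_vector M $ 1 = rho * perron_vector M $ 0"
    and "c * perron_vector M $ 0 + d * perron_vector M $ 1 = rho * perron_vector M $ 1"
proof -
  let ?P = "\<lambda>v. eigenvector M v rho \<and> (\<forall>i<dim_vec v. v $ i > 0)"
  have "?P (vec 2 (\<lambda>i. if i = 0 then b else rho - a))"
    using rho_eigenvector rho_greater entries_pos by auto
  then have "?P (perron_vector M)"
    unfolding perron_vector_def perron_root_eq by (rule someI)
  moreover from this have "dim_vec (perron_vector M) = 2"
    unfolding eigenvector_2_iff[OF carrier] by auto
  ultimately show "perron_vector M $ 0 > 0" "perron_vector M $ 1 > 0"
    "a * perron_vector M $ 0 + b * perron_vector M $ 1 = rho * perron_vector M $ 0"
    "c * perron_vector M $ 0 + d * perron_vector M $ 1 = rho * perron_vector M $ 1"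
    unfolding eigenvector_2_iff[OF carrier] by auto
qed

lemma params: "markov_params (a / rho) (d / rho)"
  using rho_greater entries_pos by unfold_locales auto

text \<open>On the diagonal the eigenvector cancels, leaving \<open>a / rho\<close> and
  \<open>d / rho\<close>; the eigenvector equation says that rows sum to 1, which fixes the other
  two entries.\<close>

lemma tprob_eq:
  assumes "i < 2" "j < 2"
  shows "inverse rho * inverse (perron_vector M $ i) * perron_vector M $ j * M $$ (i, j) =
    tprob (a / rho) (d / rho) (i + 1) (j + 1)"
proof -
  have rho: "rho > 0" using rho_greater(1) entries_pos(1) by simp
  note v = perron_vector
  have "b * perron_vector M $ 1 = (rho - a) * perron_vector M $ 0"
    "c * perron_vector M $ 0 = (rho - d) * perron_vector M $ 1"
    using v(3,4) by (simp_all add: algebra_simps)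
  then have "inverse rho * inverse (perron_vector M $ 0) * perron_vector M $ 1 * b = 1 - a / rho"
    "inverse rho * inverse (perron_vector M $ 1) * perron_vector M $ 0 * c = 1 - d / rho"
    using v(1,2) rho by (simp_all add: field_simps)
  moreover have "inverse rho * inverse (perron_vector M $ 0) * perron_vector M $ 0 * a = a / rho"
    "inverse rho * inverse (perron_vector M $ 1) * perron_vector M $ 1 * d = d / rho"
    using v(1,2) by (simp_all add: divide_inverse)
  moreover have "i = 0 \<or> i = 1" "j = 0 \<or> j = 1" using assms by auto
  ultimately show ?thesis
    by (elim disjE) (simp_all add: tprob_def)
qed

end

lemma mat_of_rows_list_2:
  "mat_of_rows_list 2 [[p, q], [r, s]] =
    mat 2 2 (\<lambda>(i, j). if i = 0 then if j = 0 then p else q else if j = 0 then r else s)"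
proof (rule eq_matI)
  fix i j assume "i < dim_row (mat 2 2 (\<lambda>(i, j). if i = 0 then if j = 0 then p else q else if j = 0 then r else s))"
    and "j < dim_col (mat 2 2 (\<lambda>(i, j). if i = 0 then if j = 0 then p else q else if j = 0 then r else s))"
  then have "i = 0 \<or> i = 1" "j = 0 \<or> j = 1" by auto
  then show "mat_of_rows_list 2 [[p, q], [r, s]] $$ (i, j) =
      mat 2 2 (\<lambda>(i, j). if i = 0 then if j = 0 then p else q else if j = 0 then r else s) $$ (i, j)"
    by (elim disjE) (simp_all add: mat_of_rows_list_def)
qed (simp_all add: mat_of_rows_list_def)

lemma locally_constant_stochastic:
  assumes f: "f \<in> locally_constant 2 full_mat"
  obtains x y c u where "markov_params x y"
    and "stochastic_matrix full_mat f = mat_of_rows_list 2 [[x, 1 - x], [1 - y, y]]"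
    and "\<And>w. w \<in> \<Omega> \<Longrightarrow> f w = ln (tprob x y (w 0) (w 1)) + c + u (w 0) - u (w 1)"
proof -
  define M where "M = weight_matrix full_mat f"
  have M_exp: "M $$ (w 0 - 1, w 1 - 1) = exp (f w)" if w: "w \<in> \<Omega>" for w
  proof -
    let ?Q = "\<lambda>v. v \<in> \<Omega> \<and> v 0 = w 0 \<and> v 1 = w 1"
    define v where "v = (SOME v. ?Q v)"
    have v: "?Q v" unfolding v_def by (rule someI[of ?Q w]) (use w in auto)
    then have "v k = w k" if "k < 2" for k
      using that by (cases k) (simp_all add: less_Suc_eq numeral_2_eq_2)
    then have "f v = f w"
      using f v w unfolding locally_constant_def shift_space_full_mat by blast
    moreover have "M $$ (i - 1, j - 1) = exp (f (SOME v. v \<in> \<Omega> \<and> v 0 = i \<and> v 1 = j))"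
      if "i \<in> {1, 2}" "j \<in> {1, 2}" for i j
    proof -
      have "i - 1 < 2" "j - 1 < 2" "i - 1 + 1 = i" "j - 1 + 1 = j" using that by auto
      then show ?thesis
        by (simp add: M_def weight_matrix_def mat1_def entry_full_mat[OF that])
    qed
    moreover have "w 0 \<in> {1, 2}" "w 1 \<in> {1, 2}" using w by (auto simp: \<Omega>_def)
    ultimately show ?thesis by (simp add: v_def)
  qed
  have word: "\<exists>w\<in>\<Omega>. w 0 = i + 1 \<and> w 1 = j + 1" if "i < 2" "j < 2" for i j
    using that by (intro bexI[of _ "\<lambda>n. if n = 0 then i + 1 else j + 1"]) (auto simp: \<Omega>_def)
  interpret positive_mat_2 M
  proof
    show "M \<in> carrier_mat 2 2" by (simp add: M_def weight_matrix_def mat1_def)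
    show "0 < M $$ (i, j)" if ij: "i < 2" "j < 2" for i j
    proof -
      obtain w where "w \<in> \<Omega>" "w 0 = i + 1" "w 1 = j + 1" using word[OF ij] by blast
      then show ?thesis using M_exp[of w] by simp
    qed
  qed
  define v where "v = perron_vector M"
  interpret P: markov_params "a / rho" "d / rho" by (rule params)
  have rho: "rho > 0" using rho_greater(1) entries_pos(1) by simp
  have "stochastic_matrix full_mat f = mat 2 2 (\<lambda>(i, j). tprob (a / rho) (d / rho) (i + 1) (j + 1))"
    by (auto simp: stochastic_matrix_def Let_def perron_root_eq tprob_eq simp flip: M_def intro!: eq_matI)
  also have "\<dots> = mat_of_rows_list 2 [[a / rho, 1 - a / rho], [1 - d / rho, d / rho]]"
    unfolding mat_of_rows_list_2 by (rule cong_mat) (auto simp: tprob_def)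
  finally have "stochastic_matrix full_mat f = \<dots>" .
  \<comment> \<open>The logarithm of the formula for the stochastic matrix: the constant is
    \<open>ln rho\<close>, the transfer function the logarithm of the eigenvector.\<close>
  moreover have "f w = ln (tprob (a / rho) (d / rho) (w 0) (w 1)) + ln rho + ln (v $ (w 0 - 1)) - ln (v $ (w 1 - 1))"
    if w: "w \<in> \<Omega>" for w
  proof -
    have w12: "w 0 \<in> {1, 2}" "w 1 \<in> {1, 2}" using w by (auto simp: \<Omega>_def)
    have v: "v $ (w 0 - 1) > 0" "v $ (w 1 - 1) > 0"
      using w12 perron_vector(1,2) by (auto simp: v_def)
    have "tprob (a / rho) (d / rho) (w 0) (w 1) =
        inverse rho * inverse (v $ (w 0 - 1)) * v $ (w 1 - 1) * exp (f w)"
    proof -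
      have "w 0 - 1 < 2" "w 1 - 1 < 2" "w 0 - 1 + 1 = w 0" "w 1 - 1 + 1 = w 1"
        using w12 by auto
      then show ?thesis
        using tprob_eq[of "w 0 - 1" "w 1 - 1"] by (simp only: M_exp[OF w] v_def)
    qed
    then have "ln (tprob (a / rho) (d / rho) (w 0) (w 1)) =
        - ln rho - ln (v $ (w 0 - 1)) + ln (v $ (w 1 - 1)) + f w"
      using v rho by (simp add: ln_mult_pos ln_inverse)
    then show ?thesis by simp
  qed
  ultimately show ?thesis
    using that[of "a / rho" "d / rho" "ln rho" "\<lambda>i. ln (v $ (i - 1))"] params by blast
qed

text \<open>Every pair of parameters is realised in the class, so a counterexample among Markov
  measures becomes one among functions.\<close>

lemma locally_constant_markov:
  assumes "markov_params x y"
  obtains g where "g \<in> locally_constant 2 full_mat" "gibbs_measure full_mat g = markov x y"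
proof
  interpret markov_params x y by fact
  define g where "g = (\<lambda>w\<in>\<Omega>. ln (tprob x y (w 0) (w 1)))"
  show "g \<in> locally_constant 2 full_mat"
    by (auto simp: g_def locally_constant_def)
  show "gibbs_measure full_mat g = markov x y"
    by (rule gibbs_measure_eq_markov[of _ 0 "\<lambda>_. 0"]) (simp add: g_def)
qed

section \<open>Bowen entropy of subsets of the full shift\<close>

abbreviation cover_cost :: "real \<Rightarrow> (nat \<times> (nat \<Rightarrow> nat)) set \<Rightarrow> ennreal" where
  "cover_cost s S \<equiv> (\<Sum>\<^sub>\<infinity>(m, w)\<in>S. ennreal (exp (- s * real m)))"

lemma sum_le_infsum_ennreal:
  fixes f :: "'a \<Rightarrow> ennreal"
  assumes "finite F" "F \<subseteq> A"
  shows "sum f F \<le> infsum f A"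
  unfolding nonneg_infsum_complete[of A f, simplified] using assms by (intro SUP_upper) auto

lemma infsum_le_ennreal:
  fixes f :: "'a \<Rightarrow> ennreal"
  assumes "\<And>F. finite F \<Longrightarrow> F \<subseteq> A \<Longrightarrow> sum f F \<le> c"
  shows "infsum f A \<le> c"
  unfolding nonneg_infsum_complete[of A f, simplified] using assms by (intro SUP_least) auto

lemma sum_UN_le:
  fixes f :: "'a \<Rightarrow> ennreal"
  assumes "finite I" "\<And>i. i \<in> I \<Longrightarrow> finite (G i)"
  shows "sum f (\<Union>i\<in>I. G i) \<le> (\<Sum>i\<in>I. sum f (G i))"
  using assms
proof (induction I)
  case (insert i I)
  have "sum f (\<Union>i\<in>insert i I. G i) \<le>
      sum f (G i \<union> (\<Union>i\<in>I. G i)) + sum f (G i \<inter> (\<Union>i\<in>I. G i))"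
    by simp
  also have "\<dots> = sum f (G i) + sum f (\<Union>i\<in>I. G i)"
    using insert by (intro sum.union_inter) auto
  also have "\<dots> \<le> (\<Sum>i\<in>insert i I. sum f (G i))"
    using insert by (simp add: add_left_mono)
  finally show ?case .
qed simp

lemma emeasure_countable_cover_le:
  assumes "countable S" "\<And>i. i \<in> S \<Longrightarrow> X i \<in> sets M" "B \<subseteq> (\<Union>i\<in>S. X i)"
  shows "emeasure M B \<le> (\<Sum>\<^sub>\<infinity>i\<in>S. emeasure M (X i))"
proof -
  have "emeasure M B \<le> emeasure M (\<Union>i\<in>S. X i)"
    using assms by (intro emeasure_mono sets.countable_UN') auto
  also have "\<dots> \<le> (\<Sum>\<^sub>\<infinity>i\<in>S. emeasure M (X i))"
  proof (cases "finite S")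
    case True
    then show ?thesis using assms emeasure_subadditive_finite[of S X M] by (simp add: image_subset_iff)
  next
    case False
    define e where "e = from_nat_into S"
    have e: "bij_betw e UNIV S"
      unfolding e_def using bij_betw_from_nat_into[OF assms(1) False] .
    have "(\<Union>i\<in>S. X i) = (\<Union>n. X (e n))"
      using e by (auto simp: bij_betw_def)
    also have "emeasure M \<dots> \<le> (\<Sum>n. emeasure M (X (e n)))"
      using e assms(2) by (intro emeasure_subadditive_countably) (auto simp: bij_betw_def)
    also have "\<dots> \<le> (\<Sum>\<^sub>\<infinity>n. emeasure M (X (e n)))"
      unfolding suminf_eq_SUP by (intro SUP_least sum_le_infsum_ennreal) auto
    also have "\<dots> = (\<Sum>\<^sub>\<infinity>i\<in>S. emeasure M (X i))"
      using infsum_reindex_bij_betw[OF e] .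
    finally show ?thesis .
  qed
  finally show ?thesis .
qed

lemma ennreal_times_divide_self: "C > 0 \<Longrightarrow> ennreal C * (a / ennreal C) = a"
  by (simp add: ennreal_times_divide mult_divide_eq_ennreal mult.commute[of _ a])

lemma bowen_sum_le:
  assumes "countable S" "S \<subseteq> {n..} \<times> \<Omega>" "Z \<subseteq> (\<Union>(m, w)\<in>S. cyl m w)"
  shows "bowen_sum full_mat s Z n \<le> cover_cost s S"
  unfolding bowen_sum_def by (rule INF_lower) (use assms in auto)

lemma bowen_sum_greatest:
  assumes "\<And>S. countable S \<Longrightarrow> S \<subseteq> {n..} \<times> \<Omega> \<Longrightarrow> Z \<subseteq> (\<Union>(m, w)\<in>S. cyl m w) \<Longrightarrow> c \<le> cover_cost s S"
  shows "c \<le> bowen_sum full_mat s Z n"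
  unfolding bowen_sum_def by (rule INF_greatest) (use assms in auto)

text \<open>The cover by all words of length \<open>n\<close> costs \<open>(2 / e) ^ n\<close>. Any
  exponent above \<open>ln 2\<close> would do; its only purpose is to make the set of exponents
  under \<open>Inf\<close> nonempty.\<close>

lemma bowen_sum_1_tendsto:
  assumes "Z \<subseteq> \<Omega>"
  shows "bowen_sum full_mat 1 Z \<longlonglongrightarrow> 0"
proof (rule tendsto_sandwich[where f = "\<lambda>_. 0"])
  have "bowen_sum full_mat 1 Z n \<le> ennreal ((2 * exp (- 1)) ^ n)" for n
  proof -
    have "bowen_sum full_mat 1 Z n \<le> cover_cost 1 ({n} \<times> words n)"
    proof (rule bowen_sum_le)
      have "(\<Union>(m, w)\<in>{n} \<times> words n. cyl m w) = \<Omega>"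
        unfolding \<Omega>_eq_UN_words[of n] by auto
      then show "Z \<subseteq> (\<Union>(m, w)\<in>{n} \<times> words n. cyl m w)"
        using assms by simp
    qed (use words_subset in \<open>auto intro: countable_finite\<close>)
    also have "\<dots> = (\<Sum>(m, w)\<in>{n} \<times> words n. ennreal (exp (- 1 * real m)))"
      by (rule infsum_finite) simp
    also have "\<dots> = (\<Sum>w\<in>words n. ennreal (exp (- real n)))"
      by (subst sum.Sigma[symmetric]) auto
    also have "\<dots> = ennreal (\<Sum>w\<in>words n. exp (- real n))"
      by (rule sum_ennreal) simp
    also have "(\<Sum>w\<in>words n. exp (- real n)) = (2 * exp (- 1)) ^ n"
      by (simp add: card_words power_mult_distrib flip: exp_of_nat_mult)
    finally show ?thesis .
  qed
  then show "\<forall>\<^sub>F n in sequentially. bowen_sum full_mat 1 Z n \<le> ennreal ((2 * exp (- 1)) ^ n)"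
    by simp
  have "exp (1 :: real) > 2"
    using exp_lower_Taylor_quadratic[of "1 :: real"] by simp
  then have "2 * exp (- 1 :: real) < 1"
    by (simp add: exp_minus field_simps)
  then have "(\<lambda>n. (2 * exp (- 1 :: real)) ^ n) \<longlonglongrightarrow> 0"
    by (intro LIMSEQ_realpow_zero) auto
  then show "(\<lambda>n. ennreal ((2 * exp (- 1)) ^ n)) \<longlonglongrightarrow> 0"
    using tendsto_ennrealI by fastforce
qed auto

lemma bowen_entropy_le:
  assumes "s \<ge> 0" "bowen_sum full_mat s Z \<longlonglongrightarrow> 0"
  shows "bowen_entropy full_mat Z \<le> s"
  unfolding bowen_entropy_def by (rule cInf_lower) (use assms in \<open>auto intro!: bdd_belowI[of _ 0]\<close>)

lemma bowen_entropy_ge: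
  assumes "Z \<subseteq> \<Omega>" "\<And>s. s \<ge> 0 \<Longrightarrow> bowen_sum full_mat s Z \<longlonglongrightarrow> 0 \<Longrightarrow> t \<le> s"
  shows "t \<le> bowen_entropy full_mat Z"
  unfolding bowen_entropy_def
proof (rule cInf_greatest)
  have "1 \<in> {s. 0 \<le> s \<and> bowen_sum full_mat s Z \<longlonglongrightarrow> 0}"
    using bowen_sum_1_tendsto[OF assms(1)] by simp
  then show "{s. 0 \<le> s \<and> bowen_sum full_mat s Z \<longlonglongrightarrow> 0} \<noteq> {}" by blast
qed (use assms(2) in auto)

text \<open>For an exponent \<open>s' < s\<close>, every cover of \<open>Z\<close> costs at least
  \<open>emeasure \<nu> B / K\<close>, so its Bowen sums cannot tend to 0. Working with a subset
  \<open>B\<close> avoids any measurability of \<open>Z\<close>.\<close>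

lemma mass_distribution:
  assumes \<nu>: "sets \<nu> = sets \<B>" and Z: "Z \<subseteq> \<Omega>"
    and B: "B \<subseteq> Z" "emeasure \<nu> B > 0"
    and K: "K \<ge> 0" "\<And>n w. w \<in> \<Omega> \<Longrightarrow> emeasure \<nu> (cyl n w) \<le> ennreal (K * exp (- s * real n))"
  shows "s \<le> bowen_entropy full_mat Z"
proof (rule bowen_entropy_ge[OF Z])
  fix s' :: real assume s': "s' \<ge> 0" "bowen_sum full_mat s' Z \<longlonglongrightarrow> 0"
  show "s \<le> s'"
  proof (rule ccontr)
    assume "\<not> s \<le> s'"
    have "emeasure \<nu> B \<le> ennreal K * bowen_sum full_mat s' Z n" for n
    proof (cases "K = 0")
      case True
      have "emeasure \<nu> B \<le> 0"
      proof -
        have "emeasure \<nu> B \<le> emeasure \<nu> (cyl 0 (\<lambda>_. 1))"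
          using B Z \<nu> by (intro emeasure_mono) auto
        also have "\<dots> \<le> ennreal 0"
          using K(2)[OF const_1_in_\<Omega>, of 0] True by simp
        finally show ?thesis by simp
      qed
      then show ?thesis by simp
    next
      case False
      then have K0: "K > 0" using K by simp
      have "emeasure \<nu> B / ennreal K \<le> bowen_sum full_mat s' Z n"
      proof (rule bowen_sum_greatest)
        fix S assume S: "countable S" "S \<subseteq> {n..} \<times> \<Omega>" "Z \<subseteq> (\<Union>(m, w)\<in>S. cyl m w)"
        have "emeasure \<nu> B \<le> (\<Sum>\<^sub>\<infinity>(m, w)\<in>S. emeasure \<nu> (cyl m w))"
          using emeasure_countable_cover_le[of S "\<lambda>(m, w). cyl m w" \<nu> B] S B \<nu>
          by (auto simp: case_prod_unfold)
        also have "\<dots> \<le> (\<Sum>\<^sub>\<infinity>(m, w)\<in>S. ennreal K * ennreal (exp (- s' * real m)))"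
        proof (rule infsum_mono)
          fix p assume "p \<in> S"
          then obtain m w where p: "p = (m, w)" "w \<in> \<Omega>" using S by auto
          have "exp (- s * real m) \<le> exp (- s' * real m)"
            using \<open>\<not> s \<le> s'\<close> by (simp add: mult_right_mono)
          then have "K * exp (- s * real m) \<le> K * exp (- s' * real m)"
            using K by (intro mult_left_mono) auto
          then have "emeasure \<nu> (cyl m w) \<le> ennreal (K * exp (- s' * real m))"
            using K(2)[OF p(2), of m] by (meson ennreal_leI order_trans)
          then show "(case p of (m, w) \<Rightarrow> emeasure \<nu> (cyl m w)) \<le>
              (case p of (m, w) \<Rightarrow> ennreal K * ennreal (exp (- s' * real m)))"
            using K p by (simp add: ennreal_mult)
        qed (rule nonneg_summable_on_complete, rule zero_le)+
        also have "\<dots> \<le> ennreal K * cover_cost s' S"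
        proof (rule infsum_le_ennreal)
          fix F assume "finite F" "F \<subseteq> S"
          have "(\<Sum>(m, w)\<in>F. ennreal K * ennreal (exp (- s' * real m))) =
              ennreal K * (\<Sum>(m, w)\<in>F. ennreal (exp (- s' * real m)))"
            unfolding sum_distrib_left case_prod_unfold ..
          also have "\<dots> \<le> ennreal K * cover_cost s' S"
            by (intro mult_left_mono sum_le_infsum_ennreal \<open>finite F\<close> \<open>F \<subseteq> S\<close>) simp
          finally show "(\<Sum>(m, w)\<in>F. ennreal K * ennreal (exp (- s' * real m))) \<le> ennreal K * cover_cost s' S" .
        qed
        finally show "emeasure \<nu> B / ennreal K \<le> cover_cost s' S"
          using K0 by (intro divide_le_posI_ennreal) (auto simp: mult.commute)
      qed
      then have "ennreal K * (emeasure \<nu> B / ennreal K) \<le> ennreal K * bowen_sum full_mat s' Z n"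
        by (rule mult_left_mono) simp
      moreover have "ennreal K * (emeasure \<nu> B / ennreal K) = emeasure \<nu> B"
        using K0 by (simp add: ennreal_times_divide_self)
      ultimately show ?thesis by simp
    qed
    moreover have "(\<lambda>n. ennreal K * bowen_sum full_mat s' Z n) \<longlonglongrightarrow> ennreal K * 0"
      using s'(2) by (intro ennreal_tendsto_cmult) auto
    ultimately have "emeasure \<nu> B \<le> ennreal K * 0"
      by (intro LIMSEQ_le_const) auto
    then show False using B by simp
  qed
qed

text \<open>Covers of \<open>Z\<close> are pulled back along \<open>T\<close>.\<close>

lemma bowen_entropy_transfer:
  assumes W: "W \<subseteq> \<Omega>" and Z: "Z \<subseteq> \<Omega>" and T: "\<And>v. v \<in> W \<Longrightarrow> T v \<in> Z"
    and cov: "\<And>m w. w \<in> \<Omega> \<Longrightarrow> \<exists>F. finite F \<and> card F \<le> K \<and> F \<subseteq> {m'. m \<le> L * m' + c} \<times> \<Omega> \<and>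
        {v \<in> W. T v \<in> cyl m w} \<subseteq> (\<Union>(m', w')\<in>F. cyl m' w')"
    and L: "L > 0"
  shows "bowen_entropy full_mat W \<le> real L * bowen_entropy full_mat Z"
proof -
  define G where "G m w = (SOME F. finite F \<and> card F \<le> K \<and> F \<subseteq> {m'. m \<le> L * m' + c} \<times> \<Omega> \<and>
      {v \<in> W. T v \<in> cyl m w} \<subseteq> (\<Union>(m', w')\<in>F. cyl m' w'))" for m w
  have G: "finite (G m w) \<and> card (G m w) \<le> K \<and> G m w \<subseteq> {m'. m \<le> L * m' + c} \<times> \<Omega> \<and>
      {v \<in> W. T v \<in> cyl m w} \<subseteq> (\<Union>(m', w')\<in>G m w. cyl m' w')" if "w \<in> \<Omega>" for m w
    unfolding G_def by (rule someI_ex) (rule cov[OF that])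
  have "bowen_entropy full_mat W / real L \<le> bowen_entropy full_mat Z"
  proof (rule bowen_entropy_ge[OF Z])
    fix s :: real assume s: "s \<ge> 0" "bowen_sum full_mat s Z \<longlonglongrightarrow> 0"
    \<comment> \<open>One cylinder of length \<open>m\<close> is replaced by at most
      \<open>K\<close> cylinders of lengths \<open>m'\<close> with
      \<open>m \<le> L * m' + c\<close>, each costing at most \<open>exp (s * c)\<close> times as
      much at exponent \<open>L * s\<close>. The summand 1 covers \<open>K = 0\<close>.\<close>
    define C where "C = real K * exp (s * real c) + 1"
    have C: "C > 0" by (auto simp: C_def intro!: add_nonneg_pos)
    define s' where "s' = real L * s"
    have bound: "bowen_sum full_mat s' W n \<le> ennreal C * bowen_sum full_mat s Z (L * n + c)" for n
    proof -
      have "bowen_sum full_mat s' W n / ennreal C \<le> bowen_sum full_mat s Z (L * n + c)"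
      proof (rule bowen_sum_greatest)
        fix S assume S: "countable S" "S \<subseteq> {L * n + c..} \<times> \<Omega>" "Z \<subseteq> (\<Union>(m, w)\<in>S. cyl m w)"
        have G': "finite (G m w)" "card (G m w) \<le> K" "G m w \<subseteq> {m'. m \<le> L * m' + c} \<times> \<Omega>"
          "{v \<in> W. T v \<in> cyl m w} \<subseteq> (\<Union>(m', w')\<in>G m w. cyl m' w')" if "(m, w) \<in> S" for m w
          using G[of w m] S(2) that by auto
        define S' where "S' = (\<Union>(m, w)\<in>S. G m w)"
        have "bowen_sum full_mat s' W n \<le> cover_cost s' S'"
        proof (rule bowen_sum_le)
          show "countable S'"
            unfolding S'_def using S(1) G' by (intro countable_UN) (auto intro: countable_finite)
          show "S' \<subseteq> {n..} \<times> \<Omega>"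
          proof
            fix q assume "q \<in> S'"
            then obtain m w where mw: "(m, w) \<in> S" "q \<in> G m w" by (auto simp: S'_def)
            then have m: "L * n + c \<le> m" and "q \<in> {m'. m \<le> L * m' + c} \<times> \<Omega>"
              using S(2) G'(3) by auto
            then have "m \<le> L * fst q + c" "snd q \<in> \<Omega>" by auto
            with order_trans[OF m this(1)] show "q \<in> {n..} \<times> \<Omega>"
              using L by (cases q) simp
          qed
          show "W \<subseteq> (\<Union>(m, w)\<in>S'. cyl m w)"
          proof
            fix v assume v: "v \<in> W"
            then obtain m w where mw: "(m, w) \<in> S" "T v \<in> cyl m w" using T S(3) by fast
            then obtain m' w' where "(m', w') \<in> G m w" "v \<in> cyl m' w'"
              using G'(4)[OF mw(1)] v by auto
            then show "v \<in> (\<Union>(m, w)\<in>S'. cyl m w)"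
              using mw(1) by (auto simp: S'_def)
          qed
        qed
        also have "cover_cost s' S' \<le> ennreal C * cover_cost s S"
        proof (rule infsum_le_ennreal)
          \<comment> \<open>Unordered sums are bounded through finite subfamilies: choosing a parent
            in \<open>S\<close> for each member of \<open>F\<close> involves only finitely many
            cylinders of \<open>S\<close>.\<close>
          fix F assume F: "finite F" "F \<subseteq> S'"
          have "\<forall>q\<in>F. \<exists>p\<in>S. q \<in> G (fst p) (snd p)"
          proof
            fix q assume "q \<in> F"
            then have "q \<in> S'" using F by blast
            then show "\<exists>p\<in>S. q \<in> G (fst p) (snd p)"
              unfolding S'_def case_prod_unfold by blast
          qed
          then obtain h where h: "\<And>q. q \<in> F \<Longrightarrow> h q \<in> S \<and> q \<in> G (fst (h q)) (snd (h q))"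
            by metis
          define H where "H = h ` F"
          have H: "finite H" "H \<subseteq> S" using F h by (auto simp: H_def)
          have "(\<Sum>(m, w)\<in>F. ennreal (exp (- s' * real m))) \<le>
              (\<Sum>q\<in>(\<Union>p\<in>H. G (fst p) (snd p)). case q of (m, w) \<Rightarrow> ennreal (exp (- s' * real m)))"
          proof (rule sum_mono2)
            show "finite (\<Union>p\<in>H. G (fst p) (snd p))"
              using H G'(1) by (intro finite_UN_I) auto
            show "F \<subseteq> (\<Union>p\<in>H. G (fst p) (snd p))"
              using h by (auto simp: H_def)
          qed simp
          also have "\<dots> \<le> (\<Sum>p\<in>H. \<Sum>q\<in>G (fst p) (snd p). case q of (m, w) \<Rightarrow> ennreal (exp (- s' * real m)))"
            using H G'(1) by (intro sum_UN_le) auto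
          also have "\<dots> \<le> (\<Sum>p\<in>H. ennreal C * (case p of (m, w) \<Rightarrow> ennreal (exp (- s * real m))))"
          proof (rule sum_mono)
            fix p assume "p \<in> H"
            then obtain m w where p: "p = (m, w)" "(m, w) \<in> S" using H by (cases p) auto
            have "(case q of (m', w') \<Rightarrow> ennreal (exp (- s' * real m'))) \<le> ennreal (exp (s * real c) * exp (- s * real m))"
              if qG: "q \<in> G m w" for q
            proof -
              obtain m' w' where q: "q = (m', w')" "m \<le> L * m' + c"
                using subsetD[OF G'(3)[OF p(2)] qG] by auto
              then have "real m \<le> real L * real m' + real c"
                by (metis of_nat_add of_nat_le_iff of_nat_mult)
              then have "s * real m \<le> s * (real L * real m' + real c)"
                using s(1) by (rule mult_left_mono)
              then have "exp (- s' * real m') \<le> exp (s * real c + - s * real m)"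
                by (simp add: s'_def algebra_simps)
              then show ?thesis
                unfolding q by (simp add: exp_add[symmetric])
            qed
            then have "(\<Sum>q\<in>G m w. case q of (m', w') \<Rightarrow> ennreal (exp (- s' * real m'))) \<le>
                (\<Sum>q\<in>G m w. ennreal (exp (s * real c) * exp (- s * real m)))"
              by (rule sum_mono)
            also have "\<dots> = ennreal (real (card (G m w)) * (exp (s * real c) * exp (- s * real m)))"
              by (subst sum_ennreal) auto
            also have "\<dots> \<le> ennreal (C * exp (- s * real m))"
            proof (rule ennreal_leI)
              have "real (card (G m w)) * exp (s * real c) \<le> C"
                using G'(2)[OF p(2)] by (auto simp: C_def intro: add_increasing2 mult_right_mono)
              then show "real (card (G m w)) * (exp (s * real c) * exp (- s * real m)) \<le> C * exp (- s * real m)"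
                unfolding mult.assoc[symmetric] by (rule mult_right_mono) simp
            qed
            finally show "(\<Sum>q\<in>G (fst p) (snd p). case q of (m, w) \<Rightarrow> ennreal (exp (- s' * real m))) \<le>
                ennreal C * (case p of (m, w) \<Rightarrow> ennreal (exp (- s * real m)))"
              using C by (simp add: p ennreal_mult)
          qed
          also have "\<dots> = ennreal C * (\<Sum>p\<in>H. case p of (m, w) \<Rightarrow> ennreal (exp (- s * real m)))"
            by (rule sum_distrib_left[symmetric])
          also have "\<dots> \<le> ennreal C * cover_cost s S"
            by (intro mult_left_mono sum_le_infsum_ennreal H) simp
          finally show "(\<Sum>(m, w)\<in>F. ennreal (exp (- s' * real m))) \<le> ennreal C * cover_cost s S" .
        qed
        finally show "bowen_sum full_mat s' W n / ennreal C \<le> cover_cost s S"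
          using C by (intro divide_le_posI_ennreal) (auto simp: mult.commute)
      qed
      then have "ennreal C * (bowen_sum full_mat s' W n / ennreal C) \<le> ennreal C * bowen_sum full_mat s Z (L * n + c)"
        by (rule mult_left_mono) simp
      moreover have "ennreal C * (bowen_sum full_mat s' W n / ennreal C) = bowen_sum full_mat s' W n"
        using C by (simp add: ennreal_times_divide_self)
      ultimately show ?thesis by simp
    qed
    have "filterlim (\<lambda>n. L * n + c) sequentially sequentially"
      using L by (intro filterlim_subseq) (auto simp: strict_mono_def)
    then have "(\<lambda>n. bowen_sum full_mat s Z (L * n + c)) \<longlonglongrightarrow> 0"
      using filterlim_compose[OF s(2)] by blast
    then have "(\<lambda>n. ennreal C * bowen_sum full_mat s Z (L * n + c)) \<longlonglongrightarrow> ennreal C * 0"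
      by (rule ennreal_tendsto_cmult[rotated]) simp
    then have lim: "(\<lambda>n. ennreal C * bowen_sum full_mat s Z (L * n + c)) \<longlonglongrightarrow> 0"
      by simp
    have "bowen_sum full_mat s' W \<longlonglongrightarrow> 0"
      by (rule tendsto_sandwich[OF _ _ tendsto_const lim]) (simp_all add: bound)
    then have "bowen_entropy full_mat W \<le> s'"
      using s L by (intro bowen_entropy_le) (auto simp: s'_def)
    then show "bowen_entropy full_mat W / real L \<le> s"
      using L by (simp add: s'_def field_simps)
  qed
  then show ?thesis using L by (simp add: field_simps)
qed

section \<open>Level sets of averages over transitions\<close>

definition trans_sum :: "(nat \<Rightarrow> nat \<Rightarrow> real) \<Rightarrow> nat \<Rightarrow> (nat \<Rightarrow> nat) \<Rightarrow> real" where
  "trans_sum s n w = (\<Sum>k<n. s (w k) (w (Suc k)))"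

definition level :: "(nat \<Rightarrow> nat \<Rightarrow> real) \<Rightarrow> real \<Rightarrow> (nat \<Rightarrow> nat) set" where
  "level s \<alpha> = {w \<in> \<Omega>. (\<lambda>n. trans_sum s n w / real n) \<longlonglongrightarrow> \<alpha>}"

text \<open>The integral of \<open>s\<close> over one transition with respect to the uniform
  measure.\<close>

definition mean_weight :: "(nat \<Rightarrow> nat \<Rightarrow> real) \<Rightarrow> real" where
  "mean_weight s = (s 1 1 + s 1 2 + s 2 1 + s 2 2) / 4"

text \<open>Words have length \<open>Suc n\<close> because \<open>n\<close> transitions read
  \<open>n + 1\<close> symbols.\<close>

definition deviating :: "(nat \<Rightarrow> nat \<Rightarrow> real) \<Rightarrow> real \<Rightarrow> nat \<Rightarrow> (nat \<Rightarrow> nat) set" where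
  "deviating s \<epsilon> n = {w \<in> words (Suc n). real n * \<epsilon> \<le> \<bar>trans_sum s n w - real n * mean_weight s\<bar>}"

lemma level_subset: "level s \<alpha> \<subseteq> \<Omega>"
  by (auto simp: level_def)

lemma trans_sum_cong: "(\<And>k. k \<le> n \<Longrightarrow> v k = w k) \<Longrightarrow> trans_sum s n v = trans_sum s n w"
  by (simp add: trans_sum_def)

lemma trans_sum_Suc: "trans_sum s (Suc n) w = trans_sum s n w + s (w n) (w (Suc n))"
  by (simp add: trans_sum_def)

lemma tendsto_div_n_iff:
  fixes a b :: "nat \<Rightarrow> real"
  assumes "\<And>n. \<bar>a n - b n\<bar> \<le> C"
  shows "(\<lambda>n. a n / real n) \<longlonglongrightarrow> \<alpha> \<longleftrightarrow> (\<lambda>n. b n / real n) \<longlonglongrightarrow> \<alpha>"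
proof (rule Lim_transform_eq)
  have "(\<lambda>n. C / real n) \<longlonglongrightarrow> 0"
    by (rule lim_const_over_n)
  moreover have "norm (a n / real n - b n / real n) \<le> C / real n" for n
    using assms[of n] by (simp add: divide_right_mono flip: diff_divide_distrib)
  ultimately show "(\<lambda>n. a n / real n - b n / real n) \<longlonglongrightarrow> 0"
    by (intro Lim_null_comparison[of "\<lambda>n. a n / real n - b n / real n"]) auto
qed

subsection \<open>Large deviations for the uniform measure\<close>

text \<open>Quadratic bounds for \<open>exp\<close> settle \<open>a \<le> 1\<close>; beyond that
  \<open>a \<le> a^2\<close>. The constant is not optimal, but only the positivity of the resulting
  rate matters.\<close>

lemma cosh_le_exp_square:
  fixes a :: real
  shows "exp a + exp (- a) \<le> 2 * exp (a\<^sup>2)"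
proof -
  have *: "exp a + exp (- a) \<le> 2 * exp (a\<^sup>2)" if a: "a \<ge> 0" for a :: real
  proof (cases "a \<le> 1")
    case True
    have "exp a \<le> 1 + a + a\<^sup>2"
      using exp_bound[of a] a True by simp
    moreover have "exp (- a) \<le> 1 - a + a\<^sup>2"
    proof -
      have "1 \<le> (1 - a + a\<^sup>2) * (1 + a)"
        using a by (simp add: algebra_simps power2_eq_square)
      also have "\<dots> \<le> (1 - a + a\<^sup>2) * exp a"
        using True by (intro mult_left_mono exp_ge_add_one_self) (auto simp: zero_le_power2)
      finally show ?thesis
        by (simp add: exp_minus divide_simps mult.commute)
    qed
    ultimately show ?thesis
      using exp_ge_add_one_self[of "a\<^sup>2"] by linarith
  next
    case False
    then have "a \<le> a\<^sup>2"
      using mult_left_mono[of 1 a a] by (simp add: power2_eq_square)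
    moreover have "- a \<le> a\<^sup>2" using a by (meson neg_le_0_iff_le order_trans zero_le_power2)
    ultimately have "exp a \<le> exp (a\<^sup>2)" "exp (- a) \<le> exp (a\<^sup>2)" by simp_all
    then show ?thesis by linarith
  qed
  show ?thesis
    using *[of a] *[of "- a"] by (cases "a \<ge> 0") auto
qed

text \<open>For weights with row sums 0, the sums form a martingale under the uniform measure.\<close>

lemma sum_exp_trans_sum_le:
  assumes g: "\<And>i. g i 1 + g i 2 = 0" and D: "\<And>i. i \<in> {1, 2} \<Longrightarrow> (g i 1)\<^sup>2 \<le> D"
  shows "(\<Sum>w\<in>words (Suc n). exp (t * trans_sum g n w)) \<le> 2 * (2 * exp (t\<^sup>2 * D)) ^ n"
proof (induction n)
  case 0
  show ?case by (simp add: trans_sum_def card_words)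
next
  case (Suc n)
  have "(\<Sum>w\<in>words (Suc (Suc n)). exp (t * trans_sum g (Suc n) w)) =
      (\<Sum>w\<in>words (Suc n). exp (t * trans_sum g n w) * (exp (t * g (w n) 1) + exp (- (t * g (w n) 1))))"
    unfolding sum_words_Suc[of _ "Suc n"]
  proof (rule sum.cong[OF refl])
    fix w assume "w \<in> words (Suc n)"
    have upd: "trans_sum g (Suc n) (w(Suc n := j)) = trans_sum g n w + g (w n) j" for j
      using trans_sum_cong[of n "w(Suc n := j)" w g] by (simp add: trans_sum_Suc)
    have "g (w n) 2 = - g (w n) 1" using g[of "w n"] by simp
    then show "exp (t * trans_sum g (Suc n) (w(Suc n := 1))) + exp (t * trans_sum g (Suc n) (w(Suc n := 2))) =
        exp (t * trans_sum g n w) * (exp (t * g (w n) 1) + exp (- (t * g (w n) 1)))"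
      unfolding upd by (simp add: distrib_left right_diff_distrib exp_add exp_diff exp_minus divide_inverse)
  qed
  also have "\<dots> \<le> (\<Sum>w\<in>words (Suc n). exp (t * trans_sum g n w) * (2 * exp (t\<^sup>2 * D)))"
  proof (intro sum_mono mult_left_mono)
    fix w assume "w \<in> words (Suc n)"
    then have "w n \<in> {1, 2}" using words_subset by (auto simp: \<Omega>_def)
    then have "(t * g (w n) 1)\<^sup>2 \<le> t\<^sup>2 * D"
      using D by (simp add: power_mult_distrib mult_left_mono)
    then have "2 * exp ((t * g (w n) 1)\<^sup>2) \<le> 2 * exp (t\<^sup>2 * D)" by simp
    with cosh_le_exp_square[of "t * g (w n) 1"]
    show "exp (t * g (w n) 1) + exp (- (t * g (w n) 1)) \<le> 2 * exp (t\<^sup>2 * D)" by linarith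
  qed simp
  also have "\<dots> = (\<Sum>w\<in>words (Suc n). exp (t * trans_sum g n w)) * (2 * exp (t\<^sup>2 * D))"
    by (rule sum_distrib_right[symmetric])
  also have "\<dots> \<le> 2 * (2 * exp (t\<^sup>2 * D)) ^ n * (2 * exp (t\<^sup>2 * D))"
    by (intro mult_right_mono Suc.IH) simp
  finally show ?case by (simp add: mult_ac)
qed

lemma card_words_trans_sum_ge:
  assumes g: "\<And>i. g i 1 + g i 2 = 0" and D: "\<And>i. i \<in> {1, 2} \<Longrightarrow> (g i 1)\<^sup>2 \<le> D" "D > 0" and \<epsilon>: "\<epsilon> \<ge> 0"
  shows "real (card {w \<in> words (Suc n). real n * \<epsilon> \<le> trans_sum g n w}) \<le> 2 * (2 * exp (- (\<epsilon>\<^sup>2 / (4 * D)))) ^ n"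
    (is "real (card ?S) \<le> _")
proof -
  \<comment> \<open>The minimiser of \<open>t^2 * D - t * \<epsilon>\<close> in the exponential
    Markov inequality.\<close>
  define t where "t = \<epsilon> / (2 * D)"
  have t: "t \<ge> 0" using \<epsilon> D by (simp add: t_def)
  have "real (card ?S) * exp (t * (real n * \<epsilon>)) = (\<Sum>w\<in>?S. exp (t * (real n * \<epsilon>)))"
    by simp
  also have "\<dots> \<le> (\<Sum>w\<in>?S. exp (t * trans_sum g n w))"
    using t by (intro sum_mono) (auto intro: mult_left_mono)
  also have "\<dots> \<le> (\<Sum>w\<in>words (Suc n). exp (t * trans_sum g n w))"
    by (intro sum_mono2) auto
  also have "\<dots> \<le> 2 * (2 * exp (t\<^sup>2 * D)) ^ n"
    by (rule sum_exp_trans_sum_le) (use g D in auto)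
  finally have "real (card ?S) \<le> 2 * (2 * exp (t\<^sup>2 * D)) ^ n / exp (t * (real n * \<epsilon>))"
    by (simp add: pos_le_divide_eq)
  also have "\<dots> = 2 * (2 * exp (t\<^sup>2 * D)) ^ n * exp (- (t * \<epsilon>)) ^ n"
  proof -
    have "exp (t * (real n * \<epsilon>)) = exp (t * \<epsilon>) ^ n"
      by (simp add: mult_ac flip: exp_of_nat_mult)
    then show ?thesis by (simp add: exp_minus divide_inverse power_inverse)
  qed
  also have "\<dots> = 2 * (2 * (exp (t\<^sup>2 * D) * exp (- (t * \<epsilon>)))) ^ n"
    by (simp add: power_mult_distrib)
  also have "exp (t\<^sup>2 * D) * exp (- (t * \<epsilon>)) = exp (- (\<epsilon>\<^sup>2 / (4 * D)))"
    using D by (simp add: t_def power2_eq_square field_simps flip: exp_add)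
  finally show ?thesis .
qed

lemma card_deviating:
  assumes "\<epsilon> > 0"
  obtains \<kappa> where "\<kappa> > 0" "\<kappa> \<le> ln 2"
    and "\<forall>\<^sub>F n in sequentially. real (card (deviating s \<epsilon> n)) \<le> 4 * (2 * exp (- \<kappa>)) ^ n"
proof -
  \<comment> \<open>martingale decomposition: \<open>g\<close> has row sums 0, and the terms \<open>r i - r j\<close> telescope along a word\<close>
  define r where "r i = (s i 1 + s i 2) / 2" for i
  define g where "g i j = s i j - mean_weight s - r i + r j" for i j
  define D where "D = (g 1 1)\<^sup>2 + (g 2 1)\<^sup>2 + 1"
  \<comment> \<open>\<open>R\<close> bounds the telescoped boundary term, which for large
    \<open>n\<close> consumes at most half of \<open>\<epsilon>\<close>; hence the halved deviation
    in the rate. The cap \<open>ln 2\<close> keeps the exponent \<open>ln 2 - \<kappa> / 2\<close>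
    nonnegative where the rate is used.\<close>
  define R where "R = 2 * (\<bar>r 1\<bar> + \<bar>r 2\<bar>)"
  define \<kappa> where "\<kappa> = min ((\<epsilon> / 2)\<^sup>2 / (4 * D)) (ln 2)"
  have D0: "D > 0" by (simp add: D_def add_nonneg_pos)
  have g0: "g i 1 + g i 2 = 0" for i
    by (simp add: g_def r_def mean_weight_def field_simps)
  have D: "(g i 1)\<^sup>2 \<le> D" if "i \<in> {1, 2}" for i
    using that by (auto simp: D_def)
  have \<kappa>: "\<kappa> > 0" "\<kappa> \<le> ln 2" using assms D0 by (auto simp: \<kappa>_def)
  have decomp: "trans_sum s n w = real n * mean_weight s + trans_sum g n w + r (w 0) - r (w n)" for n w
    by (induction n) (simp_all add: trans_sum_def g_def algebra_simps)
  have neg: "trans_sum (\<lambda>i j. - g i j) n w = - trans_sum g n w" for n w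
    by (simp add: trans_sum_def sum_negf)
  obtain n0 where n0: "R \<le> real n0 * (\<epsilon> / 2)"
    using reals_Archimedean3[of "\<epsilon> / 2"] assms by (meson half_gt_zero less_imp_le)
  have "real (card (deviating s \<epsilon> n)) \<le> 4 * (2 * exp (- \<kappa>)) ^ n" if "n \<ge> n0" for n
  proof -
    let ?A = "{w \<in> words (Suc n). real n * (\<epsilon> / 2) \<le> trans_sum g n w}"
    let ?B = "{w \<in> words (Suc n). real n * (\<epsilon> / 2) \<le> trans_sum (\<lambda>i j. - g i j) n w}"
    let ?b = "2 * (2 * exp (- \<kappa>)) ^ n"
    have "real n0 * (\<epsilon> / 2) \<le> real n * (\<epsilon> / 2)"
      using that assms by (intro mult_right_mono) auto
    with n0 have R: "R \<le> real n * (\<epsilon> / 2)" by simp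
    have "deviating s \<epsilon> n \<subseteq> ?A \<union> ?B"
    proof
      fix w assume w: "w \<in> deviating s \<epsilon> n"
      then have "w \<in> \<Omega>" using words_subset by (auto simp: deviating_def)
      then have "\<bar>r (w 0) - r (w n)\<bar> \<le> R"
        using \<Omega>_cases[of w 0] \<Omega>_cases[of w n] by (auto simp: R_def)
      moreover have "real n * \<epsilon> \<le> \<bar>trans_sum g n w + r (w 0) - r (w n)\<bar>"
      proof -
        have "trans_sum s n w - real n * mean_weight s = trans_sum g n w + r (w 0) - r (w n)"
          using decomp[of n w] by simp
        then show ?thesis
          using w by (simp only: deviating_def mem_Collect_eq)
      qed
      moreover have "real n * \<epsilon> = 2 * (real n * (\<epsilon> / 2))" by simp
      ultimately have "real n * (\<epsilon> / 2) \<le> \<bar>trans_sum g n w\<bar>"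
        using R by linarith
      then show "w \<in> ?A \<union> ?B"
        using w by (auto simp: deviating_def neg abs_if split: if_splits)
    qed
    then have "card (deviating s \<epsilon> n) \<le> card ?A + card ?B"
      by (intro order_trans[OF card_mono card_Un_le]) simp_all
    moreover have "real (card ?A) \<le> 2 * (2 * exp (- ((\<epsilon> / 2)\<^sup>2 / (4 * D)))) ^ n"
      by (rule card_words_trans_sum_ge) (use g0 D D0 assms in auto)
    moreover have "real (card ?B) \<le> 2 * (2 * exp (- ((\<epsilon> / 2)\<^sup>2 / (4 * D)))) ^ n"
    proof (rule card_words_trans_sum_ge)
      show "- g i 1 + - g i 2 = 0" for i using g0[of i] by simp
    qed (use D D0 assms in auto)
    moreover have "2 * (2 * exp (- ((\<epsilon> / 2)\<^sup>2 / (4 * D)))) ^ n \<le> ?b"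
      by (intro mult_left_mono power_mono) (auto simp: \<kappa>_def)
    ultimately show ?thesis by linarith
  qed
  then show ?thesis
    using that \<kappa> eventually_sequentially by blast
qed

lemma level_eventually_deviating:
  assumes "w \<in> level s \<alpha>" "\<alpha> \<noteq> mean_weight s"
  shows "\<forall>\<^sub>F n in sequentially. word_of (Suc n) w \<in> deviating s (\<bar>\<alpha> - mean_weight s\<bar> / 2) n"
proof -
  let ?e = "\<bar>\<alpha> - mean_weight s\<bar> / 2"
  have w: "w \<in> \<Omega>" and lim: "(\<lambda>n. trans_sum s n w / real n) \<longlonglongrightarrow> \<alpha>"
    using assms by (auto simp: level_def)
  have "\<forall>\<^sub>F n in sequentially. dist (trans_sum s n w / real n) \<alpha> < ?e"
    using tendstoD[OF lim, of ?e] assms(2) by simp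
  then show ?thesis
    using eventually_gt_at_top[of 0]
  proof eventually_elim
    case (elim n)
    have "?e \<le> \<bar>trans_sum s n w / real n - mean_weight s\<bar>"
      using elim(1) abs_triangle_ineq4[of "trans_sum s n w / real n - mean_weight s" "trans_sum s n w / real n - \<alpha>"]
      by (simp add: dist_real_def)
    then have "real n * ?e \<le> real n * \<bar>trans_sum s n w / real n - mean_weight s\<bar>"
      by (intro mult_left_mono) auto
    also have "\<dots> = \<bar>trans_sum s n w - real n * mean_weight s\<bar>"
      using elim(2) by (simp add: abs_mult[of "real n", symmetric, simplified] right_diff_distrib)
    also have "trans_sum s n w = trans_sum s n (word_of (Suc n) w)"
      by (rule trans_sum_cong) (simp add: word_of_def)
    finally show ?case
      by (simp add: deviating_def word_of_in_words[OF w])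
  qed
qed

text \<open>Every point of the level set eventually has only deviating prefixes, so the deviating
  words of all lengths beyond \<open>N\<close> cover it. Half of the gain \<open>\<kappa>\<close> in
  their number lowers the exponent, the other half makes the series over the lengths
  converge.\<close>

lemma bowen_entropy_level_less:
  assumes "\<alpha> \<noteq> mean_weight s"
  shows "bowen_entropy full_mat (level s \<alpha>) < ln 2"
proof -
  let ?e = "\<bar>\<alpha> - mean_weight s\<bar> / 2"
  have "?e > 0" using assms by simp
  then obtain \<kappa> where \<kappa>: "\<kappa> > 0" "\<kappa> \<le> ln 2"
    and "\<forall>\<^sub>F n in sequentially. real (card (deviating s ?e n)) \<le> 4 * (2 * exp (- \<kappa>)) ^ n"
    using card_deviating[of ?e s] by blast
  then obtain n0 where n0: "\<And>n. n \<ge> n0 \<Longrightarrow> real (card (deviating s ?e n)) \<le> 4 * (2 * exp (- \<kappa>)) ^ n"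
    by (auto simp: eventually_sequentially)
  define t where "t = ln 2 - \<kappa> / 2"
  define q where "q = exp (- (\<kappa> / 2))"
  have q: "0 < q" "q < 1" using \<kappa> by (auto simp: q_def)
  have t: "t \<ge> 0" "t < ln 2" using \<kappa> by (auto simp: t_def)
  have geo: "(\<Sum>n\<in>{N..<M}. q ^ n) \<le> q ^ N / (1 - q)" for N M
  proof (cases "N \<le> M")
    case True
    have "(\<Sum>n\<in>{N..<M}. q ^ n) = (\<Sum>n<M - N. q ^ N * q ^ n)"
      by (rule sum.reindex_bij_witness[of _ "\<lambda>n. n + N" "\<lambda>n. n - N"]) (use True in \<open>auto simp flip: power_add\<close>)
    also have "\<dots> = q ^ N * ((1 - q ^ (M - N)) / (1 - q))"
      using q by (simp add: sum_gp_strict flip: sum_distrib_left)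
    also have "\<dots> \<le> q ^ N * (1 / (1 - q))"
      using q by (intro mult_left_mono divide_right_mono) auto
    finally show ?thesis by simp
  qed (use q in simp)
  have "bowen_sum full_mat t (level s \<alpha>) N \<le> ennreal (4 * (q ^ N / (1 - q)))" if N: "N \<ge> n0" for N
  proof -
    define S where "S = (\<lambda>(n, w). (Suc n, w)) ` (SIGMA n:{N..}. deviating s ?e n)"
    have "bowen_sum full_mat t (level s \<alpha>) N \<le> cover_cost t S"
    proof (rule bowen_sum_le)
      have "countable (SIGMA n:{N..}. deviating s ?e n)"
        by (intro countable_SIGMA) (auto intro: countable_finite simp: deviating_def)
      then show "countable S" unfolding S_def by (rule countable_image)
      show "S \<subseteq> {N..} \<times> \<Omega>"
        using words_subset by (auto simp: S_def deviating_def)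
      show "level s \<alpha> \<subseteq> (\<Union>(m, w)\<in>S. cyl m w)"
      proof
        fix w assume w: "w \<in> level s \<alpha>"
        obtain n where n: "n \<ge> N" "word_of (Suc n) w \<in> deviating s ?e n"
          using level_eventually_deviating[OF w assms] eventually_sequentially
          by (metis (no_types, lifting) max.cobounded1 max.cobounded2)
        have "w \<in> cyl (Suc n) (word_of (Suc n) w)"
          using w level_subset by (auto simp: cyl_word_of intro: self_in_cyl)
        with n show "w \<in> (\<Union>(m, w)\<in>S. cyl m w)"
          by (intro UN_I[of "(Suc n, word_of (Suc n) w)"]) (auto simp: S_def)
      qed
    qed
    also have "\<dots> \<le> ennreal (4 * (q ^ N / (1 - q)))"
    proof (rule infsum_le_ennreal)
      fix F assume F: "finite F" "F \<subseteq> S"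
      define M where "M = Suc (Max (insert N (fst ` F)))"
      have M: "m < M" if "(m, w) \<in> F" for m w
        using that F by (auto simp: M_def less_Suc_eq_le intro!: Max_ge image_eqI[of _ fst "(m, w)"])
      have "F \<subseteq> (\<lambda>(n, w). (Suc n, w)) ` (SIGMA n:{N..<M}. deviating s ?e n)"
      proof
        fix p assume "p \<in> F"
        with F obtain n w where p: "p = (Suc n, w)" "n \<ge> N" "w \<in> deviating s ?e n"
          by (auto simp: S_def)
        then have "n < M" using M \<open>p \<in> F\<close> by fastforce
        with p show "p \<in> (\<lambda>(n, w). (Suc n, w)) ` (SIGMA n:{N..<M}. deviating s ?e n)"
          by force
      qed
      then have "(\<Sum>(m, w)\<in>F. exp (- t * real m)) \<le>
          (\<Sum>(m, w)\<in>(\<lambda>(n, w). (Suc n, w)) ` (SIGMA n:{N..<M}. deviating s ?e n). exp (- t * real m))"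
        by (intro sum_mono2) (auto simp: deviating_def)
      also have "\<dots> = (\<Sum>(n, w)\<in>(SIGMA n:{N..<M}. deviating s ?e n). exp (- t * real (Suc n)))"
        by (subst sum.reindex) (auto simp: inj_on_def case_prod_unfold)
      also have "\<dots> = (\<Sum>n\<in>{N..<M}. real (card (deviating s ?e n)) * exp (- t * real (Suc n)))"
        by (subst sum.Sigma[symmetric]) (auto simp: deviating_def)
      also have "\<dots> \<le> (\<Sum>n\<in>{N..<M}. 4 * q ^ n)"
      proof (rule sum_mono)
        fix n assume n: "n \<in> {N..<M}"
        have "exp (- t * real (Suc n)) \<le> exp (- t) ^ n"
          using t by (simp add: algebra_simps flip: exp_of_nat_mult)
        then have "real (card (deviating s ?e n)) * exp (- t * real (Suc n)) \<le>
            4 * (2 * exp (- \<kappa>)) ^ n * exp (- t) ^ n"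
          using n0[of n] n N by (intro mult_mono) auto
        also have "\<dots> = 4 * (2 * exp (- \<kappa>) * exp (- t)) ^ n"
          by (simp add: power_mult_distrib)
        also have "2 * exp (- \<kappa>) * exp (- t) = q"
        proof -
          have "2 * exp (- \<kappa>) * exp (- t) = exp (ln 2) * exp (- \<kappa>) * exp (- t)" by simp
          also have "\<dots> = q" by (simp only: q_def t_def flip: exp_add) simp
          finally show ?thesis .
        qed
        finally show "real (card (deviating s ?e n)) * exp (- t * real (Suc n)) \<le> 4 * q ^ n" .
      qed
      also have "\<dots> \<le> 4 * (q ^ N / (1 - q))"
        using geo[of N M] by (simp flip: sum_distrib_left)
      finally have "ennreal (\<Sum>(m, w)\<in>F. exp (- t * real m)) \<le> ennreal (4 * (q ^ N / (1 - q)))"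
        by (rule ennreal_leI)
      then show "(\<Sum>(m, w)\<in>F. ennreal (exp (- t * real m))) \<le> ennreal (4 * (q ^ N / (1 - q)))"
        by (simp add: case_prod_unfold)
    qed
    finally show ?thesis .
  qed
  then have le: "\<forall>\<^sub>F N in sequentially. bowen_sum full_mat t (level s \<alpha>) N \<le> ennreal (4 * (q ^ N / (1 - q)))"
    by (auto simp: eventually_sequentially)
  have "(\<lambda>N. 4 * (q ^ N / (1 - q))) \<longlonglongrightarrow> 4 * (0 / (1 - q))"
    using q by (intro tendsto_intros LIMSEQ_realpow_zero) auto
  then have "(\<lambda>N. ennreal (4 * (q ^ N / (1 - q)))) \<longlonglongrightarrow> 0"
    using tendsto_ennrealI by fastforce
  then have "bowen_sum full_mat t (level s \<alpha>) \<longlonglongrightarrow> 0"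
    by (intro tendsto_sandwich[OF _ le tendsto_const]) simp_all
  then have "bowen_entropy full_mat (level s \<alpha>) \<le> t"
    using t by (intro bowen_entropy_le) auto
  then show ?thesis using t by simp
qed

subsection \<open>The uniform measure\<close>

interpretation uniform: markov_params "1 / 2" "1 / 2"
  by unfold_locales auto

lemma measure_uniform_cyl:
  assumes "w \<in> \<Omega>"
  shows "measure (markov (1 / 2) (1 / 2)) (cyl n w) = (1 / 2) ^ n"
proof (cases n)
  case 0
  then show ?thesis using uniform.prob_space by simp
next
  case (Suc m)
  have "tprob (1 / 2) (1 / 2) i j = 1 / 2" "stat (1 / 2) (1 / 2) i = 1 / 2" for i j
    by (simp_all add: tprob_def stat_def)
  then show ?thesis
    by (simp only: Suc uniform.measure_markov_cyl[OF assms]) simp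
qed

lemma emeasure_uniform_cyl:
  assumes "w \<in> \<Omega>"
  shows "emeasure (markov (1 / 2) (1 / 2)) (cyl n w) \<le> ennreal (1 * exp (- ln 2 * real n))"
proof -
  have "exp (- ln 2 * real n) = (1 / 2) ^ n"
    by (simp add: exp_minus power_one_over inverse_eq_divide mult.commute[of _ "real n"] exp_of_nat_mult)
  then show ?thesis
    by (simp add: uniform.emeasure_eq_measure measure_uniform_cyl[OF assms])
qed

lemma bowen_entropy_\<Omega>_ge: "ln 2 \<le> bowen_entropy full_mat \<Omega>"
proof (rule mass_distribution[where \<nu> = "markov (1 / 2) (1 / 2)" and B = \<Omega> and K = 1])
  show "emeasure (markov (1 / 2) (1 / 2)) \<Omega> > 0"
    using uniform.emeasure_space_1 by simp
qed (use emeasure_uniform_cyl in auto)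

text \<open>The strong law of large numbers: the exponential bound on deviating words is summable,
  so Borel-Cantelli applies to each threshold \<open>1 / (j + 1)\<close>.\<close>

lemma AE_uniform_level: "AE w in markov (1 / 2) (1 / 2). w \<in> level s (mean_weight s)"
proof -
  let ?\<nu> = "markov (1 / 2) (1 / 2)"
  define A where "A \<epsilon> n = (\<Union>w\<in>deviating s \<epsilon> n. cyl (Suc n) w)" for \<epsilon> n
  have A_sets: "A \<epsilon> n \<in> sets ?\<nu>" for \<epsilon> n
    unfolding A_def by (intro sets.finite_UN) (auto simp: deviating_def)
  have "AE w in ?\<nu>. \<forall>\<^sub>F n in sequentially. w \<in> space ?\<nu> - A \<epsilon> n" if \<epsilon>: "\<epsilon> > 0" for \<epsilon>
  proof (rule borel_cantelli_AE1[OF A_sets])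
    obtain \<kappa> where \<kappa>: "\<kappa> > 0"
      and ev: "\<forall>\<^sub>F n in sequentially. real (card (deviating s \<epsilon> n)) \<le> 4 * (2 * exp (- \<kappa>)) ^ n"
      using card_deviating[OF \<epsilon>] by blast
    have "\<forall>\<^sub>F n in sequentially. norm (measure ?\<nu> (A \<epsilon> n)) \<le> 4 * exp (- \<kappa>) ^ n"
      using ev
    proof eventually_elim
      case (elim n)
      have "measure ?\<nu> (A \<epsilon> n) \<le> (\<Sum>w\<in>deviating s \<epsilon> n. measure ?\<nu> (cyl (Suc n) w))"
        unfolding A_def by (rule measure_UNION_le) (auto simp: deviating_def)
      also have "\<dots> = (\<Sum>w\<in>deviating s \<epsilon> n. (1 / 2) ^ Suc n)"
        using words_subset by (intro sum.cong refl measure_uniform_cyl) (auto simp: deviating_def)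
      also have "\<dots> = real (card (deviating s \<epsilon> n)) * (1 / 2) ^ Suc n"
        by simp
      also have "\<dots> \<le> 4 * (2 * exp (- \<kappa>)) ^ n * (1 / 2) ^ n"
        using elim by (intro mult_mono) auto
      also have "\<dots> = 4 * exp (- \<kappa>) ^ n"
        by (simp add: power_mult_distrib power_one_over)
      finally show ?case by simp
    qed
    moreover have "summable (\<lambda>n. 4 * exp (- \<kappa>) ^ n)"
      using \<kappa> by (intro summable_mult summable_geometric) auto
    ultimately show "summable (\<lambda>n. measure ?\<nu> (A \<epsilon> n))"
      by (rule summable_comparison_test_ev)
  qed (simp add: uniform.emeasure_eq_measure)
  then have "AE w in ?\<nu>. \<forall>j::nat. \<forall>\<^sub>F n in sequentially. w \<in> space ?\<nu> - A (inverse (real (Suc j))) n"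
    unfolding AE_all_countable by simp
  then show ?thesis
  proof (rule AE_mp[OF _ AE_I2[OF impI]])
    fix w assume "w \<in> space ?\<nu>"
      and ev: "\<forall>j::nat. \<forall>\<^sub>F n in sequentially. w \<in> space ?\<nu> - A (inverse (real (Suc j))) n"
    then have w: "w \<in> \<Omega>" by simp
    have "(\<lambda>n. trans_sum s n w / real n) \<longlonglongrightarrow> mean_weight s"
    proof (rule tendstoI)
      fix e :: real assume "e > 0"
      then obtain j where j: "inverse (real (Suc j)) < e" using reals_Archimedean by blast
      show "\<forall>\<^sub>F n in sequentially. dist (trans_sum s n w / real n) (mean_weight s) < e"
        using ev[rule_format, of j] eventually_gt_at_top[of 0]
      proof eventually_elim
        case (elim n)
        have "word_of (Suc n) w \<notin> deviating s (inverse (real (Suc j))) n"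
          using elim(1) self_in_cyl[OF w, of "Suc n"] by (auto simp: A_def cyl_word_of)
        moreover have "trans_sum s n (word_of (Suc n) w) = trans_sum s n w"
          by (rule trans_sum_cong) (simp add: word_of_def)
        ultimately have "\<bar>trans_sum s n w - real n * mean_weight s\<bar> < real n * inverse (real (Suc j))"
          using word_of_in_words[OF w] by (simp add: deviating_def not_le)
        also have "\<dots> \<le> real n * e" using j by (intro mult_left_mono) auto
        finally have "\<bar>trans_sum s n w - real n * mean_weight s\<bar> / real n < e"
          using elim(2) by (simp add: pos_divide_less_eq mult.commute)
        moreover have "\<bar>trans_sum s n w - real n * mean_weight s\<bar> / real n =
            dist (trans_sum s n w / real n) (mean_weight s)"
        proof -
          have "trans_sum s n w / real n - mean_weight s = (trans_sum s n w - real n * mean_weight s) / real n"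
            using elim(2) by (simp add: diff_divide_distrib)
          then show ?thesis by (simp add: dist_real_def)
        qed
        ultimately show ?case by simp
      qed
    qed
    with w show "w \<in> level s (mean_weight s)" by (simp add: level_def)
  qed
qed

text \<open>The mass distribution principle for the uniform measure. Removing a null set from
  \<open>\<Omega>\<close> gives a measurable subset of the level set, so the level set itself need
  not be shown measurable.\<close>

lemma bowen_entropy_level_mean_ge: "ln 2 \<le> bowen_entropy full_mat (level s (mean_weight s))"
proof -
  let ?\<nu> = "markov (1 / 2) (1 / 2)"
  obtain N where N: "\<And>w. w \<in> space ?\<nu> - N \<Longrightarrow> w \<in> level s (mean_weight s)" "N \<in> null_sets ?\<nu>"
    using AE_E3[OF AE_uniform_level] by blast
  show ?thesis
  proof (rule mass_distribution[where \<nu> = ?\<nu> and B = "\<Omega> - N" and K = 1])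
    have "emeasure ?\<nu> (\<Omega> - N) = emeasure ?\<nu> (space ?\<nu>)"
      using emeasure_Diff_null_set[OF N(2), of "space ?\<nu>"] by simp
    then show "emeasure ?\<nu> (\<Omega> - N) > 0"
      using uniform.emeasure_space_1 by simp
  qed (use N emeasure_uniform_cyl level_subset in auto)
qed

subsection \<open>Block codes\<close>

lemma trans_sum_bounded:
  assumes "w \<in> \<Omega>"
  shows "\<bar>trans_sum s n w\<bar> \<le> real n * (\<bar>s 1 1\<bar> + \<bar>s 1 2\<bar> + \<bar>s 2 1\<bar> + \<bar>s 2 2\<bar>)"
proof -
  have "\<bar>trans_sum s n w\<bar> \<le> (\<Sum>k<n. \<bar>s (w k) (w (Suc k))\<bar>)"
    unfolding trans_sum_def by (rule sum_abs)
  also have "\<dots> \<le> (\<Sum>k<n. \<bar>s 1 1\<bar> + \<bar>s 1 2\<bar> + \<bar>s 2 1\<bar> + \<bar>s 2 2\<bar>)"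
  proof (rule sum_mono)
    fix k
    consider "w k = 1" "w (Suc k) = 1" | "w k = 1" "w (Suc k) = 2"
      | "w k = 2" "w (Suc k) = 1" | "w k = 2" "w (Suc k) = 2"
      using \<Omega>_cases[OF assms, of k] \<Omega>_cases[OF assms, of "Suc k"] by blast
    then show "\<bar>s (w k) (w (Suc k))\<bar> \<le> \<bar>s 1 1\<bar> + \<bar>s 1 2\<bar> + \<bar>s 2 1\<bar> + \<bar>s 2 2\<bar>"
      by cases simp_all
  qed
  finally show ?thesis by simp
qed

text \<open>
  Free concatenations of two words \<open>u\<close>, \<open>v\<close> of length \<open>L\<close> with the same initial symbol and the same
  sum, including the transition into the next block, all have the same average.
\<close>

lemma bowen_entropy_level_block:
  fixes u v :: "nat \<Rightarrow> nat"
  assumes u: "u \<in> \<Omega>" and v: "v \<in> \<Omega>"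
    and ends: "u L = u 0" "v L = u 0" "v 0 = u 0"
    and sums: "trans_sum s L u = W" "trans_sum s L v = W"
    and diff: "r < L" "u r \<noteq> v r"
  shows "bowen_entropy full_mat (level s (W / real L)) > 0"
proof -
  have L: "L > 0" using diff by simp
  define B where "B i = (if i = (1::nat) then u else v)" for i
  define T where "T w n = B (w (n div L)) (n mod L)" for w n
  have B: "B i \<in> \<Omega>" "B i 0 = u 0" "B i L = u 0" "trans_sum s L (B i) = W" for i
    using u v ends sums by (auto simp: B_def)
  have T_in: "T w \<in> \<Omega>" for w
    using B(1) by (simp add: T_def \<Omega>_def)
  \<comment> \<open>Position \<open>k = L\<close> is the first symbol of the next block. It equals
    \<open>u 0\<close> for either choice, so the transition between blocks counts as part of the
    earlier block.\<close>
  have T_block: "T w (q * L + k) = B (w q) k" if "k \<le> L" for w q k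
  proof (cases "k = L")
    case True
    have "(q * L + L) div L = q + 1" using L by simp
    then show ?thesis using True B L by (simp add: T_def)
  qed (use that in \<open>simp add: T_def\<close>)
  have T_sum: "trans_sum s (q * L + k) (T w) = real q * W + trans_sum s k (\<lambda>i. T w (q * L + i))" for q k w
  proof -
    have shift: "trans_sum s (m + k) z = trans_sum s m z + trans_sum s k (\<lambda>i. z (m + i))" for m k z
      unfolding trans_sum_def by (induction k) auto
    have "trans_sum s (q * L) (T w) = real q * W"
    proof (induction q)
      case (Suc q)
      have "trans_sum s (Suc q * L) (T w) = trans_sum s (q * L) (T w) + trans_sum s L (\<lambda>i. T w (q * L + i))"
        using shift[of "q * L" L "T w"] by (simp add: add.commute)
      also have "trans_sum s L (\<lambda>i. T w (q * L + i)) = trans_sum s L (B (w q))"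
        by (rule trans_sum_cong) (simp add: T_block)
      finally show ?case using Suc B(4) by (simp add: algebra_simps)
    qed (simp add: trans_sum_def)
    then show ?thesis by (simp add: shift)
  qed
  define S where "S = \<bar>s 1 1\<bar> + \<bar>s 1 2\<bar> + \<bar>s 2 1\<bar> + \<bar>s 2 2\<bar>"
  have T_level: "T w \<in> level s (W / real L)" for w
  proof -
    have "\<bar>trans_sum s n (T w) - real n * (W / real L)\<bar> \<le> real L * S + \<bar>W\<bar>" for n
    proof -
      define q where "q = n div L"
      define k where "k = n mod L"
      have n: "n = q * L + k" and k: "k < L" using L by (simp_all add: q_def k_def)
      have "(\<lambda>i. T w (q * L + i)) \<in> \<Omega>" using T_in[of w] by (simp add: \<Omega>_def)
      then have "\<bar>trans_sum s k (\<lambda>i. T w (q * L + i))\<bar> \<le> real k * S"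
        unfolding S_def by (rule trans_sum_bounded)
      also have "\<dots> \<le> real L * S"
        using k by (intro mult_right_mono) (auto simp: S_def)
      finally have 1: "\<bar>trans_sum s k (\<lambda>i. T w (q * L + i))\<bar> \<le> real L * S" .
      have "\<bar>real k * (W / real L)\<bar> = (real k / real L) * \<bar>W\<bar>"
        by (simp add: abs_mult)
      also have "\<dots> \<le> 1 * \<bar>W\<bar>"
        using k by (intro mult_right_mono) auto
      finally have 2: "\<bar>real k * (W / real L)\<bar> \<le> \<bar>W\<bar>" by simp
      have "real n * (W / real L) = real q * W + real k * (W / real L)"
        using L by (simp add: n distrib_right add_divide_distrib)
      then have eq: "trans_sum s n (T w) - real n * (W / real L) =
          trans_sum s k (\<lambda>i. T w (q * L + i)) - real k * (W / real L)"
        using T_sum[of q k w] n by simp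
      show ?thesis
        unfolding eq by (rule order_trans[OF abs_triangle_ineq4 add_mono[OF 1 2]])
    qed
    moreover have "(\<lambda>n. real n * (W / real L) / real n) \<longlonglongrightarrow> W / real L"
      by (rule tendsto_eventually) (auto simp: eventually_sequentially intro!: exI[of _ 1])
    ultimately show ?thesis
      using tendsto_div_n_iff[of "\<lambda>n. trans_sum s n (T w)" "\<lambda>n. real n * (W / real L)"] T_in
      by (auto simp: level_def)
  qed
  \<comment> \<open>The symbol at offset \<open>r\<close> reveals which block was used, so
    \<open>m\<close> symbols of \<open>T z\<close> determine \<open>m div L\<close> symbols of
    \<open>z\<close>. The level set thus keeps at least the fraction \<open>1 / L\<close> of the
    entropy of the full shift.\<close>
  have "bowen_entropy full_mat \<Omega> \<le> real L * bowen_entropy full_mat (level s (W / real L))"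
  proof (rule bowen_entropy_transfer[where T = T and K = 1 and c = L])
    fix m and w :: "nat \<Rightarrow> nat"
    let ?P = "{z \<in> \<Omega>. T z \<in> cyl m w}"
    show "\<exists>F. finite F \<and> card F \<le> 1 \<and> F \<subseteq> {m'. m \<le> L * m' + L} \<times> \<Omega> \<and>
        ?P \<subseteq> (\<Union>(m', w')\<in>F. cyl m' w')"
    proof (cases "?P = {}")
      case True
      show ?thesis unfolding True by (intro exI[of _ "{}"]) simp
    next
      case False
      then obtain z where z: "z \<in> \<Omega>" "T z \<in> cyl m w" by auto
      have "?P \<subseteq> cyl (m div L) z"
      proof
        fix z' assume "z' \<in> ?P"
        then have z': "z' \<in> \<Omega>" "T z' \<in> cyl m w" by auto
        have "z' q = z q" if q: "q < m div L" for q
        proof -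
          have "Suc q * L \<le> (m div L) * L" using q by (intro mult_le_mono1) simp
          also have "\<dots> \<le> m" by simp
          finally have "q * L + r < m" using diff(1) by simp
          then have "T z' (q * L + r) = T z (q * L + r)"
            using z z' by (simp add: cyl_def)
          then have "B (z' q) r = B (z q) r"
            using diff(1) by (simp add: T_block)
          then show ?thesis
            using diff(2) \<Omega>_cases[OF z(1), of q] \<Omega>_cases[OF z'(1), of q]
            by (auto simp: B_def split: if_splits)
        qed
        then show "z' \<in> cyl (m div L) z" using z' by (simp add: cyl_def)
      qed
      moreover have "m \<le> L * (m div L) + L"
      proof -
        have "m = L * (m div L) + m mod L" by simp
        moreover have "m mod L \<le> L" using L by (simp add: less_imp_le)
        ultimately show ?thesis by linarith
      qed
      ultimately show ?thesis
        using z(1) by (intro exI[of _ "{(m div L, z)}"]) auto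
    qed
  qed (use L T_level level_subset in auto)
  then have "0 < real L * bowen_entropy full_mat (level s (W / real L))"
    using bowen_entropy_\<Omega>_ge less_le_trans[OF ln_gt_zero[of 2]] by fastforce
  then show ?thesis using L by (simp add: zero_less_mult_iff)
qed

text \<open>The two blocks consist of \<open>a\<close> except for a single \<open>b\<close> at
  position 1 or 2. Both exceed \<open>L\<close> loops at \<open>a\<close> by the same amount
  \<open>c\<close>, so the average is off by \<open>c / L\<close>. \<open>L \<ge> 3\<close> leaves
  room for both positions.\<close>

lemma bowen_entropy_level_near_loop:
  assumes ab: "a \<in> {1, 2}" "b \<in> {1, 2}" "a \<noteq> b" and "e > 0"
  obtains \<alpha> where "\<bar>\<alpha> - s a a\<bar> < e" "bowen_entropy full_mat (level s \<alpha>) > 0"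
proof -
  define c where "c = s a b + s b a - 2 * s a a"
  have "(\<lambda>n. c / real n) \<longlonglongrightarrow> 0" by (rule lim_const_over_n)
  then have "\<forall>\<^sub>F n in sequentially. \<bar>c / real n\<bar> < e"
    using \<open>e > 0\<close> by (auto simp: tendsto_iff)
  then have "\<forall>\<^sub>F L in sequentially. \<bar>c / real L\<bar> < e \<and> 3 \<le> L"
    using eventually_ge_at_top[of 3] by eventually_elim simp
  then obtain L where L: "\<bar>c / real L\<bar> < e" "L \<ge> 3"
    by (auto simp: eventually_sequentially)
  define v where "v p r = (if r = (p::nat) then b else a)" for p r
  have v_in: "v p \<in> \<Omega>" for p using ab by (auto simp: v_def \<Omega>_def)
  have v_sum: "trans_sum s L (v (Suc p)) = real L * s a a + c" if "Suc p < L" for p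
  proof -
    have "s (v (Suc p) k) (v (Suc p) (Suc k)) =
        s a a + (if k = p then s a b - s a a else 0) + (if k = Suc p then s b a - s a a else 0)" for k
      by (auto simp: v_def)
    then show ?thesis
      unfolding trans_sum_def using that by (simp add: sum.distrib c_def algebra_simps)
  qed
  have "bowen_entropy full_mat (level s ((real L * s a a + c) / real L)) > 0"
    using v_in by (rule bowen_entropy_level_block[where u = "v 1" and v = "v 2" and r = 1])
      (use v_in v_sum[of 0] v_sum[of 1] L ab in \<open>auto simp: numeral_2_eq_2 v_def\<close>)
  moreover have "(real L * s a a + c) / real L = s a a + c / real L"
    using L by (simp add: add_divide_distrib)
  ultimately show ?thesis
    using that[of "s a a + c / real L"] L by simp
qed

lemma bowen_entropy_level_near_2_loop:
  assumes "e > 0"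
  obtains \<alpha> where "\<bar>\<alpha> - (s 1 2 + s 2 1) / 2\<bar> < e" "bowen_entropy full_mat (level s \<alpha>) > 0"
proof -
  define z where "z = s 1 2 + s 2 1"
  define c where "c = s 1 1 - z / 2"
  have "(\<lambda>n. c / real n) \<longlonglongrightarrow> 0" by (rule lim_const_over_n)
  then have "\<forall>\<^sub>F n in sequentially. \<bar>c / real n\<bar> < e"
    using \<open>e > 0\<close> by (auto simp: tendsto_iff)
  then obtain n0 where n0: "\<And>n. n \<ge> n0 \<Longrightarrow> \<bar>c / real n\<bar> < e"
    by (auto simp: eventually_sequentially)
  define k where "k = Suc n0"
  define L where "L = 2 * k + 1"
  have L: "\<bar>c / real L\<bar> < e" using n0[of L] by (simp add: L_def k_def)
  \<comment> \<open>Both blocks run \<open>k\<close> times around the 2-cycle and once through the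
    loop at 1: \<open>u\<close> takes the loop first, \<open>v\<close> last. The auxiliary sequence
    \<open>a\<close> alternates strictly and agrees with \<open>v\<close> up to position
    \<open>2 * k\<close>.\<close>
  define u where "u r = (if r = 0 \<or> odd r then 1 else 2 :: nat)" for r :: nat
  define a where "a r = (if even r then 1 else 2 :: nat)" for r :: nat
  define v where "v r = (if odd r \<and> r < L then 2 else 1 :: nat)" for r :: nat
  have uL: "trans_sum s (2 * j + 1) u = real j * z + s 1 1" for j
    by (induction j) (auto simp: trans_sum_def u_def z_def algebra_simps)
  have aL: "trans_sum s (2 * j) a = real j * z" for j
    by (induction j) (auto simp: trans_sum_def a_def z_def algebra_simps)
  have "trans_sum s (2 * k) v = trans_sum s (2 * k) a"
    by (rule trans_sum_cong) (auto simp: v_def a_def L_def)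
  moreover have "v (2 * k) = 1" "v (Suc (2 * k)) = 1" by (auto simp: v_def L_def)
  ultimately have vL: "trans_sum s L v = real k * z + s 1 1"
    by (simp add: L_def trans_sum_Suc aL)
  have "bowen_entropy full_mat (level s ((real k * z + s 1 1) / real L)) > 0"
  proof (rule bowen_entropy_level_block[where u = u and v = v and r = 1])
    show "u \<in> \<Omega>" "v \<in> \<Omega>" by (auto simp: u_def v_def \<Omega>_def)
    show "trans_sum s L u = real k * z + s 1 1" using uL[of k] by (simp add: L_def)
  qed (use vL in \<open>auto simp: u_def v_def L_def k_def\<close>)
  moreover have "(real k * z + s 1 1) / real L = z / 2 + c / real L"
    by (simp add: L_def c_def field_simps)
  ultimately show ?thesis
    using that[of "z / 2 + c / real L"] L by (simp add: z_def)
qed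

subsection \<open>Range and cohomology\<close>

lemma level_range:
  assumes s: "\<And>i j. i \<in> {1, 2} \<Longrightarrow> j \<in> {1, 2} \<Longrightarrow> lo \<le> s i j \<and> s i j \<le> hi"
    and w: "w \<in> level s \<alpha>"
  shows "lo \<le> \<alpha>" "\<alpha> \<le> hi"
proof -
  have lim: "(\<lambda>n. trans_sum s n w / real n) \<longlonglongrightarrow> \<alpha>" and \<Omega>: "w \<in> \<Omega>"
    using w by (auto simp: level_def)
  have "w k \<in> {1, 2}" for k using \<Omega> by (auto simp: \<Omega>_def)
  then have "real n * lo \<le> trans_sum s n w" "trans_sum s n w \<le> real n * hi" for n
    using sum_bounded_below[of "{..<n}" lo "\<lambda>k. s (w k) (w (Suc k))"]
      sum_bounded_above[of "{..<n}" "\<lambda>k. s (w k) (w (Suc k))" hi] s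
    by (auto simp: trans_sum_def)
  then have bounds: "lo \<le> trans_sum s n w / real n" "trans_sum s n w / real n \<le> hi" if "n > 0" for n
    using that by (simp_all add: field_simps)
  have "\<forall>\<^sub>F n in sequentially. lo \<le> trans_sum s n w / real n"
    "\<forall>\<^sub>F n in sequentially. trans_sum s n w / real n \<le> hi"
    using eventually_gt_at_top[of 0] by (eventually_elim, simp add: bounds)+
  then show "lo \<le> \<alpha>" "\<alpha> \<le> hi"
    using tendsto_lowerbound[OF lim] tendsto_upperbound[OF lim] by auto
qed

lemma level_cohomologous:
  assumes "\<And>i j. i \<in> {1, 2} \<Longrightarrow> j \<in> {1, 2} \<Longrightarrow> s i j = s' i j + u i - u j"
  shows "level s \<alpha> = level s' \<alpha>"
proof -
  have "(\<lambda>n. trans_sum s n w / real n) \<longlonglongrightarrow> \<alpha> \<longleftrightarrow> (\<lambda>n. trans_sum s' n w / real n) \<longlonglongrightarrow> \<alpha>" if w: "w \<in> \<Omega>" for w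
  proof (rule tendsto_div_n_iff)
    have w12: "w k \<in> {1, 2}" for k using w by (auto simp: \<Omega>_def)
    fix n
    have "trans_sum s n w = trans_sum s' n w + u (w 0) - u (w n)"
    proof (induction n)
      case (Suc n)
      then show ?case
        using assms[OF w12 w12, of n "Suc n"] by (simp add: trans_sum_def)
    qed (simp add: trans_sum_def)
    moreover have "\<bar>u (w 0) - u (w n)\<bar> \<le> 2 * (\<bar>u 1\<bar> + \<bar>u 2\<bar>)"
      using \<Omega>_cases[OF w, of 0] \<Omega>_cases[OF w, of n] by (elim disjE) simp_all
    ultimately show "\<bar>trans_sum s n w - trans_sum s' n w\<bar> \<le> 2 * (\<bar>u 1\<bar> + \<bar>u 2\<bar>)"
      by (simp add: add_diff_eq[symmetric])
  qed
  then show ?thesis by (auto simp: level_def)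
qed

section \<open>The entropy spectrum of a Markov measure\<close>

text \<open>
  The spectrum depends only on the symmetrised weights: the logarithm of the transition matrix is
  cohomologous to the symmetric matrix with the same cycle weights.
\<close>

definition sym_weight :: "real \<Rightarrow> real \<Rightarrow> nat \<Rightarrow> nat \<Rightarrow> real" where
  "sym_weight x y i j = (if i = 1 \<and> j = 1 then - ln x else if i = 2 \<and> j = 2 then - ln y
     else - (ln (1 - x) + ln (1 - y)) / 2)"

context markov_params
begin

text \<open>The transfer function shifts half of the difference of the two off-diagonal weights, so
  both become their mean while their sum, the weight of the 2-cycle, is unchanged.\<close>

lemma level_tprob: "level (\<lambda>i j. - ln (tprob x y i j)) \<alpha> = level (sym_weight x y) \<alpha>"
  by (rule level_cohomologous[where u = "\<lambda>i. if i = 1 then (ln (1 - y) - ln (1 - x)) / 2 else 0"])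
    (auto simp: sym_weight_def tprob_def field_simps)

text \<open>The negative logarithm of a cylinder measure differs from the transition sum only by the
  initial weight and one final transition, which vanish after division by \<open>n\<close>.\<close>

lemma entropy_level_set_markov:
  "entropy_level_set full_mat (markov x y) \<alpha> = level (sym_weight x y) \<alpha>"
proof -
  let ?s = "\<lambda>i j. - ln (tprob x y i j)"
  have "(\<lambda>n. - (1 / real n) * ln (measure (markov x y) (cyl n w))) \<longlonglongrightarrow> \<alpha> \<longleftrightarrow>
      (\<lambda>n. trans_sum ?s n w / real n) \<longlonglongrightarrow> \<alpha>" if w: "w \<in> \<Omega>" for w
  proof -
    define C where "C = \<bar>?s 1 1\<bar> + \<bar>?s 1 2\<bar> + \<bar>?s 2 1\<bar> + \<bar>?s 2 2\<bar> +
      (\<bar>ln (stat x y 1)\<bar> + \<bar>ln (stat x y 2)\<bar>)"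
    have "\<bar>- ln (measure (markov x y) (cyl n w)) - trans_sum ?s n w\<bar> \<le> C" for n
    proof (cases n)
      case 0
      then show ?thesis using prob_space by (simp add: trans_sum_def C_def)
    next
      case (Suc m)
      have "ln (\<Prod>k<m. tprob x y (w k) (w (Suc k))) = (\<Sum>k<m. ln (tprob x y (w k) (w (Suc k))))"
        by (rule ln_prod) (simp, metis less_irrefl tprob_pos)
      then have "ln (measure (markov x y) (cyl n w)) =
          ln (stat x y (w 0)) + (\<Sum>k<m. ln (tprob x y (w k) (w (Suc k))))"
        unfolding Suc measure_markov_cyl[OF w]
        by (subst ln_mult_pos) (simp_all add: stat_pos tprob_pos prod_pos)
      then have eq: "- ln (measure (markov x y) (cyl n w)) - trans_sum ?s n w =
          ln (tprob x y (w m) (w (Suc m))) - ln (stat x y (w 0))"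
        by (simp add: Suc trans_sum_def sum_negf)
      have stat: "\<bar>ln (stat x y (w 0))\<bar> \<le> \<bar>ln (stat x y 1)\<bar> + \<bar>ln (stat x y 2)\<bar>"
        using \<Omega>_cases[OF w, of 0] by (elim disjE) simp_all
      have "\<bar>trans_sum ?s 1 (\<lambda>k. w (m + k))\<bar> \<le>
          real 1 * (\<bar>?s 1 1\<bar> + \<bar>?s 1 2\<bar> + \<bar>?s 2 1\<bar> + \<bar>?s 2 2\<bar>)"
        by (rule trans_sum_bounded) (use w in \<open>auto simp: \<Omega>_def\<close>)
      then have tprob: "\<bar>ln (tprob x y (w m) (w (Suc m)))\<bar> \<le>
          \<bar>?s 1 1\<bar> + \<bar>?s 1 2\<bar> + \<bar>?s 2 1\<bar> + \<bar>?s 2 2\<bar>"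
        by (simp add: trans_sum_def)
      show ?thesis
        unfolding eq C_def by (rule order_trans[OF abs_triangle_ineq4 add_mono[OF tprob stat]])
    qed
    from tendsto_div_n_iff[OF this] show ?thesis by simp
  qed
  then have "entropy_level_set full_mat (markov x y) \<alpha> = level ?s \<alpha>"
    by (auto simp: entropy_level_set_def level_def)
  then show ?thesis by (simp add: level_tprob)
qed

lemma entropy_spectrum_markov:
  "entropy_spectrum full_mat (markov x y) \<alpha> = bowen_entropy full_mat (level (sym_weight x y) \<alpha>)"
  by (simp add: entropy_spectrum_def entropy_level_set_markov)

end

section \<open>Codes between level sets of different Markov measures\<close>

text \<open>The case \<open>L = 1\<close>: bounded multiplicity \<open>K\<close> and a bounded loss
  of \<open>c\<close> symbols do not affect exponential growth rates.\<close>

lemma bowen_entropy_transfer_le: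
  assumes "W \<subseteq> \<Omega>" "Z \<subseteq> \<Omega>" "\<And>v. v \<in> W \<Longrightarrow> T v \<in> Z"
    and cov: "\<And>m w. w \<in> \<Omega> \<Longrightarrow> finite (F m w) \<and> card (F m w) \<le> K \<and> F m w \<subseteq> \<Omega> \<and>
        {v \<in> W. T v \<in> cyl m w} \<subseteq> (\<Union>w'\<in>F m w. cyl (m - c) w')"
  shows "bowen_entropy full_mat W \<le> bowen_entropy full_mat Z"
proof -
  have "bowen_entropy full_mat W \<le> real 1 * bowen_entropy full_mat Z"
  proof (rule bowen_entropy_transfer[OF assms(1-3), where K = K and c = c])
    fix m and w :: "nat \<Rightarrow> nat" assume w: "w \<in> \<Omega>"
    have "card ((\<lambda>w'. (m - c, w')) ` F m w) \<le> K"
      using cov[OF w, of m] card_image_le[of "F m w" "\<lambda>w'. (m - c, w')"] by linarith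
    then show "\<exists>F. finite F \<and> card F \<le> K \<and> F \<subseteq> {m'. m \<le> 1 * m' + c} \<times> \<Omega> \<and>
        {v \<in> W. T v \<in> cyl m w} \<subseteq> (\<Union>(m', w')\<in>F. cyl m' w')"
      using cov[OF w, of m] by (intro exI[of _ "(\<lambda>w'. (m - c, w')) ` F m w"]) auto
  qed simp_all
  then show ?thesis by simp
qed

definition swap_symbols :: "(nat \<Rightarrow> nat) \<Rightarrow> (nat \<Rightarrow> nat)" where
  "swap_symbols w = (\<lambda>n. 3 - w n)"

lemma swap_in_\<Omega>: "w \<in> \<Omega> \<Longrightarrow> swap_symbols w \<in> \<Omega>"
proof -
  assume w: "w \<in> \<Omega>"
  have "3 - w n \<in> {1, 2}" for n
    using \<Omega>_cases[OF w, of n] by auto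
  then show ?thesis by (simp add: \<Omega>_def swap_symbols_def)
qed

lemma swap_swap: "w \<in> \<Omega> \<Longrightarrow> swap_symbols (swap_symbols w) = w"
proof (rule ext)
  fix n assume "w \<in> \<Omega>"
  then show "swap_symbols (swap_symbols w) n = w n"
    using \<Omega>_cases[of w n] by (auto simp: swap_symbols_def)
qed

lemma swap_in_cyl_iff:
  assumes v: "v \<in> \<Omega>"
  shows "swap_symbols v \<in> cyl n w \<longleftrightarrow> v \<in> cyl n (swap_symbols w)"
proof -
  have "swap_symbols v k = w k \<longleftrightarrow> v k = swap_symbols w k" for k
    using \<Omega>_cases[OF v, of k] by (auto simp: swap_symbols_def)
  then show ?thesis using v swap_in_\<Omega> by (simp add: cyl_def)
qed

lemma entropy_spectrum_swap:
  assumes "markov_params x y"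
  shows "entropy_spectrum full_mat (markov y x) = entropy_spectrum full_mat (markov x y)"
proof -
  have le: "bowen_entropy full_mat (level (sym_weight x y) \<alpha>) \<le> bowen_entropy full_mat (level (sym_weight y x) \<alpha>)"
    for x y \<alpha>
  proof (rule bowen_entropy_transfer_le[where T = swap_symbols and K = 1 and c = 0 and F = "\<lambda>m w. {swap_symbols w}"])
    fix w assume w: "w \<in> level (sym_weight x y) \<alpha>"
    then have "w \<in> \<Omega>" using level_subset by auto
    have "sym_weight y x (swap_symbols w k) (swap_symbols w (Suc k)) = sym_weight x y (w k) (w (Suc k))" for k
      using \<Omega>_cases[OF \<open>w \<in> \<Omega>\<close>, of k] \<Omega>_cases[OF \<open>w \<in> \<Omega>\<close>, of "Suc k"]
      by (elim disjE) (simp_all add: sym_weight_def swap_symbols_def add.commute)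
    then show "swap_symbols w \<in> level (sym_weight y x) \<alpha>"
      using w by (simp add: level_def trans_sum_def swap_in_\<Omega>)
  next
    fix m and w :: "nat \<Rightarrow> nat" assume "w \<in> \<Omega>"
    then show "finite {swap_symbols w} \<and> card {swap_symbols w} \<le> 1 \<and> {swap_symbols w} \<subseteq> \<Omega> \<and>
        {v \<in> level (sym_weight x y) \<alpha>. swap_symbols v \<in> cyl m w} \<subseteq> (\<Union>w'\<in>{swap_symbols w}. cyl (m - 0) w')"
      using level_subset[of "sym_weight x y" \<alpha>] swap_in_cyl_iff[of _ m w] swap_in_\<Omega> by auto
  qed (rule level_subset)+
  interpret xy: markov_params x y by fact
  interpret yx: markov_params y x
    using xy.x_pos xy.x_less_1 xy.y_pos xy.y_less_1 by unfold_locales auto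
  show ?thesis
    using le by (auto simp: fun_eq_iff xy.entropy_spectrum_markov yx.entropy_spectrum_markov intro: antisym)
qed

text \<open>\<open>differences\<close> is two-to-one and maps the symmetric chain to the Bernoulli shift.\<close>

definition differences :: "(nat \<Rightarrow> nat) \<Rightarrow> (nat \<Rightarrow> nat)" where
  "differences w = (\<lambda>n. if w n = w (Suc n) then 1 else 2)"

text \<open>The inverse branch of \<open>differences\<close> with initial symbol \<open>i\<close>: a
  1 repeats the current symbol, anything else flips it.\<close>

primrec integrate :: "nat \<Rightarrow> (nat \<Rightarrow> nat) \<Rightarrow> nat \<Rightarrow> nat" where
  "integrate i w 0 = i"
| "integrate i w (Suc n) = (if w n = 1 then integrate i w n else 3 - integrate i w n)"

lemma differences_in_\<Omega>: "differences w \<in> \<Omega>"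
  by (simp add: \<Omega>_def differences_def)

lemma integrate_in_\<Omega>: "i \<in> {1, 2} \<Longrightarrow> integrate i w \<in> \<Omega>"
proof -
  assume i: "i \<in> {1, 2}"
  have "integrate i w n = 1 \<or> integrate i w n = 2" for n
    using i by (induction n) auto
  then show ?thesis by (auto simp: \<Omega>_def)
qed

lemma differences_integrate: "i \<in> {1, 2} \<Longrightarrow> w \<in> \<Omega> \<Longrightarrow> differences (integrate i w) = w"
proof (rule ext)
  fix n assume i: "i \<in> {1, 2}" and w: "w \<in> \<Omega>"
  show "differences (integrate i w) n = w n"
    using \<Omega>_cases[OF integrate_in_\<Omega>[OF i], of w n] \<Omega>_cases[OF w, of n]
    by (elim disjE) (simp_all add: differences_def)
qed

lemma eq_integrate_if_differences_eq:
  assumes "v \<in> \<Omega>" "\<And>k. k < n \<Longrightarrow> differences v k = w k" "k \<le> n"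
  shows "v k = integrate (v 0) w k"
  using assms(3)
proof (induction k)
  case (Suc k)
  then have "differences v k = w k" "v k = integrate (v 0) w k" using assms(2) by auto
  then show ?case
    using \<Omega>_cases[OF assms(1), of k] \<Omega>_cases[OF assms(1), of "Suc k"]
    by (auto simp: differences_def split: if_splits)
qed simp

text \<open>In the symmetric chain a transition weight depends only on whether the two symbols
  agree, in the Bernoulli case on one symbol only. \<open>differences\<close> turns the first kind
  of weight into the second.\<close>

lemma level_symmetric_iff:
  assumes p: "0 < p" "p < 1" and w: "w \<in> \<Omega>"
  shows "w \<in> level (sym_weight p p) \<alpha> \<longleftrightarrow> differences w \<in> level (sym_weight p (1 - p)) \<alpha>"
proof -
  define q where "q i = (if i = 1 then - ln p else - ln (1 - p))" for i :: nat
  \<comment> \<open>For these parameters \<open>sym_weight\<close> is the average of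
    \<open>q i\<close> and \<open>q j\<close>, and differs from \<open>q i\<close> by the coboundary
    of \<open>q / 2\<close>.\<close>
  have "level (\<lambda>i j. q i) \<alpha> = level (sym_weight p (1 - p)) \<alpha>"
    by (rule level_cohomologous[where u = "\<lambda>i. q i / 2"])
      (auto simp: q_def sym_weight_def field_simps)
  moreover have "trans_sum (sym_weight p p) n w = trans_sum (\<lambda>i j. q i) n (differences w)" for n
    unfolding trans_sum_def
  proof (rule sum.cong[OF refl])
    fix k
    show "sym_weight p p (w k) (w (Suc k)) = q (differences w k)"
      using \<Omega>_cases[OF w, of k] \<Omega>_cases[OF w, of "Suc k"]
      by (elim disjE) (simp_all add: sym_weight_def q_def differences_def)
  qed
  ultimately show ?thesis
    using w differences_in_\<Omega>[of w] by (auto simp: level_def)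
qed

lemma entropy_spectrum_bernoulli_symmetric:
  assumes p: "0 < p" "p < 1"
  shows "entropy_spectrum full_mat (markov p p) = entropy_spectrum full_mat (markov p (1 - p))"
proof (rule ext)
  fix \<alpha>
  interpret S: markov_params p p using p by unfold_locales
  interpret B: markov_params p "1 - p" using p by unfold_locales auto
  let ?S = "level (sym_weight p p) \<alpha>"
  let ?B = "level (sym_weight p (1 - p)) \<alpha>"
  have "bowen_entropy full_mat ?S \<le> bowen_entropy full_mat ?B"
  \<comment> \<open>Two preimages, one per initial symbol, and no loss of length: \<open>m\<close>
    differences together with the first symbol determine \<open>m + 1\<close> symbols.\<close>
  proof (rule bowen_entropy_transfer_le[where T = differences and K = 2 and c = 0
        and F = "\<lambda>m w. {integrate 1 w, integrate 2 w}"])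
    fix w assume "w \<in> ?S"
    then show "differences w \<in> ?B"
      using level_symmetric_iff[OF p] level_subset by blast
  next
    fix m and w :: "nat \<Rightarrow> nat" assume "w \<in> \<Omega>"
    have "v \<in> cyl m (integrate 1 w) \<union> cyl m (integrate 2 w)" if v: "v \<in> \<Omega>" "differences v \<in> cyl m w" for v
    proof -
      have "integrate (v 0) w k = v k" if "k < m" for k
        using eq_integrate_if_differences_eq[OF v(1), of m w k] v(2) that by (simp add: cyl_def)
      then show ?thesis
        using \<Omega>_cases[OF v(1), of 0] v(1) by (auto simp: cyl_def)
    qed
    then show "finite {integrate 1 w, integrate 2 w} \<and> card {integrate 1 w, integrate 2 w} \<le> 2 \<and>
        {integrate 1 w, integrate 2 w} \<subseteq> \<Omega> \<and>
        {v \<in> ?S. differences v \<in> cyl m w} \<subseteq> (\<Union>w'\<in>{integrate 1 w, integrate 2 w}. cyl (m - 0) w')"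
      using level_subset[of "sym_weight p p" \<alpha>] integrate_in_\<Omega>[of 1 w] integrate_in_\<Omega>[of 2 w]
      by (auto simp: card_insert_if)
  qed (rule level_subset)+
  moreover have "bowen_entropy full_mat ?B \<le> bowen_entropy full_mat ?S"
  \<comment> \<open>Here \<open>c = 1\<close>, as \<open>m\<close> symbols have only
    \<open>m - 1\<close> consecutive differences.\<close>
  proof (rule bowen_entropy_transfer_le[where T = "integrate 1" and K = 1 and c = 1
        and F = "\<lambda>m w. {differences w}"])
    fix w assume w: "w \<in> ?B"
    then have "w \<in> \<Omega>" using level_subset by blast
    then show "integrate 1 w \<in> ?S"
      using w level_symmetric_iff[OF p integrate_in_\<Omega>[of 1 w]] differences_integrate[of 1 w] by simp
  next
    fix m and w :: "nat \<Rightarrow> nat" assume "w \<in> \<Omega>"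
    have "v \<in> cyl (m - 1) (differences w)" if v: "v \<in> \<Omega>" "integrate 1 v \<in> cyl m w" for v
    proof -
      have "v k = differences w k" if "k < m - 1" for k
      proof -
        have "\<forall>k<m. integrate 1 v k = w k"
          using v(2) by (simp add: cyl_def)
        then have "k < m \<longrightarrow> integrate 1 v k = w k" "Suc k < m \<longrightarrow> integrate 1 v (Suc k) = w (Suc k)"
          by blast+
        then have "integrate 1 v k = w k" "integrate 1 v (Suc k) = w (Suc k)"
          using that by simp_all
        then have "differences (integrate 1 v) k = differences w k"
          unfolding differences_def by (simp only:)
        then show ?thesis using differences_integrate[of 1 v] v(1) by simp
      qed
      then show ?thesis using v(1) by (simp add: cyl_def)
    qed
    then show "finite {differences w} \<and> card {differences w} \<le> 1 \<and> {differences w} \<subseteq> \<Omega> \<and>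
        {v \<in> ?B. integrate 1 v \<in> cyl m w} \<subseteq> (\<Union>w'\<in>{differences w}. cyl (m - 1) w')"
      using level_subset[of "sym_weight p (1 - p)" \<alpha>] differences_in_\<Omega>[of w] by auto
  qed (rule level_subset)+
  ultimately show "entropy_spectrum full_mat (markov p p) \<alpha> = entropy_spectrum full_mat (markov p (1 - p)) \<alpha>"
    by (simp add: S.entropy_spectrum_markov B.entropy_spectrum_markov)
qed

subsection \<open>Invariants of the spectrum\<close>

definition max_weight :: "real \<Rightarrow> real \<Rightarrow> real" where
  "max_weight x y = max (max x y) (sqrt ((1 - x) * (1 - y)))"

definition min_weight :: "real \<Rightarrow> real \<Rightarrow> real" where
  "min_weight x y = min (min x y) (sqrt ((1 - x) * (1 - y)))"

context markov_params
begin

lemma cross_weight_pos: "0 < sqrt ((1 - x) * (1 - y))"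
  using x_less_1 y_less_1 by simp

lemma sym_weight_eq:
  "sym_weight x y 1 1 = - ln x" "sym_weight x y 2 2 = - ln y"
  "sym_weight x y 1 2 = - ln (sqrt ((1 - x) * (1 - y)))"
  "sym_weight x y 2 1 = - ln (sqrt ((1 - x) * (1 - y)))"
proof -
  have "ln (sqrt ((1 - x) * (1 - y))) = (ln (1 - x) + ln (1 - y)) / 2"
    using x_less_1 y_less_1 by (subst ln_sqrt) (simp_all add: ln_mult_pos)
  note eq = this
  show "sym_weight x y 1 1 = - ln x" "sym_weight x y 2 2 = - ln y"
    by (simp_all add: sym_weight_def)
  show "sym_weight x y 1 2 = - ln (sqrt ((1 - x) * (1 - y)))"
    "sym_weight x y 2 1 = - ln (sqrt ((1 - x) * (1 - y)))"
    unfolding eq sym_weight_def by (simp_all add: field_simps)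
qed

lemma weights_pos: "0 < min_weight x y" "0 < max_weight x y"
  using x_pos y_pos cross_weight_pos by (auto simp: min_weight_def max_weight_def less_max_iff_disj)

lemma sym_weight_range:
  assumes "i \<in> {1, 2}" "j \<in> {1, 2}"
  shows "- ln (max_weight x y) \<le> sym_weight x y i j" "sym_weight x y i j \<le> - ln (min_weight x y)"
proof -
  have *: "- ln (max_weight x y) \<le> - ln t \<and> - ln t \<le> - ln (min_weight x y)"
    if "t \<in> {x, y, sqrt ((1 - x) * (1 - y))}" for t
  proof -
    have "0 < t" using that x_pos y_pos cross_weight_pos by auto
    moreover have "t \<le> max_weight x y" "min_weight x y \<le> t"
      using that by (auto simp: max_weight_def min_weight_def)
    ultimately show ?thesis using weights_pos by simp
  qed
  have "\<exists>t\<in>{x, y, sqrt ((1 - x) * (1 - y))}. sym_weight x y i j = - ln t"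
    using assms sym_weight_eq by (elim insertE) auto
  then show "- ln (max_weight x y) \<le> sym_weight x y i j" "sym_weight x y i j \<le> - ln (min_weight x y)"
    using * by auto
qed

lemma spectrum_support:
  assumes "bowen_entropy full_mat (level (sym_weight x y) \<alpha>) > 0"
  shows "- ln (max_weight x y) \<le> \<alpha>" "\<alpha> \<le> - ln (min_weight x y)"
proof -
  have "level (sym_weight x y) \<alpha> \<noteq> {}"
    using assms bowen_entropy_empty[of full_mat] by auto
  then obtain w where "w \<in> level (sym_weight x y) \<alpha>" by blast
  then show "- ln (max_weight x y) \<le> \<alpha>" "\<alpha> \<le> - ln (min_weight x y)"
    using level_range[of "- ln (max_weight x y)" "sym_weight x y" "- ln (min_weight x y)"] sym_weight_range by blast+
qed

text \<open>Positivity is claimed only near the cycle weights, since on the boundary of the support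
  the entropy may be 0. Nearness suffices to compare the endpoints of two supports.\<close>

lemma spectrum_positive_near:
  assumes "t \<in> {x, y, sqrt ((1 - x) * (1 - y))}" "e > 0"
  obtains \<alpha> where "\<bar>\<alpha> - (- ln t)\<bar> < e" "bowen_entropy full_mat (level (sym_weight x y) \<alpha>) > 0"
proof -
  consider "t = x" | "t = y" | "t = sqrt ((1 - x) * (1 - y))" using assms by auto
  then show ?thesis
  proof cases
    case 1
    show ?thesis
      by (rule bowen_entropy_level_near_loop[of 1 2 e "sym_weight x y"])
        (use that assms 1 sym_weight_eq in auto)
  next
    case 2
    show ?thesis
      by (rule bowen_entropy_level_near_loop[of 2 1 e "sym_weight x y"])
        (use that assms 2 sym_weight_eq in auto)
  next
    case 3
    have "(sym_weight x y 1 2 + sym_weight x y 2 1) / 2 = - ln t"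
      by (simp only: sym_weight_eq 3) simp
    then show ?thesis
      using bowen_entropy_level_near_2_loop[of e "sym_weight x y"] that assms by metis
  qed
qed

lemma mean_sym_weight: "mean_weight (sym_weight x y) = - ln (x * y * ((1 - x) * (1 - y))) / 4"
  using x_pos y_pos x_less_1 y_less_1
  by (simp add: mean_weight_def sym_weight_def ln_mult_pos)

end

lemma spectrum_invariants:
  assumes "markov_params x y" "markov_params x' y'"
    and eq: "entropy_spectrum full_mat (markov x y) = entropy_spectrum full_mat (markov x' y')"
  shows "max_weight x y = max_weight x' y'" "min_weight x y = min_weight x' y'"
    and "x * y * ((1 - x) * (1 - y)) = x' * y' * ((1 - x') * (1 - y'))"
proof -
  interpret A: markov_params x y by fact
  interpret B: markov_params x' y' by fact
  have eq': "bowen_entropy full_mat (level (sym_weight x y) \<alpha>) = bowen_entropy full_mat (level (sym_weight x' y') \<alpha>)" for \<alpha>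
    using eq A.entropy_spectrum_markov B.entropy_spectrum_markov by (simp add: fun_eq_iff)
  \<comment> \<open>A larger maximum would place positive entropy outside the support of the other
    spectrum. The parameters are arbitrary so that each inequality can be applied in both
    directions.\<close>
  have max_le: "max_weight a b \<le> max_weight c d"
    and min_le: "min_weight c d \<le> min_weight a b"
    if ab: "markov_params a b" and cd: "markov_params c d"
      and eq: "\<And>\<alpha>. bowen_entropy full_mat (level (sym_weight a b) \<alpha>) = bowen_entropy full_mat (level (sym_weight c d) \<alpha>)"
    for a b c d
  proof -
    interpret ab: markov_params a b by fact
    interpret cd: markov_params c d by fact
    show "max_weight a b \<le> max_weight c d"
    proof (rule ccontr)
      assume "\<not> max_weight a b \<le> max_weight c d"
      then have "0 < ln (max_weight a b) - ln (max_weight c d)"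
        using ab.weights_pos cd.weights_pos by simp
      moreover have "max_weight a b \<in> {a, b, sqrt ((1 - a) * (1 - b))}"
        by (auto simp: max_weight_def max_def)
      ultimately obtain \<alpha> where "\<bar>\<alpha> - (- ln (max_weight a b))\<bar> < ln (max_weight a b) - ln (max_weight c d)"
        and "bowen_entropy full_mat (level (sym_weight a b) \<alpha>) > 0"
        using ab.spectrum_positive_near by metis
      moreover from this have "- ln (max_weight c d) \<le> \<alpha>"
        using cd.spectrum_support(1) eq by auto
      ultimately show False by linarith
    qed
    show "min_weight c d \<le> min_weight a b"
    proof (rule ccontr)
      assume "\<not> min_weight c d \<le> min_weight a b"
      then have "0 < ln (min_weight c d) - ln (min_weight a b)"
        using ab.weights_pos cd.weights_pos by simp
      moreover have "min_weight a b \<in> {a, b, sqrt ((1 - a) * (1 - b))}"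
        by (auto simp: min_weight_def min_def)
      ultimately obtain \<alpha> where "\<bar>\<alpha> - (- ln (min_weight a b))\<bar> < ln (min_weight c d) - ln (min_weight a b)"
        and "bowen_entropy full_mat (level (sym_weight a b) \<alpha>) > 0"
        using ab.spectrum_positive_near by metis
      moreover from this have "\<alpha> \<le> - ln (min_weight c d)"
        using cd.spectrum_support(2) eq by auto
      ultimately show False by linarith
    qed
  qed
  show "max_weight x y = max_weight x' y'" "min_weight x y = min_weight x' y'"
    using max_le[OF assms(1,2) eq'] max_le[OF assms(2,1) eq'[symmetric]]
      min_le[OF assms(1,2) eq'] min_le[OF assms(2,1) eq'[symmetric]] by auto
  \<comment> \<open>The mean weight is the only argument at which the spectrum reaches
    \<open>ln 2\<close>, so equal spectra have equal mean weights.\<close>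
  have "mean_weight (sym_weight x y) = mean_weight (sym_weight x' y')"
    using bowen_entropy_level_mean_ge[of "sym_weight x y"] eq'
      bowen_entropy_level_less[of "mean_weight (sym_weight x y)" "sym_weight x' y'"]
    by (metis not_le)
  then have "ln (x * y * ((1 - x) * (1 - y))) = ln (x' * y' * ((1 - x') * (1 - y')))"
    by (simp only: A.mean_sym_weight B.mean_sym_weight)
  then show "x * y * ((1 - x) * (1 - y)) = x' * y' * ((1 - x') * (1 - y'))"
    using A.x_pos A.y_pos A.x_less_1 A.y_less_1 B.x_pos B.y_pos B.x_less_1 B.y_less_1
    by (subst (asm) ln_inj_iff) simp_all
qed

section \<open>Recovering the parameters from the three numerical invariants\<close>

text \<open>The cross weight lies between the diagonal weights, strictly below them or strictly
  above them. In the last two cases it is an extreme and hides one diagonal weight, but its square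
  then gives an equation for the hidden one.\<close>

lemma weight_cases:
  assumes "y \<le> x" "x < 1"
  obtains "y \<le> sqrt ((1 - x) * (1 - y))" "sqrt ((1 - x) * (1 - y)) \<le> x"
      "max_weight x y = x" "min_weight x y = y"
    | "max_weight x y = x" "min_weight x y < y" "(1 - x) * (1 - y) = (min_weight x y)\<^sup>2"
    | "min_weight x y = y" "x < max_weight x y" "(1 - x) * (1 - y) = (max_weight x y)\<^sup>2"
proof -
  define z where "z = sqrt ((1 - x) * (1 - y))"
  have z2: "(1 - x) * (1 - y) = z\<^sup>2" using assms by (simp add: z_def)
  have "max_weight x y = max x z" "min_weight x y = min y z"
    using assms(1) by (auto simp: max_weight_def min_weight_def z_def)
  then show ?thesis
    using that z2 assms(1) unfolding z_def[symmetric] by (cases "z < y"; cases "x < z") (auto simp: max_def min_def)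
qed

lemma mult_compl_eq_cases:
  fixes a b :: real
  assumes "a * (1 - a) = b * (1 - b)"
  shows "a = b \<or> a = 1 - b"
proof -
  have "(a - b) * (1 - a - b) = 0" using assms by (simp add: algebra_simps)
  then show ?thesis by auto
qed

text \<open>
  \<open>M\<close> and \<open>m\<close> are the two extreme weights. They are the diagonal weights of one chain and a
  diagonal and the cross weight of the other chain, whose remaining diagonal weight is \<open>y'\<close>.
\<close>

lemma diag_diag_vs_cross_min:
  fixes M m y' :: real
  assumes "0 < m" "m < 1" "M < 1" "0 < M" "m \<noteq> y'"
    and "(1 - M) * (1 - y') = m\<^sup>2" and "M * m * ((1 - M) * (1 - m)) = M * y' * m\<^sup>2"
  shows "y' = 1 - m \<and> M = 1 - m"
proof -
  have 1: "(1 - M) * (1 - m) = y' * m"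
    using assms by (simp add: power2_eq_square)
  \<comment> \<open>Multiplying by \<open>1 - y'\<close> and inserting the cross weight eliminates
    \<open>M\<close>, leaving an equation between \<open>y'\<close> and \<open>m\<close>
    alone.\<close>
  have "(1 - M) * (1 - m) * (1 - y') = m\<^sup>2 * (1 - m)"
    using assms(6) by (metis mult.assoc mult.commute)
  then have "m * (m * (1 - m)) = m * (y' * (1 - y'))"
    unfolding 1 by (simp add: power2_eq_square algebra_simps)
  then have "y' * (1 - y') = m * (1 - m)" using assms(1) by simp
  then have y': "y' = 1 - m" using mult_compl_eq_cases assms(5) by blast
  then have "(1 - M) * m = m * m" using assms(6) by (simp add: power2_eq_square)
  then show ?thesis using y' assms(1) by simp
qed

text \<open>One chain has the smallest weight \<open>m\<close> as cross weight and hides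
  \<open>y\<close>; the other has the largest weight \<open>M\<close> as cross weight and hides
  \<open>x'\<close>. Eliminating both gives
  \<open>(m - M) * (1 - m - M) * (1 - m^2 - M^2) = 0\<close>. The last factor is positive, so
  \<open>M = 1 - m\<close> and both chains are symmetric.\<close>

lemma cross_min_vs_cross_max:
  fixes M m y x' :: real
  assumes "0 < m" "m < M" "M < 1" "0 < y"
    and 1: "(1 - M) * (1 - y) = m\<^sup>2" and 2: "(1 - x') * (1 - m) = M\<^sup>2"
    and 3: "M * y * m\<^sup>2 = x' * m * M\<^sup>2"
  shows "y = M \<and> x' = m"
proof -
  have 4: "m * y = M * x'"
  proof -
    have "(M * m) * (m * y) = (M * m) * (M * x')" using 3 by (simp add: power2_eq_square algebra_simps)
    then show ?thesis using assms(1,2) by simp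
  qed
  have y: "(1 - M) * y = 1 - M - m\<^sup>2" and x': "(1 - m) * x' = 1 - m - M\<^sup>2"
    using 1 2 by (simp_all add: algebra_simps)
  have "(m * (1 - m)) * ((1 - M) * y) = (M * (1 - M)) * ((1 - m) * x')"
    using 4 by (metis mult.assoc mult.commute)
  then have "m * (1 - m) * (1 - M - m\<^sup>2) = M * (1 - M) * (1 - m - M\<^sup>2)"
    unfolding y x' .
  then have "(m - M) * ((1 - (m + M)) * (1 - (m\<^sup>2 + M\<^sup>2))) = 0"
    by (simp add: algebra_simps power2_eq_square)
  moreover have "m\<^sup>2 + M\<^sup>2 < 1"
  proof -
    have "0 < (1 - M) * y" using assms by simp
    moreover have "M\<^sup>2 < M" using assms(1-3) by (simp add: power2_eq_square)
    ultimately show ?thesis unfolding y by linarith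
  qed
  ultimately have M: "M = 1 - m" using assms(2) by auto
  have "m * (1 - y) = m * m" "(1 - x') * M = M * M"
    using 1 2 by (simp_all add: M power2_eq_square)
  then show ?thesis using assms(1,2) M by auto
qed

text \<open>If the cross weight has the same position in both chains, the parameters are read off or
  solved from its square. Different positions force \<open>x + y = 1\<close> or
  \<open>x = y\<close>, hence \<open>x = y = 1 / 2\<close> by \<open>generic\<close>, which
  contradicts the strict position of the cross weight.\<close>

lemma spectrum_determines_ordered_params:
  assumes ord: "y \<le> x" "y' \<le> x'"
    and rng: "0 < y" "x < 1" "0 < y'" "x' < 1"
    and M: "max_weight x y = max_weight x' y'" and m: "min_weight x y = min_weight x' y'"
    and prod: "x * y * ((1 - x) * (1 - y)) = x' * y' * ((1 - x') * (1 - y'))"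
    and generic: "x + y = 1 \<Longrightarrow> x = 1 / 2" "x = y \<Longrightarrow> x = 1 / 2"
  shows "x' = x \<and> y' = y"
proof -
  have half: "x = 1 / 2 \<and> y = 1 / 2" if "x + y = 1 \<or> x = y"
    using generic that by auto
  show ?thesis
  proof (cases rule: weight_cases[OF ord(1) rng(2)])
    case A: 1
    show ?thesis
    proof (cases rule: weight_cases[OF ord(2) rng(4)])
      case 1
      with A M m show ?thesis by simp
    next
      case 2
      then have *: "x' = x" "y \<noteq> y'" "(1 - x) * (1 - y') = y\<^sup>2" using A M m by auto
      then have "x * y * ((1 - x) * (1 - y)) = x * y' * y\<^sup>2" using prod by simp
      then have "y' = 1 - y \<and> x = 1 - y"
        using * ord rng by (intro diag_diag_vs_cross_min) auto
      then show ?thesis using half * by auto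
    next
      case 3
      then have *: "y' = y" "x \<noteq> x'" "(1 - y) * (1 - x') = x\<^sup>2" using A M m by (auto simp: mult.commute)
      then have "y * x * ((1 - y) * (1 - x)) = y * x' * x\<^sup>2" using prod by (simp add: mult_ac)
      then have "x' = 1 - x \<and> y = 1 - x"
        using * ord rng by (intro diag_diag_vs_cross_min) auto
      then show ?thesis using half * by auto
    qed
  next
    case B: 2
    define k where "k = min_weight x y"
    have k: "k < y" "(1 - x) * (1 - y) = k\<^sup>2" using B by (auto simp: k_def)
    show ?thesis
    proof (cases rule: weight_cases[OF ord(2) rng(4)])
      case 1
      then have *: "x' = x" "y' = k" using B M m by (auto simp: k_def)
      have "x * k * ((1 - x) * (1 - k)) = x * y * k\<^sup>2"
        unfolding k(2)[symmetric] using prod unfolding * by (rule sym)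
      then have "y = 1 - k \<and> x = 1 - k"
        using * k ord rng by (intro diag_diag_vs_cross_min) auto
      then show ?thesis using half k by auto
    next
      case 2
      then have "x' = x" "(1 - x) * (1 - y) = (1 - x) * (1 - y')" using B M m by auto
      then show ?thesis using rng by simp
    next
      case 3
      then have *: "y' = k" "x' < x" "(1 - x') * (1 - k) = x\<^sup>2" using B M m by (auto simp: k_def)
      then have "x * y * k\<^sup>2 = x' * k * x\<^sup>2" using prod k by simp
      then have "y = x \<and> x' = k"
        using * k ord rng by (intro cross_min_vs_cross_max) auto
      then have xy: "x = 1 / 2" "y = 1 / 2" using half by auto
      have "k\<^sup>2 = (1 / 2)\<^sup>2"
        unfolding k(2)[symmetric] unfolding xy by (simp add: power2_eq_square)
      then have "k = 1 / 2" using * rng by (subst (asm) power2_eq_iff_nonneg) auto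
      then show ?thesis using k \<open>y = 1 / 2\<close> by simp
    qed
  next
    case C: 3
    define K where "K = max_weight x y"
    have K: "x < K" "(1 - x) * (1 - y) = K\<^sup>2" using C by (auto simp: K_def)
    show ?thesis
    proof (cases rule: weight_cases[OF ord(2) rng(4)])
      case 1
      then have *: "x' = K" "y' = y" using C M m by (auto simp: K_def)
      have "y * K * ((1 - y) * (1 - K)) = y * x * K\<^sup>2"
        unfolding K(2)[symmetric] using prod[symmetric] unfolding * by (simp only: mult_ac)
      moreover have "(1 - y) * (1 - x) = K\<^sup>2" using K by (simp add: mult.commute)
      ultimately have "x = 1 - K \<and> y = 1 - K"
        using * K ord rng by (intro diag_diag_vs_cross_min) auto
      then show ?thesis using half K by auto
    next
      case 2
      then have *: "x' = K" "y < y'" "(1 - K) * (1 - y') = y\<^sup>2" using C M m by (auto simp: K_def)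
      then have "K * y' * y\<^sup>2 = x * y * K\<^sup>2" using prod K by simp
      then have "y' = K \<and> x = y"
        using * K ord rng by (intro cross_min_vs_cross_max) auto
      then have xy: "x = 1 / 2" "y = 1 / 2" using half by auto
      have "K\<^sup>2 = (1 / 2)\<^sup>2"
        unfolding K(2)[symmetric] unfolding xy by (simp add: power2_eq_square)
      then have "K = 1 / 2" using * rng ord by (subst (asm) power2_eq_iff_nonneg) auto
      then show ?thesis using K \<open>x = 1 / 2\<close> by simp
    next
      case 3
      then have "y' = y" "(1 - x) * (1 - y) = (1 - x') * (1 - y)" using C M m by auto
      then show ?thesis using rng ord by simp
    qed
  qed
qed

lemma weight_commute: "max_weight x y = max_weight y x" "min_weight x y = min_weight y x"
  by (simp_all add: max_weight_def min_weight_def max.commute min.commute mult.commute)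

theorem spectrum_determines_params:
  assumes "markov_params x y" "markov_params x' y'"
    and eq: "entropy_spectrum full_mat (markov x y) = entropy_spectrum full_mat (markov x' y')"
    and generic: "x + y = 1 \<Longrightarrow> x = 1 / 2" "x = y \<Longrightarrow> x = 1 / 2"
  shows "(x' = x \<and> y' = y) \<or> (x' = y \<and> y' = x)"
proof -
  interpret A: markov_params x y by fact
  interpret B: markov_params x' y' by fact
  note inv = spectrum_invariants[OF assms(1-3)]
  note rng = A.x_pos A.x_less_1 A.y_pos A.y_less_1 B.x_pos B.x_less_1 B.y_pos B.y_less_1
  define a b where "a = max x y" and "b = min x y"
  define a' b' where "a' = max x' y'" and "b' = min x' y'"
  have ab: "(a = x \<and> b = y) \<or> (a = y \<and> b = x)" "(a' = x' \<and> b' = y') \<or> (a' = y' \<and> b' = x')"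
    by (auto simp: a_def b_def a'_def b'_def max_def min_def)
  have "a' = a \<and> b' = b"
  proof (rule spectrum_determines_ordered_params)
    show "b \<le> a" "b' \<le> a'" by (auto simp: a_def b_def a'_def b'_def)
    show "0 < b" "a < 1" "0 < b'" "a' < 1" using rng by (auto simp: a_def b_def a'_def b'_def)
    show "max_weight a b = max_weight a' b'" "min_weight a b = min_weight a' b'"
      using ab inv weight_commute by metis+
    show "a * b * ((1 - a) * (1 - b)) = a' * b' * ((1 - a') * (1 - b'))"
      using ab inv(3) by (elim disjE) (auto simp: mult_ac)
    show "a + b = 1 \<Longrightarrow> a = 1 / 2" "a = b \<Longrightarrow> a = 1 / 2"
      using ab generic by (elim disjE; simp)+
  qed
  then show ?thesis using ab by auto
qed

section \<open>The Jacobian as an isomorphism invariant\<close>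

context markov_params
begin

abbreviation \<mu> :: "(nat \<Rightarrow> nat) measure" where
  "\<mu> \<equiv> markov x y"

lemma cyl_eq_coords: "cyl 2 (case_nat i (\<lambda>_. j)) = {w \<in> \<Omega>. w 0 = i \<and> w 1 = j}"
  by (auto simp: cyl_def numeral_2_eq_2 less_Suc_eq)

lemma coords_in_\<B>: "{w \<in> \<Omega>. w 0 = i \<and> w 1 = j} \<in> sets \<B>"
  unfolding cyl_eq_coords[symmetric] by simp

lemma measurable_case_nat: "i \<in> {1, 2} \<Longrightarrow> case_nat i \<in> measurable \<B> \<B>"
proof (rule measurable_\<B>I)
  fix n and w :: "nat \<Rightarrow> nat" assume i: "i \<in> {1, 2}" and w: "w \<in> \<Omega>"
  show "case_nat i -` cyl n w \<inter> space \<B> \<in> sets \<B>"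
  proof (cases n)
    case 0
    have "case_nat i -` \<Omega> \<inter> \<Omega> = \<Omega>" using case_nat_in_\<Omega>[OF i] by auto
    then show ?thesis by (simp add: 0)
  next
    case (Suc m)
    have "case_nat i -` cyl n w \<inter> \<Omega> = (if w 0 = i then cyl m (shift w) else {})"
      using case_nat_in_\<Omega>[OF i] by (auto simp: cyl_def Suc All_less_Suc2 shift_def)
    then show ?thesis by simp
  qed
qed (simp add: case_nat_in_\<Omega>)

lemma shift_image_eq:
  assumes "B \<subseteq> {w \<in> \<Omega>. w 0 = i}"
  shows "shift ` B = case_nat i -` B \<inter> \<Omega>"
proof (intro equalityI subsetI)
  fix v assume "v \<in> shift ` B"
  then obtain w where "w \<in> B" "v = shift w" by auto
  then show "v \<in> case_nat i -` B \<inter> \<Omega>"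
    using assms case_nat_shift[of w] shift_in_\<Omega> by auto
next
  fix v assume "v \<in> case_nat i -` B \<inter> \<Omega>"
  then show "v \<in> shift ` B"
    by (intro image_eqI[of _ _ "case_nat i v"]) auto
qed

text \<open>Fixing the first symbol makes the shift injective, and fixing the second makes the
  factor constant. By detailed balance the factor is the reversed transition probability.\<close>

lemma measure_shift_image:
  assumes i: "i \<in> {1, 2}" and j: "j \<in> {1, 2}"
    and B: "B \<in> sets \<B>" "B \<subseteq> {w \<in> \<Omega>. w 0 = i \<and> w 1 = j}"
  shows "shift ` B \<in> sets \<B>" and "measure \<mu> B = tprob x y j i * measure \<mu> (shift ` B)"
proof -
  let ?S = "{w \<in> \<Omega>. w 0 = i \<and> w 1 = j}"
  let ?T = "{w \<in> \<Omega>. w 0 = j}"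
  have T: "?T \<in> sets \<B>"
    using measurable_sets[OF measurable_coord[of 0], of "{j}"] by (simp add: vimage_def Int_def conj_commute)
  have eq: "shift ` B = case_nat i -` B \<inter> \<Omega>"
    by (rule shift_image_eq) (use B in auto)
  then show sB: "shift ` B \<in> sets \<B>"
    using measurable_sets[OF measurable_case_nat[OF i] B(1)] by simp
  define M1 where "M1 = distr (density \<mu> (indicator ?S)) \<B> shift"
  define M2 where "M2 = scale_measure (ennreal (tprob x y j i)) (density \<mu> (indicator ?T))"
  have M1: "emeasure M1 C = emeasure \<mu> (?S \<inter> (shift -` C \<inter> \<Omega>))" if "C \<in> sets \<B>" for C
  proof -
    have "shift -` C \<inter> \<Omega> \<in> sets \<B>" using measurable_sets[OF measurable_shift that] by simp
    then show ?thesis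
      unfolding M1_def using that coords_in_\<B>
      by (subst emeasure_distr) (auto simp: emeasure_restricted)
  qed
  have M2: "emeasure M2 C = ennreal (tprob x y j i) * emeasure \<mu> (?T \<inter> C)" if "C \<in> sets \<B>" for C
    unfolding M2_def using that T by (simp add: emeasure_restricted)
  have "M1 = M2"
  proof (rule measure_eqI_cyl)
    show "sets M1 = sets \<B>" "sets M2 = sets \<B>" by (simp_all add: M1_def M2_def)
    show "emeasure M1 \<Omega> \<noteq> \<infinity>" by (simp add: M1 emeasure_eq_measure)
    fix n and w :: "nat \<Rightarrow> nat" assume w: "w \<in> \<Omega>"
    show "emeasure M1 (cyl (Suc n) w) = emeasure M2 (cyl (Suc n) w)"
    proof (cases "w 0 = j")
      case True
      have "?S \<inter> (shift -` cyl (Suc n) w \<inter> \<Omega>) = cyl (Suc (Suc n)) (case_nat i w)"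
        using shift_in_\<Omega> True by (auto simp: cyl_def All_less_Suc2 shift_def)
      moreover have "?T \<inter> cyl (Suc n) w = cyl (Suc n) w"
        using True by (auto simp: cyl_def)
      moreover have "measure \<mu> (cyl (Suc (Suc n)) (case_nat i w)) = tprob x y j i * measure \<mu> (cyl (Suc n) w)"
        using detailed_balance[OF i j] True
        unfolding measure_markov_cyl[OF case_nat_in_\<Omega>[OF i w]] measure_markov_cyl[OF w]
        by (simp add: prod.lessThan_Suc_shift del: prod.lessThan_Suc)
      ultimately show ?thesis
        using tprob_pos[of j i] by (simp add: M1 M2 emeasure_eq_measure ennreal_mult)
    next
      case False
      then have "?S \<inter> (shift -` cyl (Suc n) w \<inter> \<Omega>) = {}" "?T \<inter> cyl (Suc n) w = {}"
        by (auto simp: cyl_def shift_def)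
      then show ?thesis by (simp add: M1 M2)
    qed
  qed
  moreover have "?S \<inter> (shift -` (shift ` B) \<inter> \<Omega>) = B"
  proof (intro equalityI subsetI)
    fix w assume "w \<in> ?S \<inter> (shift -` (shift ` B) \<inter> \<Omega>)"
    then obtain b where "b \<in> B" "shift w = shift b" "w 0 = b 0" using B(2) by auto
    then show "w \<in> B" using case_nat_shift[of w] case_nat_shift[of b] by metis
  qed (use B in auto)
  moreover have "?T \<inter> shift ` B = shift ` B"
    using B(2) shift_in_\<Omega> by (auto simp: shift_def)
  ultimately have "emeasure \<mu> B = ennreal (tprob x y j i) * emeasure \<mu> (shift ` B)"
    using M1[OF sB] M2[OF sB] by simp
  then have "ennreal (measure \<mu> B) = ennreal (tprob x y j i * measure \<mu> (shift ` B))"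
    using tprob_pos[of j i] by (simp add: emeasure_eq_measure ennreal_mult)
  then show "measure \<mu> B = tprob x y j i * measure \<mu> (shift ` B)"
    using tprob_pos[of j i] by (subst (asm) ennreal_inj) (auto simp: less_imp_le)
qed

end

text \<open>The witnesses of \<open>shift_isomorphic\<close> are made explicit so that the inverse
  map can be treated as an isomorphism in its own right.\<close>

definition isomorphism_on ::
    "(nat \<Rightarrow> nat) measure \<Rightarrow> (nat \<Rightarrow> nat) measure \<Rightarrow> (nat \<Rightarrow> nat) set \<Rightarrow> (nat \<Rightarrow> nat) set
      \<Rightarrow> ((nat \<Rightarrow> nat) \<Rightarrow> (nat \<Rightarrow> nat)) \<Rightarrow> bool" where
  "isomorphism_on \<mu> \<nu> X Y \<Phi> \<longleftrightarrow> X \<in> sets \<B> \<and> Y \<in> sets \<B> \<and>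
     bij_betw \<Phi> X Y \<and> shift ` X \<subseteq> X \<and> shift ` Y \<subseteq> Y \<and> measure \<mu> X = 1 \<and> measure \<nu> Y = 1 \<and>
     \<Phi> \<in> measurable (restrict_space \<B> X) (restrict_space \<B> Y) \<and>
     inv_into X \<Phi> \<in> measurable (restrict_space \<B> Y) (restrict_space \<B> X) \<and>
     (\<forall>\<omega>\<in>X. \<Phi> (shift \<omega>) = shift (\<Phi> \<omega>)) \<and>
     (\<forall>B\<in>sets \<B>. B \<subseteq> X \<longrightarrow> emeasure \<mu> B = emeasure \<nu> (\<Phi> ` B))"

lemma shift_isomorphic_iff: "shift_isomorphic full_mat \<mu> \<nu> \<longleftrightarrow> (\<exists>X Y \<Phi>. isomorphism_on \<mu> \<nu> X Y \<Phi>)"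
proof -
  have "(\<exists>X\<in>S. \<exists>Y\<in>S. \<exists>\<Phi>. R X Y \<Phi>) \<longleftrightarrow> (\<exists>X Y \<Phi>. X \<in> S \<and> Y \<in> S \<and> R X Y \<Phi>)"
    for S :: "'s set" and R :: "'s \<Rightarrow> 's \<Rightarrow> 'f \<Rightarrow> bool"
    by blast
  then show ?thesis
    unfolding shift_isomorphic_def isomorphism_on_def .
qed

text \<open>Since \<open>X\<close> and \<open>Y\<close> are Borel, measurability for the restricted
  spaces reduces to membership of preimages and images in the Borel sets of the whole shift.\<close>

lemma isomorphism_onD:
  assumes "isomorphism_on \<mu> \<nu> X Y \<Phi>"
  shows "X \<in> sets \<B>" "Y \<in> sets \<B>" "bij_betw \<Phi> X Y" "shift ` X \<subseteq> X" "shift ` Y \<subseteq> Y"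
    "measure \<mu> X = 1" "measure \<nu> Y = 1"
    "\<And>w. w \<in> X \<Longrightarrow> \<Phi> (shift w) = shift (\<Phi> w)"
    "\<And>B. B \<in> sets \<B> \<Longrightarrow> B \<subseteq> X \<Longrightarrow> measure \<mu> B = measure \<nu> (\<Phi> ` B)"
    "\<And>C. C \<in> sets \<B> \<Longrightarrow> {w \<in> X. \<Phi> w \<in> C} \<in> sets \<B>"
    "\<And>B. B \<in> sets \<B> \<Longrightarrow> B \<subseteq> X \<Longrightarrow> \<Phi> ` B \<in> sets \<B>"
proof -
  show sets: "X \<in> sets \<B>" "Y \<in> sets \<B>" and bij: "bij_betw \<Phi> X Y"
    and "shift ` X \<subseteq> X" "shift ` Y \<subseteq> Y"
    "measure \<mu> X = 1" "measure \<nu> Y = 1" "\<And>w. w \<in> X \<Longrightarrow> \<Phi> (shift w) = shift (\<Phi> w)"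
    "\<And>B. B \<in> sets \<B> \<Longrightarrow> B \<subseteq> X \<Longrightarrow> measure \<mu> B = measure \<nu> (\<Phi> ` B)"
    using assms unfolding isomorphism_on_def measure_def by auto
  have sub: "X \<subseteq> \<Omega>" "Y \<subseteq> \<Omega>"
    using sets sets.sets_into_space by fastforce+
  have sets_restrict: "A \<in> sets (restrict_space \<B> Z) \<longleftrightarrow> A \<subseteq> Z \<and> A \<in> sets \<B>" if "Z \<in> sets \<B>" for A Z
  proof -
    have "Z \<inter> \<Omega> = Z" using sets.sets_into_space[OF that] by auto
    then show ?thesis using that sets_restrict_space_iff[of Z \<B> A] by simp
  qed
  have space_restrict: "space (restrict_space \<B> Z) = Z" if "Z \<in> sets \<B>" for Z
    using that by (rule space_restrict_space2)
  show "{w \<in> X. \<Phi> w \<in> C} \<in> sets \<B>" if "C \<in> sets \<B>" for C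
  proof -
    have "\<Phi> \<in> measurable (restrict_space \<B> X) (restrict_space \<B> Y)"
      using assms by (simp add: isomorphism_on_def)
    moreover have "C \<inter> Y \<in> sets (restrict_space \<B> Y)"
      using that sets by (simp add: sets_restrict)
    ultimately have "\<Phi> -` (C \<inter> Y) \<inter> X \<in> sets (restrict_space \<B> X)"
      using measurable_sets[of \<Phi> "restrict_space \<B> X" "restrict_space \<B> Y" "C \<inter> Y"]
      by (simp only: space_restrict[OF sets(1)])
    moreover have "\<Phi> -` (C \<inter> Y) \<inter> X = {w \<in> X. \<Phi> w \<in> C}"
      using bij by (auto simp: bij_betw_def)
    ultimately show ?thesis
      using sets by (simp add: sets_restrict)
  qed
  show "\<Phi> ` B \<in> sets \<B>" if B: "B \<in> sets \<B>" "B \<subseteq> X" for B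
  proof -
    have "inv_into X \<Phi> \<in> measurable (restrict_space \<B> Y) (restrict_space \<B> X)"
      using assms by (simp add: isomorphism_on_def)
    moreover have "B \<in> sets (restrict_space \<B> X)"
      using B sets by (simp add: sets_restrict)
    ultimately have "inv_into X \<Phi> -` B \<inter> Y \<in> sets (restrict_space \<B> Y)"
      using measurable_sets[of "inv_into X \<Phi>" "restrict_space \<B> Y" "restrict_space \<B> X" B]
      by (simp only: space_restrict[OF sets(2)])
    moreover have "inv_into X \<Phi> -` B \<inter> Y = \<Phi> ` B"
    proof (intro equalityI subsetI)
      fix v assume "v \<in> inv_into X \<Phi> -` B \<inter> Y"
      then show "v \<in> \<Phi> ` B"
        using bij by (intro image_eqI[of _ _ "inv_into X \<Phi> v"]) (auto simp: bij_betw_inv_into_right)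
    next
      fix v assume "v \<in> \<Phi> ` B"
      then show "v \<in> inv_into X \<Phi> -` B \<inter> Y"
        using bij B(2) by (auto simp: bij_betw_inv_into_left bij_betw_apply)
    qed
    ultimately show ?thesis
      using sets by (simp add: sets_restrict)
  qed
qed

lemma isomorphism_on_inv_into:
  assumes iso: "isomorphism_on \<mu> \<nu> X Y \<Phi>"
  shows "isomorphism_on \<nu> \<mu> Y X (inv_into X \<Phi>)"
proof -
  note D = isomorphism_onD[OF iso]
  let ?\<Psi> = "inv_into X \<Phi>"
  have bij: "bij_betw ?\<Psi> Y X" by (rule bij_betw_inv_into[OF D(3)])
  have "inv_into Y ?\<Psi> w = \<Phi> w" if "w \<in> X" for w
    using D(3) that by (rule inv_into_inv_into_eq)
  moreover have "space (restrict_space \<B> X) = X"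
    using D(1) by (rule space_restrict_space2)
  ultimately have "inv_into Y ?\<Psi> \<in> measurable (restrict_space \<B> X) (restrict_space \<B> Y) \<longleftrightarrow>
      \<Phi> \<in> measurable (restrict_space \<B> X) (restrict_space \<B> Y)"
    by (intro measurable_cong) simp
  then have m: "inv_into Y ?\<Psi> \<in> measurable (restrict_space \<B> X) (restrict_space \<B> Y)"
    "?\<Psi> \<in> measurable (restrict_space \<B> Y) (restrict_space \<B> X)"
    using iso by (simp_all add: isomorphism_on_def)
  have comm: "?\<Psi> (shift v) = shift (?\<Psi> v)" if v: "v \<in> Y" for v
  proof -
    have w: "?\<Psi> v \<in> X" using bij_betw_apply[OF bij v] .
    then have "\<Phi> (shift (?\<Psi> v)) = shift v"
      using D(8) bij_betw_inv_into_right[OF D(3) v] by simp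
    moreover have "shift (?\<Psi> v) \<in> X" using w D(4) by auto
    ultimately show ?thesis
      using bij_betw_inv_into_left[OF D(3)] by metis
  qed
  have em: "emeasure \<nu> C = emeasure \<mu> (?\<Psi> ` C)" if C: "C \<in> sets \<B>" "C \<subseteq> Y" for C
  proof -
    have "?\<Psi> ` C = {w \<in> X. \<Phi> w \<in> C}"
    proof (intro equalityI subsetI)
      fix w assume "w \<in> ?\<Psi> ` C"
      then show "w \<in> {w \<in> X. \<Phi> w \<in> C}"
        using C(2) bij_betw_apply[OF bij] bij_betw_inv_into_right[OF D(3)] by auto
    next
      fix w assume "w \<in> {w \<in> X. \<Phi> w \<in> C}"
      then show "w \<in> ?\<Psi> ` C"
        using bij_betw_inv_into_left[OF D(3)] by (intro image_eqI[of _ _ "\<Phi> w"]) auto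
    qed
    then have "?\<Psi> ` C \<in> sets \<B>" "?\<Psi> ` C \<subseteq> X" using D(10)[OF C(1)] by auto
    moreover have "\<Phi> ` (?\<Psi> ` C) = C"
      using C(2) bij_betw_inv_into_right[OF D(3)] by (force simp: image_image)
    moreover have "\<forall>B\<in>sets \<B>. B \<subseteq> X \<longrightarrow> emeasure \<mu> B = emeasure \<nu> (\<Phi> ` B)"
      using iso by (simp add: isomorphism_on_def)
    ultimately show ?thesis by simp
  qed
  show ?thesis
    unfolding isomorphism_on_def by (intro conjI ballI impI D(1,2,4-7) bij m comm em)
qed

lemma shift_isomorphic_sym:
  "shift_isomorphic full_mat \<mu> \<nu> \<Longrightarrow> shift_isomorphic full_mat \<nu> \<mu>"
  unfolding shift_isomorphic_iff using isomorphism_on_inv_into by blast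

text \<open>The conditional probability of the first symbol given all later ones, hence the
  reciprocal of the factor by which the shift expands the measure. The transition runs backwards
  because of reversibility.\<close>

definition jacobian :: "real \<Rightarrow> real \<Rightarrow> (nat \<Rightarrow> nat) \<Rightarrow> real" where
  "jacobian x y w = tprob x y (w 1) (w 0)"

text \<open>
  On a set where the first two symbols of \<open>w\<close> and of \<open>\<Phi> w\<close> are fixed, the shift is injective on both
  sides and multiplies the measures by the reciprocals of the two Jacobians.
\<close>

lemma isomorphism_preserves_jacobian:
  assumes "markov_params x y" "markov_params x' y'"
    and iso: "isomorphism_on (markov x y) (markov x' y') X Y \<Phi>"
  shows "{w \<in> X. jacobian x y w \<noteq> jacobian x' y' (\<Phi> w)} \<in> null_sets (markov x y)"
proof -
  interpret A: markov_params x y by fact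
  interpret B: markov_params x' y' by fact
  note D = isomorphism_onD[OF iso]
  have X: "X \<subseteq> \<Omega>" using sets.sets_into_space[OF D(1)] by simp
  have Y: "Y \<subseteq> \<Omega>" using sets.sets_into_space[OF D(2)] by simp
  \<comment> \<open>At most 16 pieces, indexed by the two leading symbols of \<open>w\<close> and of
    its image; only those with unequal Jacobians have to be null.\<close>
  define P where "P = (\<lambda>(i, j, k, l). {w \<in> X. w 0 = i \<and> w 1 = j \<and> \<Phi> w 0 = k \<and> \<Phi> w 1 = l})"
  define I :: "(nat \<times> nat \<times> nat \<times> nat) set" where
    "I = {(i, j, k, l). i \<in> {1, 2} \<and> j \<in> {1, 2} \<and> k \<in> {1, 2} \<and> l \<in> {1, 2} \<and> tprob x y j i \<noteq> tprob x' y' l k}"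
  have "I \<subseteq> {1, 2} \<times> {1, 2} \<times> {1, 2} \<times> {1, 2}" by (auto simp: I_def)
  then have finI: "finite I" by (rule finite_subset) simp
  have null: "P t \<in> null_sets (markov x y)" if "t \<in> I" for t
  proof -
    obtain i j k l where t: "t = (i, j, k, l)" by (cases t)
    have ij: "i \<in> {1, 2}" "j \<in> {1, 2}" "k \<in> {1, 2}" "l \<in> {1, 2}"
      and ne: "tprob x y j i \<noteq> tprob x' y' l k"
      using that by (auto simp: I_def t)
    have "P t = {w \<in> X. \<Phi> w \<in> {v \<in> \<Omega>. v 0 = k \<and> v 1 = l}} \<inter> {w \<in> \<Omega>. w 0 = i \<and> w 1 = j}"
      using X Y D(3) by (auto simp: P_def t bij_betw_def)
    then have P: "P t \<in> sets \<B>"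
      using D(10)[OF A.coords_in_\<B>] A.coords_in_\<B> by simp
    have PX: "P t \<subseteq> X" by (auto simp: P_def t)
    have Q: "\<Phi> ` P t \<in> sets \<B>" using D(11)[OF P PX] .
    have 1: "shift ` P t \<in> sets \<B>"
      "measure (markov x y) (P t) = tprob x y j i * measure (markov x y) (shift ` P t)"
      using A.measure_shift_image[OF ij(1,2) P] X by (auto simp: P_def t)
    have 2: "measure (markov x' y') (\<Phi> ` P t) = tprob x' y' l k * measure (markov x' y') (shift ` \<Phi> ` P t)"
      using Y D(3) by (intro B.measure_shift_image[OF ij(3,4) Q]) (auto simp: P_def t bij_betw_def)
    have "shift ` \<Phi> ` P t = \<Phi> ` shift ` P t"
      using D(8) PX by (force simp: image_image)
    moreover have "shift ` P t \<subseteq> X" using PX D(4) by blast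
    ultimately have "measure (markov x y) (P t) = tprob x' y' l k * measure (markov x y) (shift ` P t)"
      using 2 D(9)[OF P PX] D(9)[OF 1(1)] by simp
    \<comment> \<open>The measure of the piece is the measure of its shift image multiplied by
      either of two different factors, so both measures are 0.\<close>
    with 1(2) ne have "measure (markov x y) (shift ` P t) = 0" by simp
    then have "emeasure (markov x y) (P t) = 0"
      using 1(2) by (simp add: A.emeasure_eq_measure)
    then show ?thesis using P by (simp add: null_sets_def)
  qed
  have "{w \<in> X. jacobian x y w \<noteq> jacobian x' y' (\<Phi> w)} = (\<Union>t\<in>I. P t)"
  proof (intro equalityI subsetI)
    fix w assume w: "w \<in> {w \<in> X. jacobian x y w \<noteq> jacobian x' y' (\<Phi> w)}"
    then have "w \<in> \<Omega>" "\<Phi> w \<in> \<Omega>" using X Y bij_betw_apply[OF D(3)] by auto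
    then show "w \<in> (\<Union>t\<in>I. P t)"
      using w by (intro UN_I[of "(w 0, w 1, \<Phi> w 0, \<Phi> w 1)"]) (auto simp: I_def P_def jacobian_def \<Omega>_def)
  qed (auto simp: I_def P_def jacobian_def)
  then show ?thesis
    using null finI by (simp only:) (intro null_sets.finite_UN, auto)
qed

definition jacobian_law :: "real \<Rightarrow> real \<Rightarrow> real \<Rightarrow> real" where
  "jacobian_law x y t = measure (markov x y) {w \<in> \<Omega>. jacobian x y w = t}"

context markov_params
begin

lemma jacobian_level_eq:
  "{w \<in> \<Omega>. jacobian x y w = t} =
    (\<Union>(i, j)\<in>{(i, j) \<in> {1, 2} \<times> {1, 2}. tprob x y j i = t}. {w \<in> \<Omega>. w 0 = i \<and> w 1 = j})"
  by (auto simp: jacobian_def \<Omega>_def)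

lemma jacobian_level_in_\<B>: "{w \<in> \<Omega>. jacobian x y w = t} \<in> sets \<B>"
proof -
  have "finite {(i, j) \<in> {1, 2} \<times> {1, 2 :: nat}. tprob x y j i = t}"
    by (rule finite_subset[of _ "{1, 2} \<times> {1, 2}"]) auto
  then show ?thesis
    unfolding jacobian_level_eq using coords_in_\<B> by (intro sets.finite_UN) auto
qed

lemma measure_coords:
  assumes "i \<in> {1, 2}" "j \<in> {1, 2}"
  shows "measure \<mu> {w \<in> \<Omega>. w 0 = i \<and> w 1 = j} = stat x y i * tprob x y i j"
proof -
  have "case_nat i (\<lambda>_. j) \<in> \<Omega>" using assms by (auto simp: \<Omega>_def split: nat.split)
  then show ?thesis
    using measure_markov_cyl[of "case_nat i (\<lambda>_. j)" 1] cyl_eq_coords[of i j]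
    by (simp add: numeral_2_eq_2)
qed

text \<open>Detailed balance lets the sum be grouped by the second symbol. The separate indicators
  remain correct when values coincide, for example \<open>x = 1 - x\<close>.\<close>

lemma jacobian_law_eq:
  "jacobian_law x y t = stat x y 1 * ((if x = t then x else 0) + (if 1 - x = t then 1 - x else 0)) +
    stat x y 2 * ((if y = t then y else 0) + (if 1 - y = t then 1 - y else 0))"
proof -
  let ?I = "{(i, j) \<in> {1, 2} \<times> {1, 2 :: nat}. tprob x y j i = t}"
  have fin: "finite ?I" by (rule finite_subset[of _ "{1, 2} \<times> {1, 2}"]) auto
  have "jacobian_law x y t = (\<Sum>(i, j)\<in>?I. measure \<mu> {w \<in> \<Omega>. w 0 = i \<and> w 1 = j})"
    unfolding jacobian_law_def jacobian_level_eq case_prod_unfold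
    by (rule finite_measure_finite_Union)
      (use fin coords_in_\<B> in \<open>auto simp: disjoint_family_on_def case_prod_unfold\<close>)
  also have "\<dots> = (\<Sum>(i, j)\<in>?I. stat x y i * tprob x y i j)"
    by (rule sum.cong) (use measure_coords in auto)
  also have "\<dots> = (\<Sum>(i, j)\<in>?I. stat x y j * tprob x y j i)"
    by (rule sum.cong) (use detailed_balance in auto)
  also have "\<dots> = (\<Sum>(i, j)\<in>{1, 2} \<times> {1, 2}. if tprob x y j i = t then stat x y j * tprob x y j i else 0)"
    by (rule sum.mono_neutral_cong_left) (auto split: if_splits)
  also have "\<dots> = (\<Sum>i\<in>{1, 2}. \<Sum>j\<in>{1, 2}. if tprob x y j i = t then stat x y j * tprob x y j i else 0)"
    by (rule sum.cartesian_product[symmetric])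
  also have "\<dots> = stat x y 1 * ((if x = t then x else 0) + (if 1 - x = t then 1 - x else 0)) +
    stat x y 2 * ((if y = t then y else 0) + (if 1 - y = t then 1 - y else 0))"
    by (simp add: tprob_def algebra_simps)
  finally show ?thesis .
qed

end

text \<open>Off a null set, level sets of the Jacobian are mapped into level sets, which yields one
  inequality; the inverse isomorphism supplies the other.\<close>

lemma jacobian_law_le:
  assumes "markov_params x y" "markov_params x' y'"
    and "shift_isomorphic full_mat (markov x y) (markov x' y')"
  shows "jacobian_law x y t \<le> jacobian_law x' y' t"
proof -
  interpret A: markov_params x y by fact
  interpret B: markov_params x' y' by fact
  obtain X Y \<Phi> where iso: "isomorphism_on (markov x y) (markov x' y') X Y \<Phi>"
    using assms(3) unfolding shift_isomorphic_iff by blast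
  note D = isomorphism_onD[OF iso]
  have X: "X \<subseteq> \<Omega>" using sets.sets_into_space[OF D(1)] by simp
  have Y: "Y \<subseteq> \<Omega>" using sets.sets_into_space[OF D(2)] by simp
  define N where "N = {w \<in> X. jacobian x y w \<noteq> jacobian x' y' (\<Phi> w)}"
  have N: "N \<in> null_sets (markov x y)"
    unfolding N_def by (rule isomorphism_preserves_jacobian[OF assms(1,2) iso])
  then have NB: "N \<in> sets \<B>" by (auto dest: null_setsD2)
  define G where "G = {w \<in> \<Omega>. jacobian x y w = t} \<inter> X - N"
  have G: "G \<in> sets \<B>" "G \<subseteq> X"
    using A.jacobian_level_in_\<B> D(1) NB by (auto simp: G_def)
  have X1: "AE w in markov x y. w \<in> X"
    using D(1,6) by (intro A.AE_in_set_eq_1[THEN iffD2]) auto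
  have "jacobian_law x y t = measure (markov x y) G"
    unfolding jacobian_law_def
  proof (rule A.finite_measure_eq_AE)
    show "AE w in markov x y. w \<in> {w \<in> \<Omega>. jacobian x y w = t} \<longleftrightarrow> w \<in> G"
      using X1 AE_not_in[OF N] by eventually_elim (auto simp: G_def)
  qed (use A.jacobian_level_in_\<B> G in auto)
  also have "\<dots> = measure (markov x' y') (\<Phi> ` G)"
    by (rule D(9)[OF G])
  also have "\<dots> \<le> jacobian_law x' y' t"
    unfolding jacobian_law_def
  proof (rule B.finite_measure_mono)
    show "\<Phi> ` G \<subseteq> {w \<in> \<Omega>. jacobian x' y' w = t}"
      using Y bij_betw_apply[OF D(3)] G(2) by (auto simp: G_def N_def)
  qed (use B.jacobian_level_in_\<B> in auto)
  finally show ?thesis .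
qed

context markov_params
begin

lemma markov_params_swap: "markov_params y x"
  using x_pos x_less_1 y_pos y_less_1 by unfold_locales

lemma stat_swap: "stat y x 1 = stat x y 2" "stat y x 2 = stat x y 1"
  by (simp_all add: stat_def algebra_simps)

lemma jacobian_law_swap: "jacobian_law y x t = jacobian_law x y t"
  unfolding jacobian_law_eq markov_params.jacobian_law_eq[OF markov_params_swap] stat_swap by simp

lemma jacobian_law_pos_iff: "jacobian_law x y t > 0 \<longleftrightarrow> t \<in> {x, 1 - x, y, 1 - y}"
proof -
  have sum_pos: "0 < (if a = t then a else 0) + (if 1 - a = t then 1 - a else 0) \<longleftrightarrow> t \<in> {a, 1 - a}"
    "0 \<le> (if a = t then a else 0) + (if 1 - a = t then 1 - a else 0)" if "0 < a" "a < 1" for a :: real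
    using that by auto
  have add_pos_iff: "0 < u + v \<longleftrightarrow> 0 < u \<or> 0 < v" if "0 \<le> u" "0 \<le> v" for u v :: real
    using that by linarith
  show ?thesis
    unfolding jacobian_law_eq
    using x_pos x_less_1 y_pos y_less_1 stat_pos[of 1] stat_pos[of 2]
    by (subst add_pos_iff) (auto simp: zero_less_mult_iff sum_pos intro!: mult_nonneg_nonneg less_imp_le)
qed

text \<open>The value \<open>x\<close> is attained only while the later symbol is the one belonging
  to \<open>x\<close>, so its mass determines \<open>stat\<close>, whether or not \<open>x\<close>
  was replaced by \<open>1 - x\<close>. Equal \<open>stat\<close> means equal ratios of
  \<open>1 - x\<close> to \<open>1 - y\<close>, which rules out a single replacement and, as
  \<open>x \<noteq> y\<close>, a double one.\<close>

lemma jacobian_law_determines_aligned_params: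
  assumes P: "markov_params x' y'" and law: "\<And>t. jacobian_law x y t = jacobian_law x' y' t"
    and ne: "x \<noteq> y" "x + y \<noteq> 1" and x': "x' \<in> {x, 1 - x}" and y': "y' \<in> {y, 1 - y}"
  shows "x' = x \<and> y' = y"
proof -
  interpret P: markov_params x' y' by fact
  have c: "x + (if 1 - x = x then 1 - x else 0) > 0" using x_pos by simp
  have "stat x y 1 * (x + (if 1 - x = x then 1 - x else 0)) =
      stat x' y' 1 * (x + (if 1 - x = x then 1 - x else 0))"
    using law[of x] ne x' y' unfolding jacobian_law_eq P.jacobian_law_eq by (elim insertE) auto
  then have "stat x y 1 = stat x' y' 1" using c by simp
  then have "(1 - y) * (2 - x' - y') = (1 - y') * (2 - x - y)"
    using x_less_1 y_less_1 P.x_less_1 P.y_less_1 by (simp add: stat_def frac_eq_eq)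
  then have eq: "(1 - y) * (1 - x') = (1 - y') * (1 - x)" by (simp add: algebra_simps)
  consider "x' = x" | "y' = y" | "x' = 1 - x" "y' = 1 - y" using x' y' by auto
  then show ?thesis
  proof cases
    case 1
    then show ?thesis using eq x_less_1 by simp
  next
    case 2
    then show ?thesis using eq y_less_1 by simp
  next
    case 3
    have "x = y" using eq unfolding 3 by (simp add: algebra_simps)
    with ne show ?thesis by simp
  qed
qed

end

theorem isomorphism_determines_params:
  assumes "markov_params x y" "markov_params x' y'"
    and iso: "shift_isomorphic full_mat (markov x y) (markov x' y')"
    and generic: "x + y = 1 \<Longrightarrow> x = 1 / 2" "x = y \<Longrightarrow> x = 1 / 2"
  shows "(x' = x \<and> y' = y) \<or> (x' = y \<and> y' = x)"
proof -
  interpret A: markov_params x y by fact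
  interpret B: markov_params x' y' by fact
  have law: "jacobian_law x y t = jacobian_law x' y' t" for t
    using jacobian_law_le[OF assms(1,2) iso] jacobian_law_le[OF assms(2,1) shift_isomorphic_sym[OF iso]]
    by (rule antisym)
  have supp: "t \<in> {x, 1 - x, y, 1 - y} \<longleftrightarrow> t \<in> {x', 1 - x', y', 1 - y'}" for t
    using law[of t] A.jacobian_law_pos_iff[of t] B.jacobian_law_pos_iff[of t] by simp
  show ?thesis
  proof (cases "x = y \<or> x + y = 1")
    case True
    then have "x = 1 / 2" "y = 1 / 2" using generic by auto
    then show ?thesis using supp[of x'] supp[of y'] by auto
  next
    case False
    then have ne: "x \<noteq> y" "x + y \<noteq> 1" by auto
    have "(x' \<in> {x, 1 - x} \<and> y' \<in> {y, 1 - y}) \<or> (x' \<in> {y, 1 - y} \<and> y' \<in> {x, 1 - x})"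
      using supp[of x] supp[of y] supp[of x'] supp[of y'] ne by auto
    then show ?thesis
    proof
      assume "x' \<in> {x, 1 - x} \<and> y' \<in> {y, 1 - y}"
      then show ?thesis
        using A.jacobian_law_determines_aligned_params[OF assms(2) law ne] by blast
    next
      assume "x' \<in> {y, 1 - y} \<and> y' \<in> {x, 1 - x}"
      then show ?thesis
        using A.jacobian_law_determines_aligned_params[OF B.markov_params_swap _ ne] law B.jacobian_law_swap
        by simp
    qed
  qed
qed

subsection \<open>Exchanging the symbols\<close>

text \<open>An involution is its own inverse, so one measurability proof serves both directions. It
  is used for the identity and for the exchange of symbols.\<close>

lemma isomorphism_on_involution:
  assumes \<mu>: "prob_space \<mu>" "sets \<mu> = sets \<B>" and \<nu>: "prob_space \<nu>" "sets \<nu> = sets \<B>"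
    and T: "T \<in> measurable \<B> \<B>" "\<And>w. w \<in> \<Omega> \<Longrightarrow> T (T w) = w" "\<And>w. w \<in> \<Omega> \<Longrightarrow> T (shift w) = shift (T w)"
    and distr: "distr \<nu> \<B> T = \<mu>"
  shows "isomorphism_on \<mu> \<nu> \<Omega> \<Omega> T"
proof -
  have T\<Omega>: "T w \<in> \<Omega>" if "w \<in> \<Omega>" for w
    using measurable_space[OF T(1)] that by simp
  have bij: "bij_betw T \<Omega> \<Omega>"
    by (rule bij_betw_byWitness[where f' = T]) (use T T\<Omega> in auto)
  have inv: "inv_into \<Omega> T w = T w" if "w \<in> \<Omega>" for w
    using that bij T(2) T\<Omega> by (metis bij_betw_inv_into_left)
  have sets_restrict: "B \<in> sets (restrict_space \<B> \<Omega>) \<longleftrightarrow> B \<in> sets \<B>" for B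
    using sets_restrict_space_iff[of \<Omega> \<B> B] sets.sets_into_space[of B \<B>] by auto
  have restrict: "restrict_space \<B> \<Omega> = \<B>"
  proof (rule measure_eqI)
    fix B assume "B \<in> sets (restrict_space \<B> \<Omega>)"
    then have "B \<subseteq> \<Omega>" using sets.sets_into_space[of B \<B>] sets_restrict by auto
    then show "emeasure (restrict_space \<B> \<Omega>) B = emeasure \<B> B"
      by (intro emeasure_restrict_space) simp_all
  qed (use sets_restrict in blast)
  have "inv_into \<Omega> T \<in> measurable \<B> \<B> \<longleftrightarrow> T \<in> measurable \<B> \<B>"
    by (rule measurable_cong) (simp add: inv)
  moreover have "emeasure \<mu> B = emeasure \<nu> (T ` B)" if B: "B \<in> sets \<B>" for B
  proof -
    have sub: "B \<subseteq> \<Omega>" using sets.sets_into_space[OF B] by simp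
    have "T ` B = T -` B \<inter> \<Omega>"
    proof (intro equalityI subsetI)
      fix v assume "v \<in> T -` B \<inter> \<Omega>"
      then show "v \<in> T ` B" using T(2) by (intro image_eqI[of _ _ "T v"]) auto
    qed (use sub T T\<Omega> in auto)
    moreover have "T \<in> measurable \<nu> \<B>" using T(1) measurable_cong_sets[OF \<nu>(2) refl] by blast
    ultimately show ?thesis
      using B sets_eq_imp_space_eq[OF \<nu>(2)] by (simp add: emeasure_distr flip: distr)
  qed
  moreover have "measure \<mu> \<Omega> = 1" "measure \<nu> \<Omega> = 1"
    using prob_space.prob_space[OF \<mu>(1)] prob_space.prob_space[OF \<nu>(1)]
      sets_eq_imp_space_eq[OF \<mu>(2)] sets_eq_imp_space_eq[OF \<nu>(2)] by simp_all
  ultimately show ?thesis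
    unfolding isomorphism_on_def restrict using bij T shift_in_\<Omega> by auto
qed

lemma vimage_swap_cyl: "swap_symbols -` cyl n w \<inter> \<Omega> = cyl n (swap_symbols w)"
proof (intro equalityI subsetI)
  fix v assume v: "v \<in> cyl n (swap_symbols w)"
  then have "v \<in> \<Omega>" using cyl_subset by blast
  then show "v \<in> swap_symbols -` cyl n w \<inter> \<Omega>" using v swap_in_cyl_iff by simp
qed (use swap_in_cyl_iff in auto)

lemma measurable_swap_symbols: "swap_symbols \<in> measurable \<B> \<B>"
proof (rule measurable_\<B>I)
  fix n and w :: "nat \<Rightarrow> nat"
  show "swap_symbols -` cyl n w \<inter> space \<B> \<in> sets \<B>" by (simp add: vimage_swap_cyl)
qed (simp add: swap_in_\<Omega>)

context markov_params
begin

lemma distr_markov_swap: "distr (markov x y) \<B> swap_symbols = markov y x"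
proof (rule measure_eqI_cyl)
  interpret S: markov_params y x by (rule markov_params_swap)
  show "sets (markov y x) = sets \<B>" by simp
  have [measurable]: "swap_symbols \<in> measurable (markov x y) \<B>"
    using measurable_swap_symbols measurable_cong_sets[OF sets_markov refl] by blast
  have *: "emeasure (distr (markov x y) \<B> swap_symbols) (cyl n w) = emeasure (markov x y) (cyl n (swap_symbols w))" for n w
    by (simp add: emeasure_distr vimage_swap_cyl)
  show "emeasure (distr (markov x y) \<B> swap_symbols) \<Omega> \<noteq> \<infinity>"
    using *[of 0] by (simp add: emeasure_eq_measure)
  fix n and w :: "nat \<Rightarrow> nat" assume w: "w \<in> \<Omega>"
  have i: "stat x y (swap_symbols w k) = stat y x (w k)"
    "tprob x y (swap_symbols w k) (swap_symbols w l) = tprob y x (w k) (w l)" for k l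
    using \<Omega>_cases[OF w, of k] \<Omega>_cases[OF w, of l] stat_swap
    by (auto simp: swap_symbols_def tprob_def)
  have "measure (markov x y) (cyl (Suc n) (swap_symbols w)) = measure (markov y x) (cyl (Suc n) w)"
    by (simp only: measure_markov_cyl[OF swap_in_\<Omega>[OF w]] S.measure_markov_cyl[OF w] i)
  then show "emeasure (distr (markov x y) \<B> swap_symbols) (cyl (Suc n) w) = emeasure (markov y x) (cyl (Suc n) w)"
    by (simp add: * emeasure_eq_measure S.emeasure_eq_measure)
qed simp

lemma shift_isomorphic_self: "shift_isomorphic full_mat (markov x y) (markov x y)"
proof -
  have "distr (markov x y) \<B> (\<lambda>w. w) = markov x y"
    by (rule distr_id2) simp
  then have "isomorphism_on (markov x y) (markov x y) \<Omega> \<Omega> (\<lambda>w. w)"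
    by (intro isomorphism_on_involution) (auto intro: prob_space_axioms)
  then show ?thesis unfolding shift_isomorphic_iff by blast
qed

lemma shift_isomorphic_swap: "shift_isomorphic full_mat (markov x y) (markov y x)"
proof -
  interpret S: markov_params y x by (rule markov_params_swap)
  have "isomorphism_on (markov x y) (markov y x) \<Omega> \<Omega> swap_symbols"
  proof (rule isomorphism_on_involution)
    show "swap_symbols (shift w) = shift (swap_symbols w)" for w
      by (simp add: swap_symbols_def shift_def)
  qed (simp_all add: prob_space_axioms S.prob_space_axioms measurable_swap_symbols
      S.distr_markov_swap swap_swap)
  then show ?thesis unfolding shift_isomorphic_iff by blast
qed

lemma null_sets_vimage_shift:
  assumes "N \<in> null_sets (markov x y)"
  shows "shift -` N \<inter> \<Omega> \<in> null_sets (markov x y)"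
proof -
  have N: "N \<in> sets \<B>" using assms by auto
  have "shift \<in> measurable (markov x y) \<B>" by measurable
  then have "emeasure (markov x y) (shift -` N \<inter> \<Omega>) = emeasure (distr (markov x y) \<B> shift) N"
    using N by (simp add: emeasure_distr)
  then show ?thesis
    using assms measurable_sets[OF measurable_shift N] by (simp add: markov_shift null_sets_def)
qed

end

subsection \<open>The Bernoulli and the symmetric Markov measure are not isomorphic\<close>

text \<open>
  The Jacobians along the orbit of \<open>w\<close> determine \<open>w\<close> for the Bernoulli measure, but only
  \<open>differences w\<close> for the symmetric one, so an isomorphism would not separate \<open>w\<close> from its
  image under the exchange of symbols.
\<close>

lemma bernoulli_symmetric_not_isomorphic:
  assumes p: "0 < p" "p < 1" "p \<noteq> 1 / 2"
  shows "\<not> shift_isomorphic full_mat (markov p (1 - p)) (markov p p)"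
proof
  assume "shift_isomorphic full_mat (markov p (1 - p)) (markov p p)"
  then obtain X Y \<Phi> where iso: "isomorphism_on (markov p (1 - p)) (markov p p) X Y \<Phi>"
    unfolding shift_isomorphic_iff by blast
  interpret A: markov_params p "1 - p" using p by unfold_locales auto
  interpret B: markov_params p p using p by unfold_locales auto
  let ?\<mu> = "markov p (1 - p)" and ?\<nu> = "markov p p"
  note D = isomorphism_onD[OF iso]
  have X: "X \<subseteq> \<Omega>" using sets.sets_into_space[OF D(1)] by simp
  have Y: "Y \<subseteq> \<Omega>" using sets.sets_into_space[OF D(2)] by simp
  define N where "N = {w \<in> X. jacobian p (1 - p) w \<noteq> jacobian p p (\<Phi> w)}"
  have N: "N \<in> null_sets ?\<mu>"
    unfolding N_def
    by (rule isomorphism_preserves_jacobian[OF A.markov_params_axioms B.markov_params_axioms iso])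
  \<comment> \<open>Agreement of the Jacobians is needed at every time along the orbit; by
    invariance the exceptional sets for all times are null.\<close>
  define NN where "NN k = (shift ^^ k) -` N \<inter> \<Omega>" for k
  have NN: "NN k \<in> null_sets ?\<mu>" for k
  proof (induction k)
    case 0
    have "N \<subseteq> \<Omega>" using X by (auto simp: N_def)
    then show ?case using N by (simp add: NN_def Int_absorb2)
  next
    case (Suc k)
    have "NN (Suc k) = shift -` NN k \<inter> \<Omega>"
      using shift_in_\<Omega> by (auto simp: NN_def funpow_Suc_right simp del: funpow.simps)
    then show ?case using A.null_sets_vimage_shift[OF Suc] by simp
  qed
  define G where "G = X - (\<Union>k. NN k)"
  have NU: "(\<Union>k. NN k) \<in> null_sets ?\<mu>" by (rule null_sets_UN) (rule NN)
  then have "(\<Union>k. NN k) \<in> sets \<B>" by (auto dest: null_setsD2)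
  then have G: "G \<in> sets \<B>" "G \<subseteq> X" using D(1) by (auto simp: G_def)
  have "measure ?\<mu> G = measure ?\<mu> X"
    unfolding G_def using D(1) NU by (intro measure_Diff_null_set) auto
  then have \<nu>G: "measure ?\<nu> (\<Phi> ` G) = 1" using D(6) D(9)[OF G] by simp
  have \<Phi>G: "\<Phi> ` G \<in> sets \<B>" by (rule D(11)[OF G])
  have recover: "w = differences (\<Phi> w)" if w: "w \<in> G" for w
  proof (rule ext)
    fix k
    have wX: "(shift ^^ j) w \<in> X \<and> \<Phi> ((shift ^^ j) w) = (shift ^^ j) (\<Phi> w)" for j
    proof (induction j)
      case 0
      then show ?case using w G by auto
    next
      case (Suc j)
      then show ?case using D(4,8) by auto
    qed
    have "w \<in> \<Omega>" "\<Phi> w \<in> \<Omega>" using w G X Y bij_betw_apply[OF D(3)] by auto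
    have "(shift ^^ k) w \<notin> N"
      using w \<open>w \<in> \<Omega>\<close> by (auto simp: G_def NN_def)
    then have "jacobian p (1 - p) ((shift ^^ k) w) = jacobian p p ((shift ^^ k) (\<Phi> w))"
      using wX[of k] by (auto simp: N_def)
    \<comment> \<open>The left side depends only on \<open>w k\<close>, the right side only on
      whether two consecutive symbols of the image agree. Since \<open>p\<close> and
      \<open>1 - p\<close> differ, the two pieces of information coincide.\<close>
    then have "tprob p (1 - p) (w (Suc k)) (w k) = tprob p p (\<Phi> w (Suc k)) (\<Phi> w k)"
      by (simp add: jacobian_def shift_funpow)
    then show "w k = differences (\<Phi> w) k"
      using \<Omega>_cases[OF \<open>w \<in> \<Omega>\<close>, of k] \<Omega>_cases[OF \<open>w \<in> \<Omega>\<close>, of "Suc k"]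
        \<Omega>_cases[OF \<open>\<Phi> w \<in> \<Omega>\<close>, of k] \<Omega>_cases[OF \<open>\<Phi> w \<in> \<Omega>\<close>, of "Suc k"] p(3)
      by (elim disjE) (simp_all add: tprob_def differences_def)
  qed
  \<comment> \<open>The symmetric measure is invariant under the exchange of symbols, so
    \<open>S\<close> also has full measure and must meet the image of \<open>G\<close>.\<close>
  define S where "S = swap_symbols -` (\<Phi> ` G) \<inter> \<Omega>"
  have S: "S \<in> sets \<B>" unfolding S_def using measurable_sets[OF measurable_swap_symbols \<Phi>G] by simp
  have "swap_symbols \<in> measurable ?\<nu> \<B>"
    using measurable_swap_symbols measurable_cong_sets[OF B.sets_markov refl] by blast
  then have \<nu>S: "measure ?\<nu> S = 1"
    using \<nu>G \<Phi>G measure_distr[of swap_symbols ?\<nu> \<B> "\<Phi> ` G"] by (simp add: S_def B.distr_markov_swap)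
  have "\<Phi> ` G \<inter> S \<noteq> {}"
  proof
    assume "\<Phi> ` G \<inter> S = {}"
    then have "measure ?\<nu> (\<Phi> ` G \<union> S) = 2"
      using B.finite_measure_Union[of "\<Phi> ` G" S] \<Phi>G S \<nu>G \<nu>S by simp
    then show False using B.prob_le_1[of "\<Phi> ` G \<union> S"] by simp
  qed
  then obtain v where v: "v \<in> \<Phi> ` G" "swap_symbols v \<in> \<Phi> ` G" "v \<in> \<Omega>" by (auto simp: S_def)
  then obtain w w' where w: "w \<in> G" "v = \<Phi> w" and w': "w' \<in> G" "swap_symbols v = \<Phi> w'" by auto
  have "differences (swap_symbols v) = differences v"
  proof (rule ext)
    fix k
    show "differences (swap_symbols v) k = differences v k"
      using \<Omega>_cases[OF v(3), of k] \<Omega>_cases[OF v(3), of "Suc k"]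
      by (elim disjE) (simp_all add: differences_def swap_symbols_def)
  qed
  then have "w = w'"
    using recover[OF w(1)] recover[OF w'(1)] w w' by simp
  then have "swap_symbols v 0 = v 0" using w w' by simp
  then show False
    using \<Omega>_cases[OF v(3), of 0] by (auto simp: swap_symbols_def)
qed

section \<open>Comparison of the two equivalence classes\<close>

lemma mat_of_rows_list_2_eq_iff:
  "mat_of_rows_list 2 [[p, q], [r, s]] = mat_of_rows_list 2 [[p', q'], [r', s']] \<longleftrightarrow>
    p = p' \<and> q = q' \<and> r = r' \<and> s = s'"
proof
  assume eq: "mat_of_rows_list 2 [[p, q], [r, s]] = mat_of_rows_list 2 [[p', q'], [r', s']]"
  have "mat_of_rows_list 2 [[p, q], [r, s]] $$ (i, j) = mat_of_rows_list 2 [[p', q'], [r', s']] $$ (i, j)" for i j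
    by (simp only: eq)
  from this[of 0 0] this[of 0 1] this[of 1 0] this[of 1 1]
  show "p = p' \<and> q = q' \<and> r = r' \<and> s = s'"
    unfolding mat_of_rows_list_2 by simp
qed simp

lemma spectrum_eq_iff_isomorphic:
  assumes "markov_params x y" "markov_params x' y'"
    and generic: "x + y = 1 \<Longrightarrow> x = 1 / 2" "x = y \<Longrightarrow> x = 1 / 2"
  shows "entropy_spectrum full_mat (markov x y) = entropy_spectrum full_mat (markov x' y') \<longleftrightarrow>
    shift_isomorphic full_mat (markov x y) (markov x' y')" (is "?spec \<longleftrightarrow> ?iso")
proof -
  interpret A: markov_params x y by fact
  have "(x' = x \<and> y' = y) \<or> (x' = y \<and> y' = x)" if "?spec \<or> ?iso"
    using that spectrum_determines_params[OF assms(1,2) _ generic]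
      isomorphism_determines_params[OF assms(1,2) _ generic] by blast
  moreover have "?spec \<and> ?iso" if "(x' = x \<and> y' = y) \<or> (x' = y \<and> y' = x)"
    using that entropy_spectrum_swap[OF assms(1)] A.shift_isomorphic_self A.shift_isomorphic_swap by auto
  ultimately show ?thesis by blast
qed

text \<open>The partner keeps \<open>x\<close> and is the other exceptional chain: the symmetric one
  for a Bernoulli measure, and conversely.\<close>

lemma spectrum_eq_not_isomorphic:
  assumes xy: "markov_params x y" and special: "x + y = 1 \<or> x = y" "x \<noteq> 1 / 2"
  obtains x' y' where "markov_params x' y'"
    "entropy_spectrum full_mat (markov x y) = entropy_spectrum full_mat (markov x' y')"
    "\<not> shift_isomorphic full_mat (markov x y) (markov x' y')"
proof -
  interpret markov_params x y by fact
  have spec: "entropy_spectrum full_mat (markov x x) = entropy_spectrum full_mat (markov x (1 - x))"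
    using entropy_spectrum_bernoulli_symmetric x_pos x_less_1 by simp
  have not_iso: "\<not> shift_isomorphic full_mat (markov x (1 - x)) (markov x x)"
    using bernoulli_symmetric_not_isomorphic x_pos x_less_1 special(2) by simp
  have params: "markov_params x x" "markov_params x (1 - x)"
    using x_pos x_less_1 by (unfold_locales; simp)+
  from special(1) show ?thesis
  proof
    assume "x + y = 1"
    then have "y = 1 - x" by simp
    then show ?thesis using that[of x x] params spec not_iso by simp
  next
    assume "x = y"
    then show ?thesis using that[of x "1 - x"] params spec not_iso shift_isomorphic_sym by metis
  qed
qed

theorem corollary3p5:
  fixes A :: "nat mat" and \<C> E :: "((nat \<Rightarrow> nat) \<Rightarrow> real) set" and P\<^sub>1 P\<^sub>2 :: "real \<Rightarrow> real mat"
  defines "A \<equiv> mat_of_rows_list 2 [[1, 1], [1, 1]]"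
    and "\<C> \<equiv> locally_constant 2 A"
    and "P\<^sub>1 \<equiv> \<lambda>\<alpha>. mat_of_rows_list 2 [[1 - \<alpha>, \<alpha>], [1 - \<alpha>, \<alpha>]]"
    and "P\<^sub>2 \<equiv> \<lambda>\<alpha>. mat_of_rows_list 2 [[1 - \<alpha>, \<alpha>], [\<alpha>, 1 - \<alpha>]]"
    and "E \<equiv> {f \<in> \<C>. \<forall>\<alpha>\<in>{0<..<1}. \<alpha> \<noteq> 1 / 2 \<longrightarrow>
                 stochastic_matrix A f \<noteq> P\<^sub>1 \<alpha> \<and> stochastic_matrix A f \<noteq> P\<^sub>2 \<alpha>}"
  shows "{f \<in> \<C>. isomorphism_class A \<C> f = spectrum_class A \<C> f} = E"
proof -
  have A: "A = full_mat" by (simp add: A_def full_mat_def)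
  have "isomorphism_class A \<C> f = spectrum_class A \<C> f \<longleftrightarrow> f \<in> E" if f: "f \<in> \<C>" for f
  proof -
    obtain x y c u where xy: "markov_params x y"
      and mat: "stochastic_matrix full_mat f = mat_of_rows_list 2 [[x, 1 - x], [1 - y, y]]"
      and fx: "\<And>w. w \<in> \<Omega> \<Longrightarrow> f w = ln (tprob x y (w 0) (w 1)) + c + u (w 0) - u (w 1)"
      using locally_constant_stochastic f unfolding \<C>_def A by metis
    interpret markov_params x y by fact
    have gibbs: "gibbs_measure full_mat f = markov x y"
      by (rule gibbs_measure_eq_markov[OF fx])
    \<comment> \<open>With \<open>x = 1 - \<alpha>\<close>, \<open>P\<^sub>1 \<alpha>\<close> is the
      Bernoulli and \<open>P\<^sub>2 \<alpha>\<close> the symmetric chain; the excluded value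
      \<open>1 / 2\<close> is the uniform measure, common to both families.\<close>
    have "f \<in> E \<longleftrightarrow> (\<forall>\<alpha>\<in>{0<..<1}. \<alpha> \<noteq> 1 / 2 \<longrightarrow>
        \<not> (x = 1 - \<alpha> \<and> y = \<alpha>) \<and> \<not> (x = 1 - \<alpha> \<and> y = 1 - \<alpha>))"
    proof -
      have "stochastic_matrix A f \<noteq> P\<^sub>1 \<alpha> \<and> stochastic_matrix A f \<noteq> P\<^sub>2 \<alpha> \<longleftrightarrow>
          \<not> (x = 1 - \<alpha> \<and> y = \<alpha>) \<and> \<not> (x = 1 - \<alpha> \<and> y = 1 - \<alpha>)" for \<alpha>
        unfolding A mat P\<^sub>1_def P\<^sub>2_def mat_of_rows_list_2_eq_iff by auto
      then show ?thesis unfolding E_def using f by simp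
    qed
    also have "\<dots> \<longleftrightarrow> (x + y = 1 \<longrightarrow> x = 1 / 2) \<and> (x = y \<longrightarrow> x = 1 / 2)"
    proof (intro iffI conjI impI ballI)
      assume *: "\<forall>\<alpha>\<in>{0<..<1}. \<alpha> \<noteq> 1 / 2 \<longrightarrow>
          \<not> (x = 1 - \<alpha> \<and> y = \<alpha>) \<and> \<not> (x = 1 - \<alpha> \<and> y = 1 - \<alpha>)"
      show "x = 1 / 2" if "x + y = 1"
        using *[rule_format, of y] that y_pos y_less_1 by force
      show "x = 1 / 2" if "x = y"
        using *[rule_format, of "1 - x"] that x_pos x_less_1 by force
    next
      fix \<alpha> :: real assume "(x + y = 1 \<longrightarrow> x = 1 / 2) \<and> (x = y \<longrightarrow> x = 1 / 2)" "\<alpha> \<noteq> 1 / 2"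
      then show "\<not> (x = 1 - \<alpha> \<and> y = \<alpha>)" "\<not> (x = 1 - \<alpha> \<and> y = 1 - \<alpha>)" by auto
    qed
    finally have E: "f \<in> E \<longleftrightarrow> (x + y = 1 \<longrightarrow> x = 1 / 2) \<and> (x = y \<longrightarrow> x = 1 / 2)" .
    show ?thesis
    proof (cases "f \<in> E")
      case True
      have "shift_isomorphic full_mat (gibbs_measure full_mat f) (gibbs_measure full_mat g) \<longleftrightarrow>
          entropy_spectrum full_mat (gibbs_measure full_mat f) = entropy_spectrum full_mat (gibbs_measure full_mat g)"
        if g: "g \<in> \<C>" for g
      proof -
        obtain x' y' c' u' where xy': "markov_params x' y'"
          and gx: "\<And>w. w \<in> \<Omega> \<Longrightarrow> g w = ln (tprob x' y' (w 0) (w 1)) + c' + u' (w 0) - u' (w 1)"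
          using locally_constant_stochastic g unfolding \<C>_def A by metis
        have "gibbs_measure full_mat g = markov x' y'"
          by (rule markov_params.gibbs_measure_eq_markov[OF xy' gx])
        then show ?thesis
          using spectrum_eq_iff_isomorphic[OF xy xy'] True E by (simp add: gibbs)
      qed
      then show ?thesis
        using True by (auto simp: isomorphism_class_def spectrum_class_def A)
    next
      case False
      then have "x + y = 1 \<or> x = y" "x \<noteq> 1 / 2" using E by auto
      then obtain x' y' where xy': "markov_params x' y'"
        "entropy_spectrum full_mat (markov x y) = entropy_spectrum full_mat (markov x' y')"
        "\<not> shift_isomorphic full_mat (markov x y) (markov x' y')"
        using spectrum_eq_not_isomorphic[OF xy] by blast
      obtain g where "g \<in> \<C>" "gibbs_measure full_mat g = markov x' y'"
        using locally_constant_markov[OF xy'(1)] unfolding \<C>_def A by blast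
      then have "g \<in> spectrum_class A \<C> f" "g \<notin> isomorphism_class A \<C> f"
        using xy' by (auto simp: isomorphism_class_def spectrum_class_def A gibbs)
      then show ?thesis using False by blast
    qed
  qed
  then show ?thesis unfolding E_def by blast
qed

end
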